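(* Let $L\subset \mathrm{Osc}_1$ be a basic lattice, let $X:=L\backslash \mathrm{Osc}_1$, and fix a spin structure on $X$, i.e. a homomorphism $\varepsilon:L\to\mathbb Z/2\mathbb Z$. Let $D^{1/3}:L^2(\Sigma(X))\to L^2(\Sigma(X))$ be the cubic Dirac operator for this spin structure. Then: (1) the spectrum of $D^{1/3}$ is equal to $\mathbb C$; (2) the point spectrum of $D^{1/3}$ (which in general depends on the spin structure) consists of $0$ if the kernel of $\Omega$ on $L^2(\Sigma(X))$ is non-trivial, together with the two complex square roots of each of the non-zero eigenvalues of $-\Omega$ on $L^2(\Sigma(X))$ (and it contains no other points); (3) the residual spectrum of $D^{1/3}$ is empty.
   Context: Oscillator group. $\mathrm{Osc}_1$ is the set $\mathbb C\times\mathbb R\times\mathbb R$ with multiplication $(\xi_1,z_1,t_1)(\xi_2,z_2,t_2)=(\xi_1+e^{it_1}\xi_2,\ z_1+z_2+\tfrac12\omega(\xi_1,e^{it_1}\xi_2),\ t_1+t_2)$, where $\omega(\xi_1,\xi_2)=\mathrm{Im}(\overline{\xi_1}\xi_2)$. Let $H=\{(\xi,z,0)\}$ (Heisenberg group) with centre $Z(H)=\{(0,z,0)\}$. The Lie algebra has basis $X,Y,Z,T$, tangent at the identity to $s\mapsto(s,0,0),(is,0,0),(0,s,0),(0,0,s)$, with non-vanishing brackets $[T,X]=Y$, $[T,Y]=-X$, $[X,Y]=Z$. It carries the ad-invariant Lorentzian scalar product with $\langle X,X\rangle=\langle Y,Y\rangle=\langle Z,T\rangle=1$ and all other products of basis vectors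 (up to symmetry) equal to $0$; this induces a bi-invariant Lorentzian metric on $\mathrm{Osc}_1$, whose volume measure is Lebesgue measure. (The quotient manifold is also denoted $X$; no confusion should arise.) Basic lattices. A lattice is a discrete cocompact subgroup. A lattice $L\subset\mathrm{Osc}_1$ is normalised if the projection of $L\cap H$ to $H/Z(H)\cong\mathbb C\cong\mathbb R^2$ has covolume one for the standard metric. A basic lattice is a normalised lattice generated by a lattice in $H$ and an element $(0,0,2\pi\kappa)$ with $\kappa\in\mathbb N_{>0}$. Spinors. Spin structures on $L\backslash\mathrm{Osc}_1$ (with the induced metric) correspond to homomorphisms $\varepsilon:L\to\mathbb Z/2\mathbb Z$. Let $\Delta=\mathbb C^4$ be the spinor module, with standard basis $u_1,\dots,u_4$ and Clifford multiplication given by $Z=\begin{pmatrix}A&0\\0&A\end{pmatrix}$, $T=\begin{pmatrix}B&0\\0&B\end{pmatrix}$, $X=\begin{pmatrix}0&C\\C&0\end{pmatrix}$, $Y=\begin{pmatrix}0&iC\\-iC&0\end{pmatrix}$, where $A=\begin{pmatrix}0&0\\\sqrt2&0\end{pmatrix}$, $B=\begin{pmatrix}0&-\sqrt2\\0&0\end{pmatrix}$, $C=\begin{pmatrix}-i&0\\0&i\end{pmatrix}$ (so $v\cdot v=-\langle v,v\rangle$). Sections of the spinor bundle $\Sigma(L\backslash\mathrm{Osc}_1)$ are identified with functions $\psi:\mathrm{Osc}_1\to\Delta$ satisfying $\psi(lg)=(-1)^{\varepsilon(l)}\psi(g)$ for all $l\in L$. $L^2(\Sigma(L\backslash\mathrm{Osc}_1))$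 is the space of square-integrable such sections over $L\backslash\mathrm{Osc}_1$, with the Hilbert norm obtained from the Hermitian product on $\Delta$ for which $u_1,\dots,u_4$ is orthonormal. Operators. For a Lie algebra element $V$ and a smooth section $\psi$, $V(\psi)(g)=\frac{d}{ds}|_{s=0}\psi(g\exp(sV))$. The cubic Dirac operator is the closure of the operator given on smooth sections by $D^{1/3}\psi=X\cdot X(\psi)+Y\cdot Y(\psi)+Z\cdot T(\psi)+T\cdot Z(\psi)+\tfrac12XYZ\cdot\psi$, where a dot and the product $XYZ$ denote Clifford multiplication. The Casimir operator is $\Omega=X^2+Y^2+2ZT$, acting on sections by left-invariant differentiation; on smooth sections $(D^{1/3})^2=-\Omega$. Point spectrum means the set of eigenvalues. *)

theory Defs
  imports "HOL-Analysis.Analysis" "HOL-Algebra.Generated_Groups" "HOL-Algebra.Elementary_Groups"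
begin

section \<open>The oscillator group\<close>

text \<open>Elements are triples \<open>(\<xi>, z, t)\<close>.\<close>

type_synonym osc = "complex \<times> real \<times> real"

definition omega :: "complex \<Rightarrow> complex \<Rightarrow> real"
  where "omega \<xi> \<eta> = Im (cnj \<xi> * \<eta>)"

fun osc_mult :: "osc \<Rightarrow> osc \<Rightarrow> osc"
  where "osc_mult (\<xi>1, z1, t1) (\<xi>2, z2, t2) =
    (\<xi>1 + cis t1 * \<xi>2, z1 + z2 + omega \<xi>1 (cis t1 * \<xi>2) / 2, t1 + t2)"

definition Osc :: "osc monoid"
  where "Osc = \<lparr>carrier = UNIV, monoid.mult = osc_mult, one = (0, 0, 0)\<rparr>"

definition heis :: "osc set"
  where "heis = {(\<xi>, z, t). t = 0}"

abbreviation Heis :: "osc monoid"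
  where "Heis \<equiv> Osc\<lparr>carrier := heis\<rparr>"

lemma group_Osc: "group Osc"
proof (rule groupI)
  fix x y z assume "x \<in> carrier Osc" "y \<in> carrier Osc" "z \<in> carrier Osc"
  show "x \<otimes>\<^bsub>Osc\<^esub> y \<otimes>\<^bsub>Osc\<^esub> z = x \<otimes>\<^bsub>Osc\<^esub> (y \<otimes>\<^bsub>Osc\<^esub> z)"
  proof -
    obtain a b c where x: "x = (a, b, c)" by (cases x) auto
    obtain d e f where y: "y = (d, e, f)" by (cases y) auto
    obtain g h k where z: "z = (g, h, k)" by (cases z) auto
    have 1: "omega (cis c * d) (cis c * w) = omega d w" for w
    proof -
      have "cnj (cis c * d) * (cis c * w) = (cnj (cis c) * cis c) * (cnj d * w)"
        by (simp add: algebra_simps)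
      also have "cnj (cis c) * cis c = 1"
        by (simp add: cis_cnj cis_mult)
      finally show ?thesis by (simp only: omega_def mult_1_left)
    qed
    have 2: "omega (u + v) w = omega u w + omega v w" "omega u (v + w) = omega u v + omega u w"
      for u v w by (simp_all add: omega_def algebra_simps)
    show ?thesis
      using 1[of "cis f * g"]
      by (simp add: x y z Osc_def cis_mult[symmetric] distrib_left 2 mult.assoc add_divide_distrib)
  qed
next
  fix x assume "x \<in> carrier Osc"
  obtain a b c where x: "x = (a, b, c)" by (cases x) auto
  have "(- (cis (-c) * a), -b, -c) \<otimes>\<^bsub>Osc\<^esub> x = \<one>\<^bsub>Osc\<^esub>"
    by (simp add: x Osc_def omega_def algebra_simps)
  then show "\<exists>y\<in>carrier Osc. y \<otimes>\<^bsub>Osc\<^esub> x = \<one>\<^bsub>Osc\<^esub>"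
    by (force simp: Osc_def)
qed (auto simp: Osc_def omega_def)


section \<open>Lattices\<close>

text \<open>The left quotient \<open>L\G\<close> is the set \<open>rcosets\<^bsub>G\<^esub> L\<close> of all \<open>L #>\<^bsub>G\<^esub> g\<close>. The carrier of \<open>G\<close> has the
  subspace topology, the quotient has the quotient topology.\<close>

definition quotient_top :: "('a::topological_space, 'b) monoid_scheme \<Rightarrow> 'a set \<Rightarrow> 'a set topology"
  where "quotient_top G L = topology (\<lambda>U. U \<subseteq> rcosets\<^bsub>G\<^esub> L \<and>
    openin (top_of_set (carrier G)) {g \<in> carrier G. L #>\<^bsub>G\<^esub> g \<in> U})"

lemma openin_quotient_top:
  "openin (quotient_top G L) U \<longleftrightarrow> U \<subseteq> rcosets\<^bsub>G\<^esub> L \<and>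
    openin (top_of_set (carrier G)) {g \<in> carrier G. L #>\<^bsub>G\<^esub> g \<in> U}"
proof -
  have "istopology (\<lambda>U. U \<subseteq> rcosets\<^bsub>G\<^esub> L \<and>
    openin (top_of_set (carrier G)) {g \<in> carrier G. L #>\<^bsub>G\<^esub> g \<in> U})" (is "istopology ?P")
    unfolding istopology_def
  proof (intro conjI allI impI)
    fix S T assume "?P S" "?P T"
    moreover have "{g \<in> carrier G. L #>\<^bsub>G\<^esub> g \<in> S \<inter> T} =
      {g \<in> carrier G. L #>\<^bsub>G\<^esub> g \<in> S} \<inter> {g \<in> carrier G. L #>\<^bsub>G\<^esub> g \<in> T}" by auto
    ultimately show "S \<inter> T \<subseteq> rcosets\<^bsub>G\<^esub> L"
      "openin (top_of_set (carrier G)) {g \<in> carrier G. L #>\<^bsub>G\<^esub> g \<in> S \<inter> T}"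
      by (auto intro: openin_Int)
  next
    fix \<K> assume K: "\<forall>K\<in>\<K>. ?P K"
    then show "\<Union>\<K> \<subseteq> rcosets\<^bsub>G\<^esub> L" by auto
    have "{g \<in> carrier G. L #>\<^bsub>G\<^esub> g \<in> \<Union>\<K>} = (\<Union>K\<in>\<K>. {g \<in> carrier G. L #>\<^bsub>G\<^esub> g \<in> K})" by auto
    then show "openin (top_of_set (carrier G)) {g \<in> carrier G. L #>\<^bsub>G\<^esub> g \<in> \<Union>\<K>}"
      using K by (auto intro!: openin_Union)
  qed
  then show ?thesis
    by (simp add: quotient_top_def topology_inverse')
qed

definition group_lattice :: "('a::topological_space, 'b) monoid_scheme \<Rightarrow> 'a set \<Rightarrow> bool"
  where "group_lattice G L \<longleftrightarrow> subgroup L G \<and> discrete L \<and> compact_space (quotient_top G L)"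

definition fundamental_domain ::
    "('a::topological_space, 'b) monoid_scheme \<Rightarrow> 'a set \<Rightarrow> 'a set \<Rightarrow> bool"
  where "fundamental_domain G L F \<longleftrightarrow> F \<subseteq> carrier G \<and> F \<in> sets borel \<and>
    (\<forall>g\<in>carrier G. \<exists>!l. l \<in> L \<and> l \<otimes>\<^bsub>G\<^esub> g \<in> F)"

text \<open>The measure that Lebesgue measure induces on \<open>L\G\<close>, transported to a Borel fundamental domain;
  left translations by \<open>L\<close> preserve Lebesgue measure in the groups considered here, so integrals of
  \<open>L\<close>-invariant functions do not depend on the domain chosen.\<close>

definition quotient_measure :: "('a::euclidean_space, 'b) monoid_scheme \<Rightarrow> 'a set \<Rightarrow> 'a measure"
  where "quotient_measure G L = restrict_space lborel (SOME F. fundamental_domain G L F)"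

definition covolume :: "('a::euclidean_space, 'b) monoid_scheme \<Rightarrow> 'a set \<Rightarrow> ennreal"
  where "covolume G L = emeasure (quotient_measure G L) (space (quotient_measure G L))"

definition additive_C :: "complex monoid"
  where "additive_C = \<lparr>carrier = UNIV, monoid.mult = (+), one = 0\<rparr>"

text \<open>The map \<open>fst\<close> on \<open>heis\<close> is the projection to \<open>H/Z(H)\<close>, identified with the complex plane.\<close>

definition normalised :: "osc set \<Rightarrow> bool"
  where "normalised L \<longleftrightarrow> group_lattice additive_C (fst ` (L \<inter> heis)) \<and>
    covolume additive_C (fst ` (L \<inter> heis)) = 1"

definition basic_lattice :: "osc set \<Rightarrow> bool"
  where "basic_lattice L \<longleftrightarrow> group_lattice Osc L \<and> normalised L \<and>
    (\<exists>\<Gamma> (\<kappa>::nat). group_lattice Heis \<Gamma> \<and> \<kappa> > 0 \<and>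
      L = generate Osc (insert (0, 0, 2 * pi * real \<kappa>) \<Gamma>))"


section \<open>Spinor fields\<close>

type_synonym spinor = "complex ^ 4"

text \<open>Spin structures are homomorphisms \<open>\<epsilon>\<close> from \<open>L\<close> to \<open>integer_mod_group 2\<close>, whose carrier
  is \<open>{0, 1}\<close>.\<close>

definition equivariant :: "osc set \<Rightarrow> (osc \<Rightarrow> int) \<Rightarrow> (osc \<Rightarrow> spinor) \<Rightarrow> bool"
  where "equivariant L \<epsilon> \<psi> \<longleftrightarrow>
    (\<forall>l\<in>L. \<forall>g. \<psi> (l \<otimes>\<^bsub>Osc\<^esub> g) = (-1) ^ nat (\<epsilon> l) *s \<psi> g)"

fun C_k :: "nat \<Rightarrow> ('a::real_normed_vector \<Rightarrow> 'b::real_normed_vector) \<Rightarrow> bool"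
  where
    "C_k 0 f \<longleftrightarrow> continuous_on UNIV f"
  | "C_k (Suc k) f \<longleftrightarrow> (\<forall>x. f differentiable (at x)) \<and>
      (\<forall>v. C_k k (\<lambda>x. frechet_derivative f (at x) v))"

definition smooth :: "('a::real_normed_vector \<Rightarrow> 'b::real_normed_vector) \<Rightarrow> bool"
  where "smooth f \<longleftrightarrow> (\<forall>k. C_k k f)"

definition smooth_sections :: "osc set \<Rightarrow> (osc \<Rightarrow> int) \<Rightarrow> (osc \<Rightarrow> spinor) set"
  where "smooth_sections L \<epsilon> = {\<psi>. smooth \<psi> \<and> equivariant L \<epsilon> \<psi>}"

text \<open>Elements of \<open>L\<^sup>2(\<Sigma>(L\Osc))\<close> are represented by Borel functions; two sections represent the same
  element iff their difference has \<open>l2_norm\<close> zero. The norm of \<^typ>\<open>complex ^ 4\<close> is the one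
  for which the standard basis is orthonormal.\<close>

definition L2_sections :: "osc set \<Rightarrow> (osc \<Rightarrow> int) \<Rightarrow> (osc \<Rightarrow> spinor) set"
  where "L2_sections L \<epsilon> = {\<psi> \<in> borel_measurable borel. equivariant L \<epsilon> \<psi> \<and>
    integrable (quotient_measure Osc L) (\<lambda>g. (norm (\<psi> g))\<^sup>2)}"

definition l2_norm :: "osc set \<Rightarrow> (osc \<Rightarrow> spinor) \<Rightarrow> real"
  where "l2_norm L \<psi> = sqrt (LINT g|quotient_measure Osc L. (norm (\<psi> g))\<^sup>2)"


section \<open>Differential operators\<close>

text \<open>One-parameter subgroups \<open>s \<mapsto> exp (sV)\<close> for the basis \<open>V = X, Y, Z, T\<close> of the Lie algebra.\<close>

definition exp_X :: "real \<Rightarrow> osc" where "exp_X s = (of_real s, 0, 0)"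
definition exp_Y :: "real \<Rightarrow> osc" where "exp_Y s = (\<i> * of_real s, 0, 0)"
definition exp_Z :: "real \<Rightarrow> osc" where "exp_Z s = (0, s, 0)"
definition exp_T :: "real \<Rightarrow> osc" where "exp_T s = (0, 0, s)"

lemma one_parameter_subgroups:
  "exp_X (r + s) = exp_X r \<otimes>\<^bsub>Osc\<^esub> exp_X s"
  "exp_Y (r + s) = exp_Y r \<otimes>\<^bsub>Osc\<^esub> exp_Y s"
  "exp_Z (r + s) = exp_Z r \<otimes>\<^bsub>Osc\<^esub> exp_Z s"
  "exp_T (r + s) = exp_T r \<otimes>\<^bsub>Osc\<^esub> exp_T s"
  by (auto simp: exp_X_def exp_Y_def exp_Z_def exp_T_def Osc_def omega_def algebra_simps)

definition lie_deriv :: "(real \<Rightarrow> osc) \<Rightarrow> (osc \<Rightarrow> spinor) \<Rightarrow> osc \<Rightarrow> spinor"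
  where "lie_deriv \<gamma> \<psi> g = vector_derivative (\<lambda>s. \<psi> (g \<otimes>\<^bsub>Osc\<^esub> \<gamma> s)) (at 0)"

text \<open>The matrices of Clifford multiplication, by rows.\<close>

definition cliff_X :: "complex ^ 4 ^ 4" where
  "cliff_X = vector [vector [0, 0, -\<i>, 0],
                     vector [0, 0, 0, \<i>],
                     vector [-\<i>, 0, 0, 0],
                     vector [0, \<i>, 0, 0]]"

definition cliff_Y :: "complex ^ 4 ^ 4" where
  "cliff_Y = vector [vector [0, 0, 1, 0],
                     vector [0, 0, 0, -1],
                     vector [-1, 0, 0, 0],
                     vector [0, 1, 0, 0]]"

definition cliff_Z :: "complex ^ 4 ^ 4" where
  "cliff_Z = vector [vector [0, 0, 0, 0],
                     vector [of_real (sqrt 2), 0, 0, 0],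
                     vector [0, 0, 0, 0],
                     vector [0, 0, of_real (sqrt 2), 0]]"

definition cliff_T :: "complex ^ 4 ^ 4" where
  "cliff_T = vector [vector [0, - of_real (sqrt 2), 0, 0],
                     vector [0, 0, 0, 0],
                     vector [0, 0, 0, - of_real (sqrt 2)],
                     vector [0, 0, 0, 0]]"

lemma vector_4 [simp]:
  "(vector [a, b, c, d] :: 'a::zero ^ 4) $ 1 = a"
  "(vector [a, b, c, d] :: 'a::zero ^ 4) $ 2 = b"
  "(vector [a, b, c, d] :: 'a::zero ^ 4) $ 3 = c"
  "(vector [a, b, c, d] :: 'a::zero ^ 4) $ 4 = d"
  unfolding vector_def by simp_all

lemma clifford_relations:
  "cliff_X ** cliff_X = - mat 1" "cliff_Y ** cliff_Y = - mat 1"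
  "cliff_Z ** cliff_Z = 0" "cliff_T ** cliff_T = 0"
  "cliff_Z ** cliff_T + cliff_T ** cliff_Z = - 2 *\<^sub>R mat 1"
  "cliff_X ** cliff_Y = - (cliff_Y ** cliff_X)"
  "cliff_X ** cliff_Z = - (cliff_Z ** cliff_X)" "cliff_X ** cliff_T = - (cliff_T ** cliff_X)"
  "cliff_Y ** cliff_Z = - (cliff_Z ** cliff_Y)" "cliff_Y ** cliff_T = - (cliff_T ** cliff_Y)"
  by (simp_all add: vec_eq_iff forall_4 matrix_matrix_mult_def sum_4 mat_def
      cliff_X_def cliff_Y_def cliff_Z_def cliff_T_def scaleR_conv_of_real
      flip: of_real_mult)

definition dirac :: "(osc \<Rightarrow> spinor) \<Rightarrow> osc \<Rightarrow> spinor"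
  where "dirac \<psi> g =
    cliff_X *v lie_deriv exp_X \<psi> g + cliff_Y *v lie_deriv exp_Y \<psi> g +
    cliff_Z *v lie_deriv exp_T \<psi> g + cliff_T *v lie_deriv exp_Z \<psi> g +
    (1/2) *s ((cliff_X ** cliff_Y ** cliff_Z) *v \<psi> g)"

definition casimir :: "(osc \<Rightarrow> spinor) \<Rightarrow> osc \<Rightarrow> spinor"
  where "casimir \<psi> g =
    lie_deriv exp_X (lie_deriv exp_X \<psi>) g + lie_deriv exp_Y (lie_deriv exp_Y \<psi>) g +
    2 *s lie_deriv exp_Z (lie_deriv exp_T \<psi>) g"


section \<open>Closed operators and their spectrum\<close>

text \<open>An operator is given by its graph, a set of pairs of functions. The space it acts on is given
  by a set \<open>S\<close> of functions with a seminorm \<open>N\<close>, functions with \<open>N (f - g) = 0\<close> being identified.\<close>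

definition graph_closure :: "('g \<Rightarrow> complex ^ 'n) set \<Rightarrow> (('g \<Rightarrow> complex ^ 'n) \<Rightarrow> real) \<Rightarrow>
    (('g \<Rightarrow> complex ^ 'n) \<times> ('g \<Rightarrow> complex ^ 'n)) set \<Rightarrow>
    (('g \<Rightarrow> complex ^ 'n) \<times> ('g \<Rightarrow> complex ^ 'n)) set"
  where "graph_closure S N A = {(\<psi>, \<phi>). \<psi> \<in> S \<and> \<phi> \<in> S \<and>
    (\<exists>f h. (\<forall>n::nat. (f n, h n) \<in> A) \<and>
      (\<lambda>n. N (\<lambda>g. f n g - \<psi> g)) \<longlonglongrightarrow> 0 \<and> (\<lambda>n. N (\<lambda>g. h n g - \<phi> g)) \<longlonglongrightarrow> 0)}"

definition kernel_nontrivial :: "(('g \<Rightarrow> complex ^ 'n) \<Rightarrow> real) \<Rightarrow>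
    (('g \<Rightarrow> complex ^ 'n) \<times> ('g \<Rightarrow> complex ^ 'n)) set \<Rightarrow> bool"
  where "kernel_nontrivial N A \<longleftrightarrow> (\<exists>\<psi>. (\<psi>, \<lambda>g. 0) \<in> A \<and> N \<psi> \<noteq> 0)"

definition point_spectrum :: "(('g \<Rightarrow> complex ^ 'n) \<Rightarrow> real) \<Rightarrow>
    (('g \<Rightarrow> complex ^ 'n) \<times> ('g \<Rightarrow> complex ^ 'n)) set \<Rightarrow> complex set"
  where "point_spectrum N A = {\<mu>. \<exists>\<psi>. (\<psi>, \<lambda>g. \<mu> *s \<psi> g) \<in> A \<and> N \<psi> \<noteq> 0}"

text \<open>A number \<open>\<mu>\<close> is in the resolvent set iff \<open>A - \<mu>\<close> maps its domain onto the whole space and has a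
  bounded inverse; the estimate includes injectivity.\<close>

definition resolvent_set :: "('g \<Rightarrow> complex ^ 'n) set \<Rightarrow> (('g \<Rightarrow> complex ^ 'n) \<Rightarrow> real) \<Rightarrow>
    (('g \<Rightarrow> complex ^ 'n) \<times> ('g \<Rightarrow> complex ^ 'n)) set \<Rightarrow> complex set"
  where "resolvent_set S N A = {\<mu>.
    (\<forall>\<eta>\<in>S. \<exists>(\<psi>, \<phi>)\<in>A. N (\<lambda>g. \<phi> g - \<mu> *s \<psi> g - \<eta> g) = 0) \<and>
    (\<exists>c. \<forall>(\<psi>, \<phi>)\<in>A. N \<psi> \<le> c * N (\<lambda>g. \<phi> g - \<mu> *s \<psi> g))}"

definition spectrum :: "('g \<Rightarrow> complex ^ 'n) set \<Rightarrow> (('g \<Rightarrow> complex ^ 'n) \<Rightarrow> real) \<Rightarrow>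
    (('g \<Rightarrow> complex ^ 'n) \<times> ('g \<Rightarrow> complex ^ 'n)) set \<Rightarrow> complex set"
  where "spectrum S N A = - resolvent_set S N A"

definition residual_spectrum :: "('g \<Rightarrow> complex ^ 'n) set \<Rightarrow> (('g \<Rightarrow> complex ^ 'n) \<Rightarrow> real) \<Rightarrow>
    (('g \<Rightarrow> complex ^ 'n) \<times> ('g \<Rightarrow> complex ^ 'n)) set \<Rightarrow> complex set"
  where "residual_spectrum S N A = {\<mu> \<in> spectrum S N A. \<mu> \<notin> point_spectrum N A \<and>
    \<not> (\<forall>\<eta>\<in>S. \<forall>e>0. \<exists>(\<psi>, \<phi>)\<in>A. N (\<lambda>g. \<phi> g - \<mu> *s \<psi> g - \<eta> g) < e)}"

text \<open>The operators on smooth sections are closable, so their graph closures are again graphs, up to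
  the identification of functions at distance zero.\<close>

definition dirac_closure ::
    "osc set \<Rightarrow> (osc \<Rightarrow> int) \<Rightarrow> ((osc \<Rightarrow> spinor) \<times> (osc \<Rightarrow> spinor)) set"
  where "dirac_closure L \<epsilon> = graph_closure (L2_sections L \<epsilon>) (l2_norm L)
    {(\<psi>, dirac \<psi>) | \<psi>. \<psi> \<in> smooth_sections L \<epsilon>}"

definition casimir_closure ::
    "osc set \<Rightarrow> (osc \<Rightarrow> int) \<Rightarrow> ((osc \<Rightarrow> spinor) \<times> (osc \<Rightarrow> spinor)) set"
  where "casimir_closure L \<epsilon> = graph_closure (L2_sections L \<epsilon>) (l2_norm L)
    {(\<psi>, casimir \<psi>) | \<psi>. \<psi> \<in> smooth_sections L \<epsilon>}"

definition neg_casimir_closure ::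
    "osc set \<Rightarrow> (osc \<Rightarrow> int) \<Rightarrow> ((osc \<Rightarrow> spinor) \<times> (osc \<Rightarrow> spinor)) set"
  where "neg_casimir_closure L \<epsilon> =
    {(\<psi>, \<lambda>g. - \<phi> g) | \<psi> \<phi>. (\<psi>, \<phi>) \<in> casimir_closure L \<epsilon>}"

end

theory Submission
  imports Defs
begin

text \<open>Write \<open>D\<close> for the cubic Dirac operator and \<open>\<Omega>\<close> for the Casimir operator. The proof rests on three facts about
  smooth sections: \<open>D\<^sup>2 = - \<Omega>\<close> (\<open>dirac_square\<close>), \<open>\<Omega>\<close> is symmetric for the positive definite \<open>L\<^sup>2\<close> product although \<open>D\<close>
  is not (\<open>casimir_symmetric\<close>), and \<open>\<Omega>\<close> commutes with left and with right translations and with the inversion of the group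
  (\<open>casimir_op_inverse\<close>).

  The operator \<open>\<Omega>\<close> is not elliptic, so a weak eigensection \<open>\<zeta>\<close> of \<open>\<Omega>\<close> need not be smooth. Convolution with a test
  function, \<open>u(h) = \<integral> \<phi>(h\<^sup>-\<^sup>1 g) \<zeta>(g) dg\<close>, replaces it by a smooth section. Bi-invariance of \<open>\<Omega>\<close> makes \<open>u\<close> an
  eigensection again, and \<open>u \<noteq> 0\<close> for some \<open>\<phi>\<close> (\<open>smooth_eigensection_of_weak\<close>). Hence every eigenvalue of the closed
  operators is seen on smooth sections, where \<open>D\<^sup>2 = - \<Omega>\<close> can be applied.

  Point spectrum: if \<open>D \<psi> = \<nu> \<psi>\<close>, then \<open>\<psi>\<close> is a weak eigensection of \<open>\<Omega>\<close> for \<open>- \<nu>\<^sup>2\<close>. Conversely, \<open>D + \<nu>\<close> maps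
  the eigenspace of \<open>\<Omega>\<close> for \<open>- \<nu>\<^sup>2\<close> into the kernel of \<open>D - \<nu>\<close>, and for \<open>\<nu> \<noteq> 0\<close> it does not vanish on this eigenspace
  (\<open>dirac_eigensection_of_casimir\<close>). For \<open>\<nu> = 0\<close> one of \<open>u\<close> and \<open>D u\<close> is a non-zero element of the kernel of \<open>D\<close>.

  Residual spectrum: a section orthogonal to the range of \<open>D - \<mu>\<close> is orthogonal to the range of \<open>(D - \<mu>) (D + \<mu>) = - \<Omega> - \<mu>\<^sup>2\<close>
  and is therefore a weak eigensection of \<open>\<Omega>\<close>. Eigenvalues of \<open>\<Omega>\<close> are real by symmetry, so \<open>\<mu>\<close> is itself an eigenvalue of \<open>D\<close>
  (\<open>dense_range\<close>).

  Spectrum: the symbol of \<open>\<Omega>\<close> vanishes on null covectors. Wave packets that oscillate in a null direction with increasing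
  frequency \<open>p\<close> give scalar equivariant functions \<open>f\<close> of constant norm with \<open>T f = - i p\<^sup>2/(2c) f\<close> and \<open>\<Omega> f = O(p)\<close>
  (\<open>packets_exist\<close>). For \<open>w = f u\<^sub>1\<close> and any complex \<open>\<mu>\<close>, the norm of \<open>(D + \<mu>) w\<close> grows like \<open>p\<^sup>2\<close>, whereas
  \<open>(D - \<mu>) (D + \<mu>) w = - \<Omega> w - \<mu>\<^sup>2 w\<close> is only \<open>O(p)\<close>. So \<open>D - \<mu>\<close> has no bounded inverse (\<open>dirac_resolvent_empty\<close>).
  The packets are cut off in the coordinate \<open>\<xi>\<close> by a bump function so narrow that its translates by \<open>L\<close>, which acts on \<open>\<xi>\<close>
  by a discrete group of translations, do not overlap.\<close>

section \<open>Smooth functions\<close>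

text \<open>The direction comes first, so that partial applications are differential operators that can be iterated.\<close>

definition dir_deriv :: "'a \<Rightarrow> ('a::real_normed_vector \<Rightarrow> 'b::real_normed_vector) \<Rightarrow> 'a \<Rightarrow> 'b"
  where "dir_deriv v f x = frechet_derivative f (at x) v"

lemma dir_derivI:
  assumes "(f has_derivative f') (at x)" shows "dir_deriv v f x = f' v"
  using frechet_derivative_at[OF assms] by (simp add: dir_deriv_def)

lemma C_k_SucI:
  assumes "\<And>x. (f has_derivative f' x) (at x)" and "\<And>v. C_k k (\<lambda>x. f' x v)"
  shows "C_k (Suc k) f"
proof -
  have "(\<lambda>x. frechet_derivative f (at x) v) = (\<lambda>x. f' x v)" for v
    using frechet_derivative_at[OF assms(1)] by (simp add: fun_eq_iff)
  then show ?thesis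
    using assms by (auto simp: differentiable_def)
qed

lemma C_k_Suc_has_derivative:
  assumes "C_k (Suc k) f"
  shows "(f has_derivative (\<lambda>v. dir_deriv v f x)) (at x)"
  using assms by (simp add: dir_deriv_def frechet_derivative_works)

lemma C_k_Suc_dir_deriv: "C_k (Suc k) f \<Longrightarrow> C_k k (dir_deriv v f)"
  by (simp add: dir_deriv_def[abs_def])

lemma C_k_Suc_imp: "C_k (Suc k) f \<Longrightarrow> C_k k f"
proof (induction k arbitrary: f)
  case 0
  then show ?case
    by (auto intro!: continuous_at_imp_continuous_on differentiable_imp_continuous_within)
next
  case (Suc k)
  then show ?case by simp
qed

lemma C_k_const: "C_k k (\<lambda>x. c)"
proof (induction k arbitrary: c)
  case (Suc k)
  show ?case by (rule C_k_SucI[where f'="\<lambda>x v. 0"]) (auto intro: Suc)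
qed simp

lemma C_k_bounded_linear_compose:
  assumes T: "bounded_linear T"
  shows "C_k k f \<Longrightarrow> C_k k (\<lambda>x. T (f x))"
proof (induction k arbitrary: f)
  case 0
  then show ?case using linear_continuous_on[OF T]
    by (auto intro: continuous_on_compose2)
next
  case (Suc k)
  show ?case
    by (rule C_k_SucI[OF bounded_linear.has_derivative[OF T C_k_Suc_has_derivative[OF Suc.prems]]])
       (rule Suc.IH, use Suc.prems C_k_Suc_dir_deriv in blast)
qed

lemma C_k_id: "C_k k (\<lambda>x. x)"
proof (cases k)
  case (Suc n)
  show ?thesis unfolding Suc by (rule C_k_SucI[OF has_derivative_ident]) (rule C_k_const)
qed simp

lemma C_k_add: "C_k k f \<Longrightarrow> C_k k g \<Longrightarrow> C_k k (\<lambda>x. f x + g x)"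
proof (induction k arbitrary: f g)
  case (Suc k)
  show ?case
    by (rule C_k_SucI[OF has_derivative_add[OF C_k_Suc_has_derivative[OF Suc.prems(1)]
          C_k_Suc_has_derivative[OF Suc.prems(2)]]])
       (rule Suc.IH; use Suc.prems C_k_Suc_dir_deriv in blast)
qed (auto intro!: continuous_intros)

lemma C_k_sum: "(\<And>i. i \<in> I \<Longrightarrow> C_k k (f i)) \<Longrightarrow> C_k k (\<lambda>x. \<Sum>i\<in>I. f i x)"
  by (induction I rule: infinite_finite_induct) (simp_all add: C_k_const C_k_add)

lemma C_k_bilinear:
  assumes B: "bounded_bilinear B"
  shows "C_k k f \<Longrightarrow> C_k k g \<Longrightarrow> C_k k (\<lambda>x. B (f x) (g x))"
proof (induction k arbitrary: f g)
  case 0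
  then show ?case by (auto intro: bounded_bilinear.continuous_on[OF B])
next
  case (Suc k)
  show ?case
    by (rule C_k_SucI[OF bounded_bilinear.FDERIV[OF B C_k_Suc_has_derivative[OF Suc.prems(1)]
          C_k_Suc_has_derivative[OF Suc.prems(2)]]])
       (rule C_k_add; rule Suc.IH; use Suc.prems C_k_Suc_dir_deriv C_k_Suc_imp in blast)
qed

text \<open>The derivative of a composition is expanded in a basis of the middle space, because \<open>C_k\<close> speaks
  about derivatives in constant directions only.\<close>

lemma C_k_compose:
  fixes f :: "'a::real_normed_vector \<Rightarrow> 'b::euclidean_space"
  shows "C_k k g \<Longrightarrow> C_k k f \<Longrightarrow> C_k k (\<lambda>x. g (f x))"
proof (induction k arbitrary: g)
  case 0
  then show ?case by (auto intro: continuous_on_compose2)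
next
  case (Suc k)
  have g: "(g has_derivative (\<lambda>v. dir_deriv v g y)) (at y)" for y
    using Suc.prems(1) by (rule C_k_Suc_has_derivative)
  have f: "(f has_derivative (\<lambda>v. dir_deriv v f x)) (at x)" for x
    using Suc.prems(2) by (rule C_k_Suc_has_derivative)
  have eq: "dir_deriv (dir_deriv v f x) g (f x) =
      (\<Sum>b\<in>Basis. (dir_deriv v f x \<bullet> b) *\<^sub>R dir_deriv b g (f x))" for v x
  proof -
    interpret linear "\<lambda>v. dir_deriv v g (f x)"
      by (rule has_derivative_linear[OF g])
    have "dir_deriv (\<Sum>b\<in>Basis. (dir_deriv v f x \<bullet> b) *\<^sub>R b) g (f x) =
      (\<Sum>b\<in>Basis. (dir_deriv v f x \<bullet> b) *\<^sub>R dir_deriv b g (f x))"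
      by (simp add: sum scale)
    then show ?thesis by (simp add: euclidean_representation)
  qed
  show ?case
  proof (rule C_k_SucI)
    show "((\<lambda>x. g (f x)) has_derivative
        (\<lambda>v. \<Sum>b\<in>Basis. (dir_deriv v f x \<bullet> b) *\<^sub>R dir_deriv b g (f x))) (at x)" for x
      using has_derivative_compose[OF f g, of x] by (simp add: eq)
    show "C_k k (\<lambda>x. \<Sum>b\<in>Basis. (dir_deriv v f x \<bullet> b) *\<^sub>R dir_deriv b g (f x))" for v
    proof (rule C_k_sum)
      fix b :: 'b
      have "C_k k (\<lambda>x. dir_deriv v f x \<bullet> b)"
        using C_k_bounded_linear_compose[OF bounded_linear_inner_left C_k_Suc_dir_deriv[OF Suc.prems(2)]] .
      moreover have "C_k k (\<lambda>x. dir_deriv b g (f x))"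
        using Suc.IH[OF C_k_Suc_dir_deriv[OF Suc.prems(1)] C_k_Suc_imp[OF Suc.prems(2)]] .
      ultimately show "C_k k (\<lambda>x. (dir_deriv v f x \<bullet> b) *\<^sub>R dir_deriv b g (f x))"
        using C_k_bilinear[OF bounded_bilinear_scaleR] by blast
    qed
  qed
qed

lemma C_k_local:
  assumes "\<And>x. \<exists>U h. open U \<and> x \<in> U \<and> C_k k h \<and> (\<forall>y\<in>U. f y = h y)"
  shows "C_k k f"
  using assms
proof (induction k arbitrary: f)
  case 0
  have "isCont f x" for x
  proof -
    from 0 obtain U h where U: "open U" "x \<in> U" "C_k 0 h" "\<forall>y\<in>U. f y = h y" by blast
    then have "isCont h x" by (simp add: continuous_on_eq_continuous_at)
    moreover have "\<forall>\<^sub>F y in nhds x. f y = h y"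
      using U eventually_nhds by blast
    ultimately show ?thesis using isCont_cong by blast
  qed
  then show ?case by (simp add: continuous_on_eq_continuous_at)
next
  case (Suc k)
  obtain U h where U: "open (U x)" "x \<in> U x" "C_k (Suc k) (h x)" and eq: "\<And>y. y \<in> U x \<Longrightarrow> f y = h x y" for x
    using Suc.prems by metis
  have der: "(f has_derivative (\<lambda>v. dir_deriv v (h x) y)) (at y)" if "y \<in> U x" for x y
    using has_derivative_transform_within_open[OF C_k_Suc_has_derivative[OF U(3)] U(1) that] eq by auto
  show ?case
  proof (rule C_k_SucI)
    show "(f has_derivative (\<lambda>v. dir_deriv v (h x) x)) (at x)" for x
      by (rule der[OF U(2)])
    show "C_k k (\<lambda>x. dir_deriv v (h x) x)" for v
    proof (rule Suc.IH)
      fix x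
      have "dir_deriv v (h y) y = dir_deriv v (h x) y" if "y \<in> U x" for y
        using dir_derivI[OF der[OF that], of v] dir_derivI[OF der[OF U(2)[of y]], of v] by simp
      then show "\<exists>V k'. open V \<and> x \<in> V \<and> C_k k k' \<and> (\<forall>y\<in>V. dir_deriv v (h y) y = k' y)"
        by (intro exI[of _ "U x"] exI[of _ "dir_deriv v (h x)"] conjI U C_k_Suc_dir_deriv[OF U(3)]) simp
    qed
  qed
qed

lemma C_k_real_SucI:
  assumes "\<And>x. (f has_vector_derivative f' x) (at x)" and "C_k k f'"
  shows "C_k (Suc k) f"
proof (rule C_k_SucI)
  show "(f has_derivative (\<lambda>v. v *\<^sub>R f' x)) (at x)" for x
    using assms(1) by (simp add: has_vector_derivative_def)
  show "C_k k (\<lambda>x. v *\<^sub>R f' x)" for v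
    using C_k_bounded_linear_compose[OF bounded_linear_scaleR_right assms(2)] .
qed

named_theorems smooth_intros

lemma smooth_has_derivative:
  "smooth f \<Longrightarrow> (f has_derivative (\<lambda>v. dir_deriv v f x)) (at x)"
  by (rule C_k_Suc_has_derivative[of 0]) (simp only: smooth_def)

lemma smooth_dir_deriv [smooth_intros]: "smooth f \<Longrightarrow> smooth (dir_deriv v f)"
  by (simp add: smooth_def C_k_Suc_dir_deriv)

lemma smooth_continuous_on: "smooth f \<Longrightarrow> continuous_on A f"
  using continuous_on_subset unfolding smooth_def by (metis C_k.simps(1) subset_UNIV)

lemma smooth_isCont: "smooth f \<Longrightarrow> isCont f x"
  using smooth_continuous_on[of f UNIV] by (simp add: continuous_on_eq_continuous_at)

lemma smooth_borel_measurable: "smooth f \<Longrightarrow> f \<in> borel_measurable borel"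
  using smooth_continuous_on[of f UNIV] by (rule borel_measurable_continuous_onI)

lemma smooth_const [smooth_intros]: "smooth (\<lambda>x. c)"
  by (simp add: smooth_def C_k_const)

lemma smooth_id [smooth_intros]: "smooth (\<lambda>x. x)"
  by (simp add: smooth_def C_k_id)

lemma smooth_bounded_linear: "bounded_linear T \<Longrightarrow> smooth f \<Longrightarrow> smooth (\<lambda>x. T (f x))"
  by (simp add: smooth_def C_k_bounded_linear_compose)

lemma smooth_add [smooth_intros]: "smooth f \<Longrightarrow> smooth g \<Longrightarrow> smooth (\<lambda>x. f x + g x)"
  by (simp add: smooth_def C_k_add)

lemma smooth_sum [smooth_intros]: "(\<And>i. i \<in> I \<Longrightarrow> smooth (f i)) \<Longrightarrow> smooth (\<lambda>x. \<Sum>i\<in>I. f i x)"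
  by (simp add: smooth_def C_k_sum)

lemma smooth_uminus [smooth_intros]: "smooth f \<Longrightarrow> smooth (\<lambda>x. - f x)"
  by (rule smooth_bounded_linear[OF bounded_linear_minus[OF bounded_linear_ident]])

lemma smooth_diff [smooth_intros]: "smooth f \<Longrightarrow> smooth g \<Longrightarrow> smooth (\<lambda>x. f x - g x)"
  using smooth_add[OF _ smooth_uminus, of f g] by simp

lemma smooth_bilinear: "bounded_bilinear B \<Longrightarrow> smooth f \<Longrightarrow> smooth g \<Longrightarrow> smooth (\<lambda>x. B (f x) (g x))"
  by (simp add: smooth_def C_k_bilinear)

lemmas smooth_mult [smooth_intros] = smooth_bilinear[OF bounded_bilinear_mult]
lemmas smooth_scaleR [smooth_intros] = smooth_bilinear[OF bounded_bilinear_scaleR]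
lemmas smooth_inner [smooth_intros] = smooth_bilinear[OF bounded_bilinear_inner]
lemmas smooth_fst [smooth_intros] = smooth_bounded_linear[OF bounded_linear_fst]
lemmas smooth_snd [smooth_intros] = smooth_bounded_linear[OF bounded_linear_snd]
lemmas smooth_Re [smooth_intros] = smooth_bounded_linear[OF bounded_linear_Re]
lemmas smooth_Im [smooth_intros] = smooth_bounded_linear[OF bounded_linear_Im]
lemmas smooth_cnj [smooth_intros] = smooth_bounded_linear[OF bounded_linear_cnj]
lemmas smooth_of_real [smooth_intros] = smooth_bounded_linear[OF bounded_linear_of_real]

lemma smooth_divide_const [smooth_intros]:
  fixes f :: "'a::real_normed_vector \<Rightarrow> 'b::real_normed_field"
  shows "smooth f \<Longrightarrow> smooth (\<lambda>x. f x / c)"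
  by (rule smooth_bounded_linear[OF bounded_linear_divide])

lemma smooth_power [smooth_intros]:
  fixes f :: "'a::real_normed_vector \<Rightarrow> 'b::real_normed_algebra_1"
  shows "smooth f \<Longrightarrow> smooth (\<lambda>x. f x ^ n)"
  by (induction n) (simp_all add: smooth_const smooth_mult)

lemma smooth_prod [smooth_intros]:
  fixes f :: "'i \<Rightarrow> 'a::real_normed_vector \<Rightarrow> 'b::real_normed_field"
  shows "(\<And>i. i \<in> I \<Longrightarrow> smooth (f i)) \<Longrightarrow> smooth (\<lambda>x. \<Prod>i\<in>I. f i x)"
  by (induction I rule: infinite_finite_induct) (simp_all add: smooth_const smooth_mult)

lemma smooth_Pair [smooth_intros]:
  assumes "smooth f" "smooth g" shows "smooth (\<lambda>x. (f x, g x))"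
proof -
  have "smooth (\<lambda>x. (f x, 0) + (0, g x))"
    by (intro smooth_add smooth_bounded_linear[OF bounded_linear_Pair[OF bounded_linear_ident bounded_linear_zero]]
        smooth_bounded_linear[OF bounded_linear_Pair[OF bounded_linear_zero bounded_linear_ident]] assms)
  then show ?thesis by simp
qed

lemma smooth_compose:
  fixes f :: "'a::real_normed_vector \<Rightarrow> 'b::euclidean_space"
  shows "smooth g \<Longrightarrow> smooth f \<Longrightarrow> smooth (\<lambda>x. g (f x))"
  by (simp add: smooth_def C_k_compose)

lemma smooth_local:
  assumes "\<And>x. \<exists>U h. open U \<and> x \<in> U \<and> smooth h \<and> (\<forall>y\<in>U. f y = h y)"
  shows "smooth f"
  unfolding smooth_def
proof
  show "C_k k f" for k
  proof (rule C_k_local)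
    fix x
    obtain U h where "open U" "x \<in> U" "smooth h" "\<forall>y\<in>U. f y = h y" using assms by metis
    then show "\<exists>U h. open U \<and> x \<in> U \<and> C_k k h \<and> (\<forall>y\<in>U. f y = h y)"
      by (intro exI[of _ U] exI[of _ h]) (simp add: smooth_def)
  qed
qed

lemma smooth_cos_sin: "smooth (cos :: real \<Rightarrow> real)" "smooth (sin :: real \<Rightarrow> real)"
proof -
  have "C_k k (cos :: real \<Rightarrow> real) \<and> C_k k (sin :: real \<Rightarrow> real)" for k
  proof (induction k)
    case (Suc k)
    have "C_k k (\<lambda>x::real. - sin x)"
      using Suc by (intro C_k_bounded_linear_compose[OF bounded_linear_minus[OF bounded_linear_ident]]) simp
    then have "C_k (Suc k) (cos :: real \<Rightarrow> real)"
      by (rule C_k_real_SucI[rotated])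
         (auto simp flip: has_real_derivative_iff_has_vector_derivative)
    moreover have "C_k (Suc k) (sin :: real \<Rightarrow> real)"
      by (rule C_k_real_SucI[where f'=cos])
         (use Suc in \<open>auto simp flip: has_real_derivative_iff_has_vector_derivative\<close>)
    ultimately show ?case ..
  qed (auto intro!: continuous_intros)
  then show "smooth (cos :: real \<Rightarrow> real)" "smooth (sin :: real \<Rightarrow> real)"
    by (auto simp: smooth_def)
qed

lemmas smooth_cos [smooth_intros] = smooth_compose[OF smooth_cos_sin(1)]
lemmas smooth_sin [smooth_intros] = smooth_compose[OF smooth_cos_sin(2)]

lemma smooth_cis [smooth_intros]: "smooth f \<Longrightarrow> smooth (\<lambda>x. cis (f x))"
  unfolding cis.ctr Complex_eq by (intro smooth_add smooth_mult smooth_const smooth_of_real smooth_cos smooth_sin)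

text \<open>Mixed second derivatives agree: by the mean value theorem, both are values, near \<open>x\<close>, of the same second
  difference quotient.\<close>

lemma second_difference_mvt:
  fixes f :: "'a::real_normed_vector \<Rightarrow> real"
  assumes f: "smooth f" and "s > 0"
  shows "\<exists>a b. 0 < a \<and> a < s \<and> 0 < b \<and> b < s \<and>
    f (x + s *\<^sub>R v + s *\<^sub>R w) - f (x + s *\<^sub>R v) - f (x + s *\<^sub>R w) + f x =
      s * s * dir_deriv w (dir_deriv v f) (x + a *\<^sub>R v + b *\<^sub>R w)"
proof -
  have D: "((\<lambda>r. h (y + r *\<^sub>R u)) has_real_derivative dir_deriv u h (y + r *\<^sub>R u)) (at r)"
    if "smooth h" for h :: "'a \<Rightarrow> real" and y u r
  proof -
    have *: "((\<lambda>r. y + r *\<^sub>R u) has_derivative (\<lambda>t. t *\<^sub>R u)) (at r)"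
      by (auto intro!: derivative_eq_intros)
    have "((\<lambda>r. h (y + r *\<^sub>R u)) has_derivative (\<lambda>t. dir_deriv (t *\<^sub>R u) h (y + r *\<^sub>R u))) (at r)"
      using has_derivative_compose[OF * smooth_has_derivative[OF that]] .
    moreover have "dir_deriv (t *\<^sub>R u) h z = dir_deriv u h z * t" for t z
      using linear_cmul[OF has_derivative_linear[OF smooth_has_derivative[OF that]]] by simp
    ultimately show ?thesis by (simp add: has_field_derivative_def)
  qed
  define g where "g r = f ((x + s *\<^sub>R w) + r *\<^sub>R v) - f (x + r *\<^sub>R v)" for r
  have g': "(g has_real_derivative (dir_deriv v f ((x + s *\<^sub>R w) + r *\<^sub>R v) - dir_deriv v f (x + r *\<^sub>R v))) (at r)" for r
    unfolding g_def by (intro DERIV_diff D f)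
  obtain a where a: "0 < a" "a < s" "g s - g 0 =
      (s - 0) * (dir_deriv v f ((x + s *\<^sub>R w) + a *\<^sub>R v) - dir_deriv v f (x + a *\<^sub>R v))"
    using MVT2[OF \<open>s > 0\<close> g'] by blast
  obtain b where b: "0 < b" "b < s"
    "dir_deriv v f ((x + a *\<^sub>R v) + s *\<^sub>R w) - dir_deriv v f ((x + a *\<^sub>R v) + 0 *\<^sub>R w) =
      (s - 0) * dir_deriv w (dir_deriv v f) ((x + a *\<^sub>R v) + b *\<^sub>R w)"
    using MVT2[OF \<open>s > 0\<close> D[OF smooth_dir_deriv[OF f]]] by blast
  have "f (x + s *\<^sub>R v + s *\<^sub>R w) - f (x + s *\<^sub>R v) - f (x + s *\<^sub>R w) + f x = g s - g 0"
    by (simp add: g_def algebra_simps)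
  then show ?thesis using a b by (intro exI[of _ a] exI[of _ b]) (simp add: algebra_simps)
qed

lemma dir_deriv_commute_real:
  fixes f :: "'a::real_normed_vector \<Rightarrow> real"
  assumes f: "smooth f"
  shows "dir_deriv v (dir_deriv w f) x = dir_deriv w (dir_deriv v f) x"
proof (rule ccontr)
  let ?A = "dir_deriv w (dir_deriv v f)" and ?B = "dir_deriv v (dir_deriv w f)"
  assume ne: "\<not> ?thesis"
  define e where "e = \<bar>?A x - ?B x\<bar> / 2"
  have "e > 0" using ne by (simp add: e_def)
  have "isCont ?A x" "isCont ?B x" by (intro smooth_isCont smooth_intros f)+
  then obtain d1 d2 where d: "d1 > 0" "\<And>y. dist y x < d1 \<Longrightarrow> dist (?A y) (?A x) < e"
     "d2 > 0" "\<And>y. dist y x < d2 \<Longrightarrow> dist (?B y) (?B x) < e"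
    using \<open>e > 0\<close> unfolding continuous_at_eps_delta by metis
  define s where "s = min d1 d2 / (norm v + norm w + 1) / 2"
  have s: "s > 0" unfolding s_def using d by (simp add: add_nonneg_pos)
  have near: "dist (x + a *\<^sub>R v + b *\<^sub>R w) x < min d1 d2" if "0 < a" "a < s" "0 < b" "b < s" for a b
  proof -
    have "dist (x + a *\<^sub>R v + b *\<^sub>R w) x \<le> a * norm v + b * norm w"
      using that norm_triangle_ineq[of "a *\<^sub>R v" "b *\<^sub>R w"] by (simp add: dist_norm)
    also have "\<dots> \<le> s * norm v + s * norm w" using that by (intro add_mono mult_right_mono) auto
    also have "\<dots> \<le> s * (norm v + norm w + 1)" using s by (simp add: algebra_simps)
    also have "\<dots> = min d1 d2 / 2"
      unfolding s_def using add_nonneg_pos[of "norm v + norm w" 1] by (simp add: field_simps)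
    also have "\<dots> < min d1 d2" using d(1,3) by (simp add: min_def)
    finally show ?thesis .
  qed
  obtain a b where ab: "0 < a" "a < s" "0 < b" "b < s"
    "f (x + s *\<^sub>R v + s *\<^sub>R w) - f (x + s *\<^sub>R v) - f (x + s *\<^sub>R w) + f x = s * s * ?A (x + a *\<^sub>R v + b *\<^sub>R w)"
    using second_difference_mvt[OF f s, of x v w] by blast
  obtain a' b' where ab': "0 < a'" "a' < s" "0 < b'" "b' < s"
    "f (x + s *\<^sub>R w + s *\<^sub>R v) - f (x + s *\<^sub>R w) - f (x + s *\<^sub>R v) + f x = s * s * ?B (x + a' *\<^sub>R w + b' *\<^sub>R v)"
    using second_difference_mvt[OF f s, of x w v] by blast
  have "s * s * ?A (x + a *\<^sub>R v + b *\<^sub>R w) = s * s * ?B (x + b' *\<^sub>R v + a' *\<^sub>R w)"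
    using ab(5) ab'(5) by (simp add: algebra_simps)
  then have "?A (x + a *\<^sub>R v + b *\<^sub>R w) = ?B (x + b' *\<^sub>R v + a' *\<^sub>R w)" using s by simp
  moreover have "dist (?A (x + a *\<^sub>R v + b *\<^sub>R w)) (?A x) < e"
    "dist (?B (x + b' *\<^sub>R v + a' *\<^sub>R w)) (?B x) < e"
    using d near ab ab' by simp_all
  ultimately show False unfolding e_def dist_real_def by (auto simp: abs_if split: if_splits)
qed

lemma dir_deriv_inner_left:
  assumes "smooth f" shows "dir_deriv v (\<lambda>x. f x \<bullet> b) = (\<lambda>x. dir_deriv v f x \<bullet> b)"
  by (rule ext, rule dir_derivI)
     (rule bounded_linear.has_derivative[OF bounded_linear_inner_left smooth_has_derivative[OF assms]])

lemma dir_deriv_commute: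
  fixes f :: "'a::real_normed_vector \<Rightarrow> 'b::euclidean_space"
  assumes f: "smooth f"
  shows "dir_deriv v (dir_deriv w f) x = dir_deriv w (dir_deriv v f) x"
proof (rule euclidean_eqI)
  fix b :: 'b
  have "smooth (\<lambda>x. f x \<bullet> b)" by (intro smooth_intros f)
  from dir_deriv_commute_real[OF this, of v w x]
  show "dir_deriv v (dir_deriv w f) x \<bullet> b = dir_deriv w (dir_deriv v f) x \<bullet> b"
    by (simp add: dir_deriv_inner_left f smooth_dir_deriv)
qed

subsection \<open>A flat function\<close>

text \<open>The standard smooth function that vanishes on the negative half-line; bump functions are built from it.\<close>

definition flat :: "real \<Rightarrow> real" where "flat x = (if x > 0 then exp (- inverse x) else 0)"

lemma flat_pos_iff: "flat x > 0 \<longleftrightarrow> x > 0" and flat_nonneg: "flat x \<ge> 0" and flat_le_1: "flat x \<le> 1"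
  by (auto simp: flat_def)

text \<open>The functions \<open>x\<^sup>-\<^sup>n exp (-1/x)\<close>, extended by zero, have derivatives in their own linear span.\<close>

lemma smooth_flat: "smooth flat"
proof -
  define h where "h n x = (if x > 0 then inverse x ^ n * exp (- inverse x) else (0::real))" for n x
  \<comment> \<open>this makes the difference quotient of each \<open>h n\<close> at zero tend to zero\<close>
  have lim: "((\<lambda>x. inverse x ^ n * exp (- inverse x)) \<longlongrightarrow> 0) (at_right (0::real))" for n
  proof -
    have "((\<lambda>x::real. x ^ n / exp x) \<longlongrightarrow> 0) at_top" by (rule tendsto_power_div_exp_0)
    from filterlim_compose[OF this filterlim_inverse_at_top_right]
    show ?thesis by (simp add: exp_minus divide_inverse)
  qed
  have der: "(h n has_real_derivative (h (n + 2) x - real n * h (n + 1) x)) (at x)" for n x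
  proof -
    consider "x > 0" | "x < 0" | "x = 0" by linarith
    then show ?thesis
    proof cases
      case 1
      have "((\<lambda>x. inverse x ^ n * exp (- inverse x)) has_real_derivative
          (h (n + 2) x - real n * h (n + 1) x)) (at x)"
        using 1 by (auto intro!: derivative_eq_intros simp: h_def power2_eq_square field_simps)
           (cases n; simp add: field_simps)
      moreover have "\<forall>\<^sub>F y in nhds x. y \<in> {0<..}" using 1 by (intro eventually_nhds_in_open) auto
      ultimately show ?thesis
        by (subst DERIV_cong_ev[OF refl _ refl]) (auto simp: h_def elim: eventually_mono)
    next
      case 2
      have "\<forall>\<^sub>F y in nhds x. y \<in> {..<0}" using 2 by (intro eventually_nhds_in_open) auto
      then show ?thesis using 2
        by (subst DERIV_cong_ev[OF refl, where g="\<lambda>_. 0"]) (auto simp: h_def elim: eventually_mono)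
    next
      case 3
      have "((\<lambda>y. (h n y - h n 0) / (y - 0)) \<longlongrightarrow> 0) (at 0)"
      proof (rule filterlim_split_at)
        have "\<forall>\<^sub>F y in at_left (0::real). (h n y - h n 0) / (y - 0) = 0"
          by (auto simp: h_def eventually_at_filter)
        then show "((\<lambda>y. (h n y - h n 0) / (y - 0)) \<longlongrightarrow> 0) (at_left 0)"
          by (rule tendsto_eventually)
        have "\<forall>\<^sub>F y in at_right (0::real). inverse y ^ (n + 1) * exp (- inverse y) = (h n y - h n 0) / (y - 0)"
          by (auto simp: h_def eventually_at_filter divide_inverse)
        then show "((\<lambda>y. (h n y - h n 0) / (y - 0)) \<longlongrightarrow> 0) (at_right 0)"
          using lim[of "n + 1"] by (rule Lim_transform_eventually[rotated])
      qed
      then show ?thesis using 3 by (simp add: has_field_derivative_iff h_def)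
    qed
  qed
  have "C_k k (h n)" for k n
  proof (induction k arbitrary: n)
    case 0
    have "isCont (h n) x" for x using der DERIV_isCont by blast
    then show ?case by (simp add: continuous_on_eq_continuous_at)
  next
    case (Suc k)
    have "C_k k (\<lambda>x. h (n + 2) x + - real n * h (n + 1) x)"
      by (intro C_k_add Suc C_k_bounded_linear_compose[OF bounded_linear_mult_right])
    then show ?case
      by (rule C_k_real_SucI[rotated]) (use der[of n] in \<open>simp flip: has_real_derivative_iff_has_vector_derivative\<close>)
  qed
  then have "smooth (h 0)" by (simp add: smooth_def)
  moreover have "h 0 = flat" by (auto simp: h_def flat_def)
  ultimately show ?thesis by simp
qed

lemmas smooth_flat_compose [smooth_intros] = smooth_compose[OF smooth_flat]

lemma flat_tendsto_indicator: "(\<lambda>n. flat (real n * y)) \<longlonglongrightarrow> indicator {0<..} y"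
proof (cases "y > 0")
  case True
  have "(\<lambda>n. exp (- (inverse y * inverse (real n)))) \<longlonglongrightarrow> exp (- (inverse y * 0))"
    by (intro tendsto_intros lim_inverse_n)
  moreover have "\<forall>\<^sub>F n in sequentially. exp (- (inverse y * inverse (real n))) = flat (real n * y)"
    using eventually_gt_at_top[of 0] by eventually_elim (use True in \<open>auto simp: flat_def\<close>)
  ultimately show ?thesis using True by (simp add: tendsto_cong)
next
  case False
  then have "flat (real n * y) = 0" for n by (auto simp: flat_def mult_nonneg_nonpos zero_less_mult_iff)
  then show ?thesis using False by simp
qed

section \<open>Invariant differential operators on the oscillator group\<close>

notation osc_mult (infixl "\<cdot>" 70)

lemma mult_Osc [simp]: "g \<otimes>\<^bsub>Osc\<^esub> h = g \<cdot> h"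
  by (simp add: Osc_def)

lemma osc_mult_eq:
  "g \<cdot> h = (fst g + cis (snd (snd g)) * fst h,
     fst (snd g) + fst (snd h) + omega (fst g) (cis (snd (snd g)) * fst h) / 2, snd (snd g) + snd (snd h))"
  by (cases g; cases h) simp

lemma osc_assoc: "(g \<cdot> h) \<cdot> k = g \<cdot> (h \<cdot> k)"
  using group.is_monoid[OF group_Osc, THEN monoid.m_assoc, of g h k] by (simp add: Osc_def)

abbreviation osc_one :: osc where "osc_one \<equiv> (0, 0, 0)"

lemma osc_one_left [simp]: "osc_one \<cdot> g = g" and osc_one_right [simp]: "g \<cdot> osc_one = g"
  by (cases g; simp add: omega_def)+

definition osc_inv :: "osc \<Rightarrow> osc"
  where "osc_inv g = (- (cis (- snd (snd g)) * fst g), - fst (snd g), - snd (snd g))"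

lemma osc_inv_left [simp]: "osc_inv g \<cdot> g = osc_one"
  by (cases g) (simp add: osc_inv_def omega_def algebra_simps)

lemma osc_inv_right [simp]: "g \<cdot> osc_inv g = osc_one"
  by (cases g) (simp add: osc_inv_def omega_def cis_mult cis_cnj flip: mult.assoc)

lemma osc_inv_left' [simp]: "osc_inv g \<cdot> (g \<cdot> h) = h" and osc_inv_right' [simp]: "g \<cdot> (osc_inv g \<cdot> h) = h"
  by (simp_all flip: osc_assoc)

lemma osc_inv_unique: "g \<cdot> h = osc_one \<Longrightarrow> osc_inv g = h"
  by (metis osc_inv_left' osc_one_right)

lemma osc_inv_mult: "osc_inv (g \<cdot> h) = osc_inv h \<cdot> osc_inv g"
  by (rule osc_inv_unique) (simp add: osc_assoc)

lemma osc_inv_inv [simp]: "osc_inv (osc_inv g) = g"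
  by (rule osc_inv_unique) simp

lemma smooth_osc_mult [smooth_intros]: "smooth f \<Longrightarrow> smooth h \<Longrightarrow> smooth (\<lambda>x. f x \<cdot> h x)"
  unfolding osc_mult_eq omega_def by (intro smooth_intros)

lemma smooth_osc_inv [smooth_intros]: "smooth f \<Longrightarrow> smooth (\<lambda>x. osc_inv (f x))"
  unfolding osc_inv_def by (intro smooth_intros)

lemma continuous_on_osc_mult [continuous_intros]:
  assumes "continuous_on A f" "continuous_on A h"
  shows "continuous_on A (\<lambda>x. f x \<cdot> h x)"
proof -
  have "smooth (\<lambda>p. fst p \<cdot> snd p)" by (intro smooth_intros)
  from continuous_on_compose2[OF smooth_continuous_on[OF this, of UNIV] continuous_on_Pair[OF assms]]
  show ?thesis by simp
qed

lemma continuous_on_osc_inv [continuous_intros]: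
  assumes "continuous_on A f" shows "continuous_on A (\<lambda>x. osc_inv (f x))"
proof -
  have "smooth osc_inv" using smooth_osc_inv[OF smooth_id] .
  from continuous_on_compose2[OF smooth_continuous_on[OF this, of UNIV] assms] show ?thesis by simp
qed

subsection \<open>Left- and right-invariant vector fields\<close>

definition one_parameter :: "(real \<Rightarrow> osc) \<Rightarrow> bool"
  where "one_parameter \<gamma> \<longleftrightarrow> smooth \<gamma> \<and> (\<forall>r s. \<gamma> (r + s) = \<gamma> r \<cdot> \<gamma> s)"

lemma one_parameter_exp:
  "one_parameter exp_X" "one_parameter exp_Y" "one_parameter exp_Z" "one_parameter exp_T"
  unfolding one_parameter_def
  by (auto simp: exp_X_def[abs_def] exp_Y_def[abs_def] exp_Z_def[abs_def] exp_T_def[abs_def]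
      omega_def distrib_left intro!: smooth_intros)

lemma one_parameter_smooth: "one_parameter \<gamma> \<Longrightarrow> smooth \<gamma>"
  and one_parameter_add: "one_parameter \<gamma> \<Longrightarrow> \<gamma> (r + s) = \<gamma> r \<cdot> \<gamma> s"
  by (simp_all add: one_parameter_def)

lemma one_parameter_0: assumes "one_parameter \<gamma>" shows "\<gamma> 0 = osc_one"
proof -
  have "\<gamma> 0 \<cdot> \<gamma> 0 = \<gamma> 0" using one_parameter_add[OF assms, of 0 0] by simp
  then have "osc_inv (\<gamma> 0) \<cdot> (\<gamma> 0 \<cdot> \<gamma> 0) = osc_inv (\<gamma> 0) \<cdot> \<gamma> 0" by simp
  then show ?thesis by (simp only: osc_inv_left' osc_inv_left)
qed

lemma one_parameter_minus: assumes "one_parameter \<gamma>" shows "\<gamma> (- s) = osc_inv (\<gamma> s)"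
  using one_parameter_add[OF assms, of s "- s"] one_parameter_0[OF assms] osc_inv_unique[of "\<gamma> s" "\<gamma> (- s)"] by simp

text \<open>The derivatives \<open>lie_deriv\<close> for functions with values in any normed space, because kernels, cut-offs and wave packets are
  scalar.\<close>

definition left_deriv :: "(real \<Rightarrow> osc) \<Rightarrow> (osc \<Rightarrow> 'b::real_normed_vector) \<Rightarrow> osc \<Rightarrow> 'b"
  where "left_deriv \<gamma> f g = vector_derivative (\<lambda>s. f (g \<cdot> \<gamma> s)) (at 0)"

definition right_deriv :: "(real \<Rightarrow> osc) \<Rightarrow> (osc \<Rightarrow> 'b::real_normed_vector) \<Rightarrow> osc \<Rightarrow> 'b"
  where "right_deriv \<gamma> f g = vector_derivative (\<lambda>s. f (\<gamma> s \<cdot> g)) (at 0)"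

lemma lie_deriv_eq: "lie_deriv \<gamma> = left_deriv \<gamma>"
  by (simp add: fun_eq_iff lie_deriv_def left_deriv_def)

lemma smooth_has_vector_derivative:
  fixes f :: "real \<Rightarrow> 'b::real_normed_vector"
  assumes "smooth f" shows "(f has_vector_derivative vector_derivative f (at s)) (at s)"
  unfolding vector_derivative_works[symmetric]
  by (rule differentiableI[OF smooth_has_derivative[OF assms]])

lemma left_deriv_dir:
  assumes \<gamma>: "(\<lambda>s. g \<cdot> \<gamma> s) = c" "c 0 = g" "(c has_vector_derivative v) (at 0)" and f: "smooth f"
  shows "left_deriv \<gamma> f g = dir_deriv v f g"
proof -
  have "((\<lambda>s. f (c s)) has_derivative (\<lambda>s. dir_deriv (s *\<^sub>R v) f (c 0))) (at 0)"
    using has_derivative_compose[OF assms(3)[unfolded has_vector_derivative_def] smooth_has_derivative[OF f]] .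
  moreover have "dir_deriv (s *\<^sub>R v) f (c 0) = s *\<^sub>R dir_deriv v f (c 0)" for s
    using linear_cmul[OF has_derivative_linear[OF smooth_has_derivative[OF f]]] by simp
  ultimately have "((\<lambda>s. f (c s)) has_vector_derivative dir_deriv v f (c 0)) (at 0)"
    by (simp add: has_vector_derivative_def)
  then show ?thesis unfolding left_deriv_def using assms(1,2)
    by (auto simp: vector_derivative_at fun_eq_iff)
qed

lemma right_deriv_dir:
  assumes \<gamma>: "(\<lambda>s. \<gamma> s \<cdot> g) = c" "c 0 = g" "(c has_vector_derivative v) (at 0)" and f: "smooth f"
  shows "right_deriv \<gamma> f g = dir_deriv v f g"
proof -
  have "((\<lambda>s. f (c s)) has_derivative (\<lambda>s. dir_deriv (s *\<^sub>R v) f (c 0))) (at 0)"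
    using has_derivative_compose[OF assms(3)[unfolded has_vector_derivative_def] smooth_has_derivative[OF f]] .
  moreover have "dir_deriv (s *\<^sub>R v) f (c 0) = s *\<^sub>R dir_deriv v f (c 0)" for s
    using linear_cmul[OF has_derivative_linear[OF smooth_has_derivative[OF f]]] by simp
  ultimately have "((\<lambda>s. f (c s)) has_vector_derivative dir_deriv v f (c 0)) (at 0)"
    by (simp add: has_vector_derivative_def)
  then show ?thesis unfolding right_deriv_def using assms(1,2)
    by (auto simp: vector_derivative_at fun_eq_iff)
qed

lemma smooth_along_one_parameter:
  "one_parameter \<gamma> \<Longrightarrow> smooth f \<Longrightarrow> smooth (\<lambda>s. f (g \<cdot> \<gamma> s))"
  by (rule smooth_compose[where g=f])
     (simp_all add: smooth_osc_mult[OF smooth_const] one_parameter_smooth)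

lemma left_deriv_has_vector_derivative:
  assumes \<gamma>: "one_parameter \<gamma>" and f: "smooth f"
  shows "((\<lambda>s. f (g \<cdot> \<gamma> s)) has_vector_derivative left_deriv \<gamma> f (g \<cdot> \<gamma> s)) (at s)"
proof -
  have "((\<lambda>r. f ((g \<cdot> \<gamma> s) \<cdot> \<gamma> r)) has_vector_derivative left_deriv \<gamma> f (g \<cdot> \<gamma> s)) (at (s - s))"
    unfolding left_deriv_def
    using smooth_has_vector_derivative[OF smooth_along_one_parameter[OF \<gamma> f, of "g \<cdot> \<gamma> s"], of 0] by simp
  moreover have "((\<lambda>r. r - s) has_vector_derivative 1) (at s)"
    by (auto intro!: derivative_eq_intros)
  ultimately have "((\<lambda>r. f ((g \<cdot> \<gamma> s) \<cdot> \<gamma> r)) \<circ> (\<lambda>r. r - s) has_vector_derivative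
      1 *\<^sub>R left_deriv \<gamma> f (g \<cdot> \<gamma> s)) (at s)"
    by (intro vector_diff_chain_at)
  moreover have "(g \<cdot> \<gamma> s) \<cdot> \<gamma> (r - s) = g \<cdot> \<gamma> r" for r
    using one_parameter_add[OF \<gamma>, of s "r - s"] by (simp add: osc_assoc)
  ultimately show ?thesis by (simp add: o_def)
qed

lemma smooth_left_deriv [smooth_intros]:
  assumes \<gamma>: "one_parameter \<gamma>" and f: "smooth f" shows "smooth (left_deriv \<gamma> f)"
proof -
  define F where "F p = f (fst p \<cdot> \<gamma> (snd p))" for p
  have F: "smooth F" unfolding F_def
    by (rule smooth_compose[OF f])
       (intro smooth_osc_mult smooth_fst smooth_id smooth_compose[OF one_parameter_smooth[OF \<gamma>]] smooth_snd)
  have "left_deriv \<gamma> f g = dir_deriv (0, 1) F (g, 0)" for g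
  proof -
    have "((\<lambda>s::real. (g, s)) has_derivative (\<lambda>s. (0, s))) (at 0)"
      by (auto intro!: derivative_eq_intros)
    from has_derivative_compose[OF this smooth_has_derivative[OF F]]
    have "((\<lambda>s. F (g, s)) has_derivative (\<lambda>s. dir_deriv (0, s) F (g, 0))) (at 0)" .
    moreover have "(\<lambda>s. dir_deriv (0, s) F (g, 0)) = (\<lambda>s::real. s *\<^sub>R dir_deriv (0, 1) F (g, 0))"
    proof
      fix s :: real
      show "dir_deriv (0, s) F (g, 0) = s *\<^sub>R dir_deriv (0, 1) F (g, 0)"
        using linear_cmul[OF has_derivative_linear[OF smooth_has_derivative[OF F]], of s "(0, 1)"] by simp
    qed
    ultimately have "((\<lambda>s. F (g, s)) has_vector_derivative dir_deriv (0, 1) F (g, 0)) (at 0)"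
      unfolding has_vector_derivative_def by (rule has_derivative_eq_rhs)
    then show ?thesis by (simp add: left_deriv_def F_def vector_derivative_at)
  qed
  moreover have "smooth (\<lambda>g. dir_deriv (0, 1) F (g, 0))"
    by (rule smooth_compose[OF smooth_dir_deriv[OF F]]) (intro smooth_intros)
  ultimately show ?thesis by (metis ext)
qed

lemma left_deriv_translate: "left_deriv \<gamma> (\<lambda>h. f (l \<cdot> h)) g = left_deriv \<gamma> f (l \<cdot> g)"
  by (simp add: left_deriv_def osc_assoc)

text \<open>Inversion turns \<open>h \<gamma>(s)\<close> into \<open>\<gamma>(-s) h\<^sup>-\<^sup>1\<close>, whence the sign.\<close>

lemma left_deriv_inverse:
  assumes \<gamma>: "one_parameter \<gamma>" and f: "smooth f"
  shows "left_deriv \<gamma> (\<lambda>h. f (osc_inv h \<cdot> g)) h = - right_deriv \<gamma> f (osc_inv h \<cdot> g)"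
proof -
  define x where "x = osc_inv h \<cdot> g"
  have sm: "smooth (\<lambda>s. f (\<gamma> s \<cdot> x))"
    by (rule smooth_compose[OF f]) (intro smooth_intros one_parameter_smooth \<gamma>)
  have "((\<lambda>s. f (\<gamma> s \<cdot> x)) has_vector_derivative right_deriv \<gamma> f x) (at (- 0))"
    unfolding right_deriv_def using smooth_has_vector_derivative[OF sm, of 0] by simp
  moreover have "((\<lambda>s::real. - s) has_vector_derivative - 1) (at 0)"
    by (auto intro!: derivative_eq_intros)
  ultimately have "((\<lambda>s. f (\<gamma> s \<cdot> x)) \<circ> uminus has_vector_derivative (- 1) *\<^sub>R right_deriv \<gamma> f x) (at 0)"
    by (intro vector_diff_chain_at)
  moreover have "osc_inv (h \<cdot> \<gamma> s) \<cdot> g = \<gamma> (- s) \<cdot> x" for s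
    by (simp add: osc_inv_mult one_parameter_minus[OF \<gamma>] osc_assoc x_def)
  ultimately show ?thesis unfolding left_deriv_def by (simp add: o_def vector_derivative_at x_def)
qed

lemma left_deriv_bounded_linear:
  assumes "bounded_linear B" and \<gamma>: "one_parameter \<gamma>" and f: "smooth f"
  shows "left_deriv \<gamma> (\<lambda>g. B (f g)) g = B (left_deriv \<gamma> f g)"
  unfolding left_deriv_def
  by (rule vector_derivative_at)
     (rule bounded_linear.has_vector_derivative[OF assms(1)
        smooth_has_vector_derivative[OF smooth_along_one_parameter[OF \<gamma> f]]])

lemma left_deriv_add:
  assumes \<gamma>: "one_parameter \<gamma>" and f: "smooth f" and h: "smooth h"
  shows "left_deriv \<gamma> (\<lambda>g. f g + h g) g = left_deriv \<gamma> f g + left_deriv \<gamma> h g"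
  unfolding left_deriv_def
  by (rule vector_derivative_at has_vector_derivative_add smooth_has_vector_derivative smooth_along_one_parameter \<gamma> f h)+

lemma left_deriv_bilinear:
  assumes B: "bounded_bilinear B" and \<gamma>: "one_parameter \<gamma>" and f: "smooth f" and h: "smooth h"
  shows "left_deriv \<gamma> (\<lambda>g. B (f g) (h g)) g = B (f g) (left_deriv \<gamma> h g) + B (left_deriv \<gamma> f g) (h g)"
proof -
  have "((\<lambda>s. B (f (g \<cdot> \<gamma> s)) (h (g \<cdot> \<gamma> s))) has_vector_derivative
      B (f (g \<cdot> \<gamma> 0)) (left_deriv \<gamma> h g) + B (left_deriv \<gamma> f g) (h (g \<cdot> \<gamma> 0))) (at 0)"
    using bounded_bilinear.has_vector_derivative[OF B
        left_deriv_has_vector_derivative[OF \<gamma> f, of g 0] left_deriv_has_vector_derivative[OF \<gamma> h, of g 0]]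
    by (simp add: one_parameter_0[OF \<gamma>])
  then show ?thesis
    unfolding left_deriv_def[of \<gamma> "\<lambda>g. B (f g) (h g)"] by (simp add: vector_derivative_at one_parameter_0[OF \<gamma>])
qed

lemma left_deriv_local:
  assumes "open U" "g \<in> U" "\<And>h. h \<in> U \<Longrightarrow> f h = f' h" and \<gamma>: "one_parameter \<gamma>"
  shows "left_deriv \<gamma> f g = left_deriv \<gamma> f' g"
  unfolding left_deriv_def
proof (rule vector_derivative_cong_eq)
  have "isCont (\<lambda>s. g \<cdot> \<gamma> s) 0"
    by (rule smooth_isCont) (intro smooth_intros one_parameter_smooth \<gamma>)
  then have "((\<lambda>s. g \<cdot> \<gamma> s) \<longlongrightarrow> g \<cdot> \<gamma> 0) (nhds 0)"
    using tendsto_at_iff_tendsto_nhds[of "\<lambda>s. g \<cdot> \<gamma> s" 0] by (simp add: isCont_def)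
  then have "\<forall>\<^sub>F s in nhds 0. g \<cdot> \<gamma> s \<in> U"
    by (rule topological_tendstoD) (use assms(1,2) one_parameter_0[OF \<gamma>] in simp_all)
  then show "\<forall>\<^sub>F s in nhds 0. s \<in> UNIV \<longrightarrow> f (g \<cdot> \<gamma> s) = f' (g \<cdot> \<gamma> s)"
    by eventually_elim (use assms(3) in auto)
qed auto

subsection \<open>Coordinates\<close>

abbreviation D1 where "D1 \<equiv> dir_deriv ((1, 0, 0) :: osc)"
abbreviation D2 where "D2 \<equiv> dir_deriv ((\<i>, 0, 0) :: osc)"
abbreviation D3 where "D3 \<equiv> dir_deriv ((0, 1, 0) :: osc)"
abbreviation D4 where "D4 \<equiv> dir_deriv ((0, 0, 1) :: osc)"

lemma dir_deriv_coordinates: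
  assumes "smooth f"
  shows "dir_deriv v f g = Re (fst v) *\<^sub>R D1 f g + Im (fst v) *\<^sub>R D2 f g
    + fst (snd v) *\<^sub>R D3 f g + snd (snd v) *\<^sub>R D4 f g"
proof -
  interpret linear "\<lambda>v. dir_deriv v f g"
    by (rule has_derivative_linear[OF smooth_has_derivative[OF assms]])
  have "v = Re (fst v) *\<^sub>R (1, 0, 0) + Im (fst v) *\<^sub>R (\<i>, 0, 0)
    + fst (snd v) *\<^sub>R (0, 1, 0) + snd (snd v) *\<^sub>R (0, 0, 1)"
    by (cases v) (auto simp: complex_eq_iff)
  then have "dir_deriv v f g = dir_deriv (Re (fst v) *\<^sub>R (1, 0, 0) + Im (fst v) *\<^sub>R (\<i>, 0, 0)
    + fst (snd v) *\<^sub>R (0, 1, 0) + snd (snd v) *\<^sub>R (0, 0, 1)) f g" by simp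
  then show ?thesis by (simp only: add scale)
qed

lemma left_deriv_coordinates:
  assumes f: "smooth f"
  shows "left_deriv exp_X f = (\<lambda>g. cos (snd (snd g)) *\<^sub>R D1 f g + sin (snd (snd g)) *\<^sub>R D2 f g
      + ((Re (fst g) * sin (snd (snd g)) - Im (fst g) * cos (snd (snd g))) / 2) *\<^sub>R D3 f g)"
    and "left_deriv exp_Y f = (\<lambda>g. (- sin (snd (snd g))) *\<^sub>R D1 f g + cos (snd (snd g)) *\<^sub>R D2 f g
      + ((Re (fst g) * cos (snd (snd g)) + Im (fst g) * sin (snd (snd g))) / 2) *\<^sub>R D3 f g)"
    and "left_deriv exp_Z f = D3 f"
    and "left_deriv exp_T f = D4 f"
proof -
  show "left_deriv exp_X f = (\<lambda>g. cos (snd (snd g)) *\<^sub>R D1 f g + sin (snd (snd g)) *\<^sub>R D2 f g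
      + ((Re (fst g) * sin (snd (snd g)) - Im (fst g) * cos (snd (snd g))) / 2) *\<^sub>R D3 f g)"
  proof
    fix g :: osc
    let ?v = "(cis (snd (snd g)), omega (fst g) (cis (snd (snd g))) / 2, 0) :: osc"
    have dd: "left_deriv exp_X f g = dir_deriv ?v f g"
      by (rule left_deriv_dir[where c="\<lambda>s. g + s *\<^sub>R ?v", OF _ _ _ f])
         (auto intro!: derivative_eq_intros simp: osc_mult_eq exp_X_def omega_def fun_eq_iff prod_eq_iff
           complex_eq_iff algebra_simps add_divide_distrib)
    show "left_deriv exp_X f g = cos (snd (snd g)) *\<^sub>R D1 f g + sin (snd (snd g)) *\<^sub>R D2 f g
      + ((Re (fst g) * sin (snd (snd g)) - Im (fst g) * cos (snd (snd g))) / 2) *\<^sub>R D3 f g"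
      unfolding dd dir_deriv_coordinates[OF f, of ?v] by (simp add: omega_def)
  qed
  show "left_deriv exp_Y f = (\<lambda>g. (- sin (snd (snd g))) *\<^sub>R D1 f g + cos (snd (snd g)) *\<^sub>R D2 f g
      + ((Re (fst g) * cos (snd (snd g)) + Im (fst g) * sin (snd (snd g))) / 2) *\<^sub>R D3 f g)"
  proof
    fix g :: osc
    let ?v = "(\<i> * cis (snd (snd g)), omega (fst g) (\<i> * cis (snd (snd g))) / 2, 0) :: osc"
    have dd: "left_deriv exp_Y f g = dir_deriv ?v f g"
      by (rule left_deriv_dir[where c="\<lambda>s. g + s *\<^sub>R ?v", OF _ _ _ f])
         (auto intro!: derivative_eq_intros simp: osc_mult_eq exp_Y_def omega_def fun_eq_iff prod_eq_iff
           complex_eq_iff algebra_simps add_divide_distrib)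
    show "left_deriv exp_Y f g = (- sin (snd (snd g))) *\<^sub>R D1 f g + cos (snd (snd g)) *\<^sub>R D2 f g
      + ((Re (fst g) * cos (snd (snd g)) + Im (fst g) * sin (snd (snd g))) / 2) *\<^sub>R D3 f g"
      unfolding dd dir_deriv_coordinates[OF f, of ?v] by (simp add: omega_def)
  qed
  show "left_deriv exp_Z f = D3 f"
  proof
    fix g :: osc
    show "left_deriv exp_Z f g = D3 f g"
      by (rule left_deriv_dir[where c="\<lambda>s. g + s *\<^sub>R (0, 1, 0)", OF _ _ _ f])
         (auto intro!: derivative_eq_intros simp: osc_mult_eq exp_Z_def omega_def fun_eq_iff prod_eq_iff)
  qed
  show "left_deriv exp_T f = D4 f"
  proof
    fix g :: osc
    show "left_deriv exp_T f g = D4 f g"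
      by (rule left_deriv_dir[where c="\<lambda>s. g + s *\<^sub>R (0, 0, 1)", OF _ _ _ f])
         (auto intro!: derivative_eq_intros simp: osc_mult_eq exp_T_def omega_def fun_eq_iff prod_eq_iff)
  qed
qed

lemma right_deriv_coordinates:
  assumes f: "smooth f"
  shows "right_deriv exp_X f = (\<lambda>g. D1 f g + (Im (fst g) / 2) *\<^sub>R D3 f g)"
    and "right_deriv exp_Y f = (\<lambda>g. D2 f g + (- Re (fst g) / 2) *\<^sub>R D3 f g)"
    and "right_deriv exp_Z f = D3 f"
    and "right_deriv exp_T f = (\<lambda>g. (- Im (fst g)) *\<^sub>R D1 f g + Re (fst g) *\<^sub>R D2 f g + D4 f g)"
proof -
  show "right_deriv exp_X f = (\<lambda>g. D1 f g + (Im (fst g) / 2) *\<^sub>R D3 f g)"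
  proof
    fix g :: osc
    let ?v = "(1, Im (fst g) / 2, 0) :: osc"
    have dd: "right_deriv exp_X f g = dir_deriv ?v f g"
      by (rule right_deriv_dir[where c="\<lambda>s. g + s *\<^sub>R ?v", OF _ _ _ f])
         (auto intro!: derivative_eq_intros simp: osc_mult_eq exp_X_def omega_def fun_eq_iff prod_eq_iff
           complex_eq_iff)
    show "right_deriv exp_X f g = D1 f g + (Im (fst g) / 2) *\<^sub>R D3 f g"
      unfolding dd dir_deriv_coordinates[OF f, of ?v] by (simp add: omega_def)
  qed
  show "right_deriv exp_Y f = (\<lambda>g. D2 f g + (- Re (fst g) / 2) *\<^sub>R D3 f g)"
  proof
    fix g :: osc
    let ?v = "(\<i>, - Re (fst g) / 2, 0) :: osc"
    have dd: "right_deriv exp_Y f g = dir_deriv ?v f g"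
      by (rule right_deriv_dir[where c="\<lambda>s. g + s *\<^sub>R ?v", OF _ _ _ f])
         (auto intro!: derivative_eq_intros simp: osc_mult_eq exp_Y_def omega_def fun_eq_iff prod_eq_iff
           complex_eq_iff)
    show "right_deriv exp_Y f g = D2 f g + (- Re (fst g) / 2) *\<^sub>R D3 f g"
      unfolding dd dir_deriv_coordinates[OF f, of ?v] by (simp add: omega_def)
  qed
  show "right_deriv exp_Z f = D3 f"
  proof
    fix g :: osc
    show "right_deriv exp_Z f g = D3 f g"
      by (rule right_deriv_dir[where c="\<lambda>s. g + s *\<^sub>R (0, 1, 0)", OF _ _ _ f])
         (auto intro!: derivative_eq_intros simp: osc_mult_eq exp_Z_def omega_def fun_eq_iff prod_eq_iff)
  qed
  show "right_deriv exp_T f = (\<lambda>g. (- Im (fst g)) *\<^sub>R D1 f g + Re (fst g) *\<^sub>R D2 f g + D4 f g)"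
  proof
    fix g :: osc
    let ?v = "(\<i> * fst g, 0, 1) :: osc"
    let ?c = "\<lambda>s. (cis s * fst g, fst (snd g), s + snd (snd g)) :: osc"
    have "((\<lambda>z. exp (\<i> * z) * fst g) has_field_derivative \<i> * fst g) (at (of_real 0))"
      by (auto intro!: derivative_eq_intros)
    from has_vector_derivative_real_field[OF this]
    have "((\<lambda>s. cis s * fst g) has_vector_derivative \<i> * fst g) (at 0)"
      by (simp add: cis_conv_exp)
    moreover have "((\<lambda>s. (fst (snd g), s + snd (snd g))) has_vector_derivative (0, 1)) (at 0)"
      by (rule has_vector_derivative_Pair) (auto intro!: derivative_eq_intros)
    ultimately have "(?c has_vector_derivative ?v) (at 0)"
      by (rule has_vector_derivative_Pair)
    then have dd: "right_deriv exp_T f g = dir_deriv ?v f g"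
      by (intro right_deriv_dir[where c="?c", OF _ _ _ f])
         (auto simp: osc_mult_eq exp_T_def omega_def fun_eq_iff prod_eq_iff)
    show "right_deriv exp_T f g = (- Im (fst g)) *\<^sub>R D1 f g + Re (fst g) *\<^sub>R D2 f g + D4 f g"
      unfolding dd dir_deriv_coordinates[OF f, of ?v] by (simp add: omega_def)
  qed
qed

text \<open>Derivatives of the coefficients of the invariant fields, by the product rule in coordinates. They are stated for real functions,
  where ring normalisation applies; values in other spaces are reached through their components.\<close>

lemma dir_deriv_left_X:
  fixes f :: "osc \<Rightarrow> real"
  assumes f: "smooth f"
  shows "dir_deriv v (left_deriv exp_X f) g =
    cos (snd (snd g)) * dir_deriv v (D1 f) g + sin (snd (snd g)) * dir_deriv v (D2 f) g
    + (Re (fst g) * sin (snd (snd g)) - Im (fst g) * cos (snd (snd g))) / 2 * dir_deriv v (D3 f) g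
    + snd (snd v) * (- sin (snd (snd g)) * D1 f g + cos (snd (snd g)) * D2 f g
       + (Re (fst g) * cos (snd (snd g)) + Im (fst g) * sin (snd (snd g))) / 2 * D3 f g)
    + (Re (fst v) * sin (snd (snd g)) - Im (fst v) * cos (snd (snd g))) / 2 * D3 f g"
proof (rule dir_derivI)
  show "(left_deriv exp_X f has_derivative (\<lambda>v.
    cos (snd (snd g)) * dir_deriv v (D1 f) g + sin (snd (snd g)) * dir_deriv v (D2 f) g
    + (Re (fst g) * sin (snd (snd g)) - Im (fst g) * cos (snd (snd g))) / 2 * dir_deriv v (D3 f) g
    + snd (snd v) * (- sin (snd (snd g)) * D1 f g + cos (snd (snd g)) * D2 f g
       + (Re (fst g) * cos (snd (snd g)) + Im (fst g) * sin (snd (snd g))) / 2 * D3 f g)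
    + (Re (fst v) * sin (snd (snd g)) - Im (fst v) * cos (snd (snd g))) / 2 * D3 f g)) (at g)"
    unfolding left_deriv_coordinates[OF f]
    by (auto intro!: derivative_eq_intros smooth_has_derivative smooth_dir_deriv f
        simp: algebra_simps add_divide_distrib diff_divide_distrib)
qed

lemma dir_deriv_left_Y:
  fixes f :: "osc \<Rightarrow> real"
  assumes f: "smooth f"
  shows "dir_deriv v (left_deriv exp_Y f) g =
    - sin (snd (snd g)) * dir_deriv v (D1 f) g + cos (snd (snd g)) * dir_deriv v (D2 f) g
    + (Re (fst g) * cos (snd (snd g)) + Im (fst g) * sin (snd (snd g))) / 2 * dir_deriv v (D3 f) g
    + snd (snd v) * (- cos (snd (snd g)) * D1 f g - sin (snd (snd g)) * D2 f g
       + (Im (fst g) * cos (snd (snd g)) - Re (fst g) * sin (snd (snd g))) / 2 * D3 f g)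
    + (Re (fst v) * cos (snd (snd g)) + Im (fst v) * sin (snd (snd g))) / 2 * D3 f g"
proof (rule dir_derivI)
  show "(left_deriv exp_Y f has_derivative (\<lambda>v.
    - sin (snd (snd g)) * dir_deriv v (D1 f) g + cos (snd (snd g)) * dir_deriv v (D2 f) g
    + (Re (fst g) * cos (snd (snd g)) + Im (fst g) * sin (snd (snd g))) / 2 * dir_deriv v (D3 f) g
    + snd (snd v) * (- cos (snd (snd g)) * D1 f g - sin (snd (snd g)) * D2 f g
       + (Im (fst g) * cos (snd (snd g)) - Re (fst g) * sin (snd (snd g))) / 2 * D3 f g)
    + (Re (fst v) * cos (snd (snd g)) + Im (fst v) * sin (snd (snd g))) / 2 * D3 f g)) (at g)"
    unfolding left_deriv_coordinates[OF f]
    by (auto intro!: derivative_eq_intros smooth_has_derivative smooth_dir_deriv f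
        simp: algebra_simps add_divide_distrib diff_divide_distrib)
qed

lemma dir_deriv_right_X:
  fixes f :: "osc \<Rightarrow> real"
  assumes f: "smooth f"
  shows "dir_deriv v (right_deriv exp_X f) g =
    dir_deriv v (D1 f) g + Im (fst g) / 2 * dir_deriv v (D3 f) g + Im (fst v) / 2 * D3 f g"
  unfolding right_deriv_coordinates[OF f]
  by (rule dir_derivI) (auto intro!: derivative_eq_intros smooth_has_derivative smooth_dir_deriv f simp: field_simps)

lemma dir_deriv_right_Y:
  fixes f :: "osc \<Rightarrow> real"
  assumes f: "smooth f"
  shows "dir_deriv v (right_deriv exp_Y f) g =
    dir_deriv v (D2 f) g - Re (fst g) / 2 * dir_deriv v (D3 f) g - Re (fst v) / 2 * D3 f g"
  unfolding right_deriv_coordinates[OF f]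
  by (rule dir_derivI) (auto intro!: derivative_eq_intros smooth_has_derivative smooth_dir_deriv f simp: field_simps)

lemma dir_deriv_right_T:
  fixes f :: "osc \<Rightarrow> real"
  assumes f: "smooth f"
  shows "dir_deriv v (right_deriv exp_T f) g =
    - Im (fst g) * dir_deriv v (D1 f) g + Re (fst g) * dir_deriv v (D2 f) g + dir_deriv v (D4 f) g
    - Im (fst v) * D1 f g + Re (fst v) * D2 f g"
  unfolding right_deriv_coordinates[OF f]
  by (rule dir_derivI) (auto intro!: derivative_eq_intros smooth_has_derivative smooth_dir_deriv f simp: field_simps)

lemma smooth_right_deriv:
  fixes f :: "osc \<Rightarrow> real"
  assumes "smooth f"
  shows "smooth (right_deriv exp_X f)" "smooth (right_deriv exp_Y f)"
    "smooth (right_deriv exp_Z f)" "smooth (right_deriv exp_T f)"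
  unfolding right_deriv_coordinates[OF assms] by (intro smooth_intros assms; simp)+

definition casimir_op :: "(osc \<Rightarrow> 'b::real_normed_vector) \<Rightarrow> osc \<Rightarrow> 'b"
  where "casimir_op f g = left_deriv exp_X (left_deriv exp_X f) g + left_deriv exp_Y (left_deriv exp_Y f) g
    + 2 *\<^sub>R left_deriv exp_Z (left_deriv exp_T f) g"

definition right_casimir_op :: "(osc \<Rightarrow> 'b::real_normed_vector) \<Rightarrow> osc \<Rightarrow> 'b"
  where "right_casimir_op f g = right_deriv exp_X (right_deriv exp_X f) g + right_deriv exp_Y (right_deriv exp_Y f) g
    + 2 *\<^sub>R right_deriv exp_Z (right_deriv exp_T f) g"

lemma casimir_eq: "casimir = casimir_op"
  by (simp add: fun_eq_iff casimir_def casimir_op_def lie_deriv_eq vec_eq_iff scaleR_conv_of_real)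

lemma D_order:
  fixes f :: "osc \<Rightarrow> 'b::euclidean_space"
  assumes f: "smooth f"
  shows "D2 (D1 f) g = D1 (D2 f) g" "D3 (D1 f) g = D1 (D3 f) g" "D4 (D1 f) g = D1 (D4 f) g"
    "D3 (D2 f) g = D2 (D3 f) g" "D4 (D2 f) g = D2 (D4 f) g" "D4 (D3 f) g = D3 (D4 f) g"
  by (rule dir_deriv_commute[OF f])+

lemma casimir_op_coordinates_real:
  fixes f :: "osc \<Rightarrow> real"
  assumes f: "smooth f"
  shows "casimir_op f g = D1 (D1 f) g + D2 (D2 f) g + Re (fst g) * D2 (D3 f) g - Im (fst g) * D1 (D3 f) g
    + ((Re (fst g))\<^sup>2 + (Im (fst g))\<^sup>2) / 4 * D3 (D3 f) g + 2 * D3 (D4 f) g"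
    and "right_casimir_op f g = D1 (D1 f) g + D2 (D2 f) g + Re (fst g) * D2 (D3 f) g - Im (fst g) * D1 (D3 f) g
    + ((Re (fst g))\<^sup>2 + (Im (fst g))\<^sup>2) / 4 * D3 (D3 f) g + 2 * D3 (D4 f) g"
proof -
  note sl = smooth_left_deriv[OF one_parameter_exp(1) f] smooth_left_deriv[OF one_parameter_exp(2) f]
     smooth_left_deriv[OF one_parameter_exp(4) f]
  have 1: "left_deriv exp_Z (left_deriv exp_T f) g = D3 (D4 f) g"
    unfolding left_deriv_coordinates(4)[OF f] left_deriv_coordinates(3)[OF smooth_dir_deriv[OF f]] ..
  define c s where cs: "c = cos (snd (snd g))" "s = sin (snd (snd g))"
  have cs1: "s * s = 1 - c * c" "s * (s * w) = w - c * (c * w)" for w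
  proof -
    show "s * s = 1 - c * c" using sin_cos_squared_add3[of "snd (snd g)"] by (simp add: cs algebra_simps)
    then show "s * (s * w) = w - c * (c * w)" by (metis left_diff_distrib mult.assoc mult_1)
  qed
  define x y where xy: "x = Re (fst g)" "y = Im (fst g)"
  have 2: "left_deriv exp_X (left_deriv exp_X f) g + left_deriv exp_Y (left_deriv exp_Y f) g =
     D1 (D1 f) g + D2 (D2 f) g + x * D2 (D3 f) g - y * D1 (D3 f) g + (x\<^sup>2 + y\<^sup>2) / 4 * D3 (D3 f) g"
    unfolding left_deriv_coordinates(1)[OF sl(1)] left_deriv_coordinates(2)[OF sl(2)]
      dir_deriv_left_X[OF f] dir_deriv_left_Y[OF f] D_order[OF f] cs[symmetric] xy[symmetric] fst_conv snd_conv real_scaleR_def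
      one_complex.sel imaginary_unit.sel zero_complex.sel
    by (simp add: cs1 algebra_simps add_divide_distrib diff_divide_distrib power2_eq_square)
  show "casimir_op f g = D1 (D1 f) g + D2 (D2 f) g + Re (fst g) * D2 (D3 f) g - Im (fst g) * D1 (D3 f) g
    + ((Re (fst g))\<^sup>2 + (Im (fst g))\<^sup>2) / 4 * D3 (D3 f) g + 2 * D3 (D4 f) g"
    unfolding casimir_op_def 1 2 xy by simp
  note sr = smooth_right_deriv[OF f]
  show "right_casimir_op f g = D1 (D1 f) g + D2 (D2 f) g + Re (fst g) * D2 (D3 f) g - Im (fst g) * D1 (D3 f) g
    + ((Re (fst g))\<^sup>2 + (Im (fst g))\<^sup>2) / 4 * D3 (D3 f) g + 2 * D3 (D4 f) g"
    unfolding right_casimir_op_def right_deriv_coordinates(1)[OF sr(1)] right_deriv_coordinates(2)[OF sr(2)]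
       right_deriv_coordinates(3)[OF sr(4)]
       dir_deriv_right_X[OF f] dir_deriv_right_Y[OF f] dir_deriv_right_T[OF f] D_order[OF f] fst_conv snd_conv real_scaleR_def
      one_complex.sel imaginary_unit.sel zero_complex.sel
    by (simp add: algebra_simps add_divide_distrib diff_divide_distrib power2_eq_square)
qed

lemma commutators_real:
  fixes f :: "osc \<Rightarrow> real"
  assumes f: "smooth f"
  shows "left_deriv exp_T (left_deriv exp_X f) g = left_deriv exp_X (left_deriv exp_T f) g + left_deriv exp_Y f g"
    and "left_deriv exp_T (left_deriv exp_Y f) g = left_deriv exp_Y (left_deriv exp_T f) g - left_deriv exp_X f g"
    and "left_deriv exp_X (left_deriv exp_Y f) g = left_deriv exp_Y (left_deriv exp_X f) g + left_deriv exp_Z f g"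
    and "left_deriv exp_Z (left_deriv exp_X f) g = left_deriv exp_X (left_deriv exp_Z f) g"
    and "left_deriv exp_Z (left_deriv exp_Y f) g = left_deriv exp_Y (left_deriv exp_Z f) g"
    and "left_deriv exp_T (left_deriv exp_Z f) g = left_deriv exp_Z (left_deriv exp_T f) g"
proof -
  note sl = smooth_left_deriv[OF one_parameter_exp(1) f] smooth_left_deriv[OF one_parameter_exp(2) f]
     smooth_left_deriv[OF one_parameter_exp(3) f] smooth_left_deriv[OF one_parameter_exp(4) f]
  define c s where cs: "c = cos (snd (snd g))" "s = sin (snd (snd g))"
  have cs1: "s * s = 1 - c * c" "s * (s * w) = w - c * (c * w)" for w
  proof -
    show "s * s = 1 - c * c" using sin_cos_squared_add3[of "snd (snd g)"] by (simp add: cs algebra_simps)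
    then show "s * (s * w) = w - c * (c * w)" by (metis left_diff_distrib mult.assoc mult_1)
  qed
  define x y where xy: "x = Re (fst g)" "y = Im (fst g)"
  note u = left_deriv_coordinates[OF smooth_dir_deriv[OF f]] dir_deriv_left_X[OF f] dir_deriv_left_Y[OF f] left_deriv_coordinates(3)[OF f] left_deriv_coordinates(4)[OF f]
     D_order[OF f] cs[symmetric] xy[symmetric] fst_conv snd_conv real_scaleR_def
      one_complex.sel imaginary_unit.sel zero_complex.sel
  show "left_deriv exp_T (left_deriv exp_X f) g = left_deriv exp_X (left_deriv exp_T f) g + left_deriv exp_Y f g"
    unfolding left_deriv_coordinates(4)[OF sl(1)] left_deriv_coordinates(1)[OF sl(4)] left_deriv_coordinates(2)[OF f] u
    by (simp add: algebra_simps add_divide_distrib diff_divide_distrib power2_eq_square)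
  show "left_deriv exp_T (left_deriv exp_Y f) g = left_deriv exp_Y (left_deriv exp_T f) g - left_deriv exp_X f g"
    unfolding left_deriv_coordinates(4)[OF sl(2)] left_deriv_coordinates(2)[OF sl(4)] left_deriv_coordinates(1)[OF f] u
    by (simp add: algebra_simps add_divide_distrib diff_divide_distrib power2_eq_square)
  show "left_deriv exp_X (left_deriv exp_Y f) g = left_deriv exp_Y (left_deriv exp_X f) g + left_deriv exp_Z f g"
    unfolding left_deriv_coordinates(1)[OF sl(2)] left_deriv_coordinates(2)[OF sl(1)] left_deriv_coordinates(3)[OF f] u
    by (simp add: cs1 algebra_simps add_divide_distrib diff_divide_distrib power2_eq_square)
  show "left_deriv exp_Z (left_deriv exp_X f) g = left_deriv exp_X (left_deriv exp_Z f) g"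
    unfolding left_deriv_coordinates(3)[OF sl(1)] left_deriv_coordinates(1)[OF sl(3)] u
    by (simp add: algebra_simps add_divide_distrib diff_divide_distrib power2_eq_square)
  show "left_deriv exp_Z (left_deriv exp_Y f) g = left_deriv exp_Y (left_deriv exp_Z f) g"
    unfolding left_deriv_coordinates(3)[OF sl(2)] left_deriv_coordinates(2)[OF sl(3)] u
    by (simp add: algebra_simps add_divide_distrib diff_divide_distrib power2_eq_square)
  show "left_deriv exp_T (left_deriv exp_Z f) g = left_deriv exp_Z (left_deriv exp_T f) g"
    unfolding left_deriv_coordinates(4)[OF sl(3)] left_deriv_coordinates(3)[OF sl(4)] u ..
qed

lemma left_deriv_inner_left:
  assumes "one_parameter \<gamma>" "smooth f"
  shows "left_deriv \<gamma> (\<lambda>g. f g \<bullet> b) = (\<lambda>g. left_deriv \<gamma> f g \<bullet> b)"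
  by (rule ext, rule left_deriv_bounded_linear[OF bounded_linear_inner_left assms])

lemma commutators:
  fixes f :: "osc \<Rightarrow> 'b::euclidean_space"
  assumes f: "smooth f"
  shows "left_deriv exp_T (left_deriv exp_X f) g = left_deriv exp_X (left_deriv exp_T f) g + left_deriv exp_Y f g"
    and "left_deriv exp_T (left_deriv exp_Y f) g = left_deriv exp_Y (left_deriv exp_T f) g - left_deriv exp_X f g"
    and "left_deriv exp_X (left_deriv exp_Y f) g = left_deriv exp_Y (left_deriv exp_X f) g + left_deriv exp_Z f g"
    and "left_deriv exp_Z (left_deriv exp_X f) g = left_deriv exp_X (left_deriv exp_Z f) g"
    and "left_deriv exp_Z (left_deriv exp_Y f) g = left_deriv exp_Y (left_deriv exp_Z f) g"
    and "left_deriv exp_T (left_deriv exp_Z f) g = left_deriv exp_Z (left_deriv exp_T f) g"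
  by (rule euclidean_eqI,
      insert commutators_real[OF smooth_inner[OF f smooth_const]],
      simp add: left_deriv_inner_left one_parameter_exp f smooth_left_deriv inner_add_left inner_diff_left)+

lemma casimir_op_coordinates:
  fixes f :: "osc \<Rightarrow> 'b::euclidean_space"
  assumes f: "smooth f"
  shows "casimir_op f g = D1 (D1 f) g + D2 (D2 f) g + Re (fst g) *\<^sub>R D2 (D3 f) g - Im (fst g) *\<^sub>R D1 (D3 f) g
    + (((Re (fst g))\<^sup>2 + (Im (fst g))\<^sup>2) / 4) *\<^sub>R D3 (D3 f) g + 2 *\<^sub>R D3 (D4 f) g"
proof (rule euclidean_eqI)
  fix b :: 'b
  have "casimir_op f g \<bullet> b = casimir_op (\<lambda>g. f g \<bullet> b) g"
    by (simp add: casimir_op_def left_deriv_inner_left one_parameter_exp f smooth_left_deriv inner_add_left)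
  also have "\<dots> = (D1 (D1 f) g + D2 (D2 f) g + Re (fst g) *\<^sub>R D2 (D3 f) g - Im (fst g) *\<^sub>R D1 (D3 f) g
    + (((Re (fst g))\<^sup>2 + (Im (fst g))\<^sup>2) / 4) *\<^sub>R D3 (D3 f) g + 2 *\<^sub>R D3 (D4 f) g) \<bullet> b"
    unfolding casimir_op_coordinates_real(1)[OF smooth_inner[OF f smooth_const]]
    by (simp add: dir_deriv_inner_left f smooth_dir_deriv inner_add_left inner_diff_left)
  finally show "casimir_op f g \<bullet> b = (D1 (D1 f) g + D2 (D2 f) g + Re (fst g) *\<^sub>R D2 (D3 f) g - Im (fst g) *\<^sub>R D1 (D3 f) g
    + (((Re (fst g))\<^sup>2 + (Im (fst g))\<^sup>2) / 4) *\<^sub>R D3 (D3 f) g + 2 *\<^sub>R D3 (D4 f) g) \<bullet> b" .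
qed

text \<open>The Casimir operator is bi-invariant: the left- and the right-invariant expressions have the same
  coordinate expression.\<close>

lemma right_casimir_eq: "smooth f \<Longrightarrow> right_casimir_op f g = casimir_op f (g :: osc)" for f :: "osc \<Rightarrow> real"
  by (simp add: casimir_op_coordinates_real)

lemma smooth_casimir_op [smooth_intros]: "smooth f \<Longrightarrow> smooth (casimir_op f)"
  unfolding casimir_op_def[abs_def] by (intro smooth_intros one_parameter_exp)

lemma casimir_op_translate: "casimir_op (\<lambda>h. f (l \<cdot> h)) g = casimir_op f (l \<cdot> g)"
  by (simp add: casimir_op_def left_deriv_translate[abs_def])

text \<open>Inversion exchanges left- and right-invariant fields up to a sign, and the signs cancel in an operator of second order.
  This moves \<open>\<Omega>\<close> from one argument of a convolution kernel to the other.\<close>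

lemma casimir_op_inverse:
  fixes f :: "osc \<Rightarrow> real"
  assumes f: "smooth f"
  shows "casimir_op (\<lambda>h. f (osc_inv h \<cdot> g)) h = casimir_op f (osc_inv h \<cdot> g)"
proof -
  have neg: "right_deriv \<gamma> (\<lambda>x. - k x) = (\<lambda>x. - right_deriv \<gamma> k x)" if "one_parameter \<gamma>" "smooth k"
    for \<gamma> and k :: "osc \<Rightarrow> real"
  proof
    fix x
    have "smooth (\<lambda>s. k (\<gamma> s \<cdot> x))"
      by (rule smooth_compose[OF that(2)]) (intro smooth_osc_mult smooth_const one_parameter_smooth that)
    from has_vector_derivative_minus[OF smooth_has_vector_derivative[OF this]]
    show "right_deriv \<gamma> (\<lambda>x. - k x) x = - right_deriv \<gamma> k x"
      by (simp add: right_deriv_def vector_derivative_at)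
  qed
  have 2: "left_deriv \<delta> (left_deriv \<gamma> (\<lambda>h. f (osc_inv h \<cdot> g))) h = right_deriv \<delta> (right_deriv \<gamma> f) (osc_inv h \<cdot> g)"
    if "one_parameter \<gamma>" "one_parameter \<delta>" "smooth (right_deriv \<gamma> f)" for \<gamma> \<delta>
  proof -
    have "left_deriv \<delta> (left_deriv \<gamma> (\<lambda>h. f (osc_inv h \<cdot> g))) h = left_deriv \<delta> (\<lambda>h. - right_deriv \<gamma> f (osc_inv h \<cdot> g)) h"
      using left_deriv_inverse[OF that(1) f] by presburger
    also have "\<dots> = right_deriv \<delta> (right_deriv \<gamma> f) (osc_inv h \<cdot> g)"
      using left_deriv_inverse[OF that(2) smooth_uminus[OF that(3)], of g h] neg[OF that(2,3)] by simp
    finally show ?thesis .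
  qed
  show ?thesis
    unfolding right_casimir_eq[OF f, symmetric]
    by (simp add: casimir_op_def right_casimir_op_def 2 one_parameter_exp smooth_right_deriv f)
qed

lemma casimir_op_local:
  assumes "open U" "g \<in> U" and eq: "\<And>h. h \<in> U \<Longrightarrow> f h = f' h"
  shows "casimir_op f g = casimir_op f' g"
proof -
  have 1: "left_deriv \<gamma> f h = left_deriv \<gamma> f' h" if "h \<in> U" "one_parameter \<gamma>" for \<gamma> h
    using left_deriv_local[OF assms(1) that(1) eq that(2)] .
  have "left_deriv \<delta> (left_deriv \<gamma> f) g = left_deriv \<delta> (left_deriv \<gamma> f') g"
    if "one_parameter \<gamma>" "one_parameter \<delta>" for \<gamma> \<delta>
    by (rule left_deriv_local[OF assms(1,2) 1 that(2)]) (use that in auto)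
  then show ?thesis by (simp add: casimir_op_def one_parameter_exp)
qed

lemma casimir_op_bounded_linear:
  assumes B: "bounded_linear B" and f: "smooth f"
  shows "casimir_op (\<lambda>g. B (f g)) g = B (casimir_op f g)"
proof -
  have "left_deriv \<gamma> (\<lambda>g. B (k g)) = (\<lambda>g. B (left_deriv \<gamma> k g))" if "one_parameter \<gamma>" "smooth k" for \<gamma> k
    using left_deriv_bounded_linear[OF B that] by blast
  then show ?thesis using B
    by (simp add: casimir_op_def one_parameter_exp smooth_left_deriv f bounded_linear.linear linear_add linear_cmul)
qed

subsection \<open>The square of the cubic Dirac operator\<close>

lemma bounded_linear_matrix_vector: "bounded_linear (\<lambda>v. (M :: complex ^ 4 ^ 4) *v v)"
  by (rule matrix_vector_mul_bounded_linear)

lemma half_vector_scalar: "(1/2) *s (v :: spinor) = (1/2) *\<^sub>R v"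
  by (simp add: vec_eq_iff scaleR_conv_of_real[where 'a=complex])

lemma dirac_eq:
  "dirac \<psi> g = cliff_X *v left_deriv exp_X \<psi> g + cliff_Y *v left_deriv exp_Y \<psi> g +
    cliff_Z *v left_deriv exp_T \<psi> g + cliff_T *v left_deriv exp_Z \<psi> g +
    (1/2) *\<^sub>R ((cliff_X ** cliff_Y ** cliff_Z) *v \<psi> g)"
  unfolding dirac_def lie_deriv_eq half_vector_scalar ..

lemma smooth_matrix_vector: "smooth \<psi> \<Longrightarrow> smooth (\<lambda>g. (M :: complex ^ 4 ^ 4) *v \<psi> g)"
  by (rule smooth_bounded_linear[OF bounded_linear_matrix_vector])

lemma smooth_dirac [smooth_intros]: "smooth \<psi> \<Longrightarrow> smooth (dirac \<psi>)"
  unfolding dirac_eq[abs_def]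
  by (intro smooth_add smooth_scaleR smooth_const smooth_matrix_vector smooth_left_deriv one_parameter_exp)

lemma left_deriv_dirac:
  assumes \<gamma>: "one_parameter \<gamma>" and \<psi>: "smooth \<psi>"
  shows "left_deriv \<gamma> (dirac \<psi>) g = cliff_X *v left_deriv \<gamma> (left_deriv exp_X \<psi>) g +
    cliff_Y *v left_deriv \<gamma> (left_deriv exp_Y \<psi>) g +
    cliff_Z *v left_deriv \<gamma> (left_deriv exp_T \<psi>) g + cliff_T *v left_deriv \<gamma> (left_deriv exp_Z \<psi>) g +
    (1/2) *\<^sub>R ((cliff_X ** cliff_Y ** cliff_Z) *v left_deriv \<gamma> \<psi> g)"
proof -
  have M: "left_deriv \<gamma> (\<lambda>g. (M :: complex ^ 4 ^ 4) *v f g) g = M *v left_deriv \<gamma> f g" if "smooth f" for M f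
    by (rule left_deriv_bounded_linear[OF bounded_linear_matrix_vector \<gamma> that])
  have S: "left_deriv \<gamma> (\<lambda>g. (1/2) *\<^sub>R f g) g = (1/2) *\<^sub>R left_deriv \<gamma> f g" if "smooth f" for f :: "osc \<Rightarrow> spinor"
    by (rule left_deriv_bounded_linear[OF bounded_linear_scaleR_right \<gamma> that])
  note sm = smooth_matrix_vector smooth_left_deriv one_parameter_exp \<psi> smooth_add
    smooth_scaleR[OF smooth_const]
  show ?thesis
    unfolding dirac_eq[abs_def]
    by (simp only: left_deriv_add[OF \<gamma>] M S sm)
qed

text \<open>The second order terms give \<open>- \<Omega>\<close> by the Clifford relations. The commutators leave first order terms, and these are cancelled
  by the anticommutators with the cubic term \<open>1/2 XYZ\<close>, whose square is zero.\<close>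

lemma dirac_square:
  assumes \<psi>: "smooth \<psi>"
  shows "dirac (dirac \<psi>) g = - casimir_op \<psi> g"
proof -
  have sq: "complex_of_real (sqrt 2) * complex_of_real (sqrt 2) = 2"
    "complex_of_real (sqrt 2) * (complex_of_real (sqrt 2) * w) = 2 * w" for w
    by (simp_all flip: of_real_mult mult.assoc)
  show ?thesis
    unfolding dirac_eq[of "dirac \<psi>"] left_deriv_dirac[OF one_parameter_exp(1) \<psi>]
      left_deriv_dirac[OF one_parameter_exp(2) \<psi>] left_deriv_dirac[OF one_parameter_exp(3) \<psi>]
      left_deriv_dirac[OF one_parameter_exp(4) \<psi>] casimir_op_def
      commutators[OF \<psi>] dirac_eq[of \<psi>]
    by (simp add: vec_eq_iff forall_4 matrix_matrix_mult_def matrix_vector_mult_def sum_4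
      cliff_X_def cliff_Y_def cliff_Z_def cliff_T_def scaleR_conv_of_real[where 'a=complex])
      (simp add: algebra_simps sq add_divide_distrib diff_divide_distrib)
qed

section \<open>Lebesgue measure on the group and on the quotient\<close>

lemma nn_integral_shift:
  fixes f :: "'a::euclidean_space \<Rightarrow> ennreal"
  assumes "f \<in> borel_measurable borel"
  shows "(\<integral>\<^sup>+x. f (c + x) \<partial>lborel) = (\<integral>\<^sup>+x. f x \<partial>lborel)"
proof -
  have "(\<integral>\<^sup>+x. f x \<partial>distr lborel borel ((+) c)) = (\<integral>\<^sup>+x. f (c + x) \<partial>lborel)"
    by (rule nn_integral_distr) (use assms in measurable)
  then show ?thesis by (simp add: lborel_distr_plus)
qed

lemma nn_integral_lborel_fst:
  fixes f :: "'a::euclidean_space \<times> 'b::euclidean_space \<Rightarrow> ennreal"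
  assumes "f \<in> borel_measurable borel"
  shows "(\<integral>\<^sup>+x. f x \<partial>lborel) = (\<integral>\<^sup>+x. \<integral>\<^sup>+y. f (x, y) \<partial>lborel \<partial>lborel)"
  using lborel.nn_integral_fst[of f lborel] assms by (simp add: lborel_prod)

lemma nn_integral_osc:
  fixes f :: "osc \<Rightarrow> ennreal"
  assumes [measurable]: "f \<in> borel_measurable borel"
  shows "(\<integral>\<^sup>+g. f g \<partial>lborel) = (\<integral>\<^sup>+\<xi>. \<integral>\<^sup>+z. \<integral>\<^sup>+t. f (\<xi>, z, t) \<partial>lborel \<partial>lborel \<partial>lborel)"
  by (subst nn_integral_lborel_fst, measurable)
     (rule nn_integral_cong, rule nn_integral_lborel_fst, measurable)

lemma measurable_osc_mult [measurable]:
  assumes "f \<in> borel_measurable M" "h \<in> borel_measurable M"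
  shows "(\<lambda>x. f x \<cdot> h x) \<in> borel_measurable M"
proof -
  have "(\<lambda>p. fst p \<cdot> snd p) \<in> borel_measurable borel"
    by (intro borel_measurable_continuous_onI continuous_intros)
  from measurable_compose[OF borel_measurable_Pair[OF assms] this] show ?thesis by simp
qed

lemma osc_mult_left_measure_preserving:
  assumes l: "cis (snd (snd l)) = 1"
  shows "distr lborel borel (\<lambda>g. l \<cdot> g) = (lborel :: osc measure)"
proof (rule measure_eqI)
  obtain a b c where abc: "l = (a, b, c)" by (cases l)
  have c: "cis c = 1" using l abc by simp
  have cont: "continuous_on UNIV (\<lambda>g. l \<cdot> g)" by (intro continuous_intros)
  then have m [measurable]: "(\<lambda>g. l \<cdot> g) \<in> borel_measurable borel" by (rule borel_measurable_continuous_onI)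
  fix A assume "A \<in> sets (distr lborel borel (\<lambda>g. l \<cdot> g))"
  then have [measurable]: "A \<in> sets borel" by simp
  define f :: "osc \<Rightarrow> ennreal" where "f = indicator A"
  have [measurable]: "f \<in> borel_measurable borel" by (simp add: f_def)
  have "emeasure (distr lborel borel (\<lambda>g. l \<cdot> g)) A = (\<integral>\<^sup>+g. f (l \<cdot> g) \<partial>lborel)"
    by (simp add: f_def nn_integral_distr flip: nn_integral_indicator)
  also have "\<dots> = (\<integral>\<^sup>+\<xi>. \<integral>\<^sup>+z. \<integral>\<^sup>+t. f (a + \<xi>, (b + omega a \<xi> / 2) + z, c + t) \<partial>lborel \<partial>lborel \<partial>lborel)"
    by (subst nn_integral_osc, measurable) (simp add: abc c ac_simps)
  also have "\<dots> = (\<integral>\<^sup>+\<xi>. \<integral>\<^sup>+z. \<integral>\<^sup>+t. f (a + \<xi>, (b + omega a \<xi> / 2) + z, t) \<partial>lborel \<partial>lborel \<partial>lborel)"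
    by (rule nn_integral_cong, rule nn_integral_cong, rule nn_integral_shift) measurable
  also have "\<dots> = (\<integral>\<^sup>+\<xi>. \<integral>\<^sup>+z. \<integral>\<^sup>+t. f (a + \<xi>, z, t) \<partial>lborel \<partial>lborel \<partial>lborel)"
    by (rule nn_integral_cong, rule nn_integral_shift) measurable
  also have "\<dots> = (\<integral>\<^sup>+\<xi>. \<integral>\<^sup>+z. \<integral>\<^sup>+t. f (\<xi>, z, t) \<partial>lborel \<partial>lborel \<partial>lborel)"
    by (rule nn_integral_shift) measurable
  also have "\<dots> = (\<integral>\<^sup>+g. f g \<partial>lborel)" by (rule nn_integral_osc[symmetric]) measurable
  finally show "emeasure (distr lborel borel (\<lambda>g. l \<cdot> g)) A = emeasure lborel A"
    by (simp add: f_def)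
qed simp

text \<open>Integrate over \<open>z\<close> first, then over \<open>\<xi>\<close>, then over \<open>t\<close>: each variable is shifted by an amount that depends only on
  those integrated later.\<close>

lemma osc_mult_right_measure_preserving: "distr lborel borel (\<lambda>g. g \<cdot> h) = (lborel :: osc measure)"
proof (rule measure_eqI)
  obtain a b c where abc: "h = (a, b, c)" by (cases h)
  have cont: "continuous_on UNIV (\<lambda>g. g \<cdot> h)" by (intro continuous_intros)
  then have m [measurable]: "(\<lambda>g. g \<cdot> h) \<in> borel_measurable borel" by (rule borel_measurable_continuous_onI)
  fix A assume "A \<in> sets (distr lborel borel (\<lambda>g. g \<cdot> h))"
  then have [measurable]: "A \<in> sets borel" by simp
  define f :: "osc \<Rightarrow> ennreal" where "f = indicator A"
  have [measurable]: "f \<in> borel_measurable borel" by (simp add: f_def)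
  have swap: "(\<integral>\<^sup>+\<xi>. \<integral>\<^sup>+z. \<integral>\<^sup>+t. k (\<xi>, z, t) \<partial>lborel \<partial>lborel \<partial>lborel)
      = (\<integral>\<^sup>+t. \<integral>\<^sup>+\<xi>. \<integral>\<^sup>+z. k (\<xi>, z, t) \<partial>lborel \<partial>lborel \<partial>lborel)"
    if [measurable]: "k \<in> borel_measurable borel" for k :: "osc \<Rightarrow> ennreal"
  proof -
    have "(\<integral>\<^sup>+z. \<integral>\<^sup>+t. k (\<xi>, z, t) \<partial>lborel \<partial>lborel) = (\<integral>\<^sup>+t. \<integral>\<^sup>+z. k (\<xi>, z, t) \<partial>lborel \<partial>lborel)" for \<xi>
      by (rule lborel_pair.Fubini'[symmetric]) measurable
    then have "(\<integral>\<^sup>+\<xi>. \<integral>\<^sup>+z. \<integral>\<^sup>+t. k (\<xi>, z, t) \<partial>lborel \<partial>lborel \<partial>lborel)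
      = (\<integral>\<^sup>+\<xi>. \<integral>\<^sup>+t. \<integral>\<^sup>+z. k (\<xi>, z, t) \<partial>lborel \<partial>lborel \<partial>lborel)" by simp
    also have "\<dots> = (\<integral>\<^sup>+t. \<integral>\<^sup>+\<xi>. \<integral>\<^sup>+z. k (\<xi>, z, t) \<partial>lborel \<partial>lborel \<partial>lborel)"
      by (rule lborel_pair.Fubini'[symmetric]) measurable
    finally show ?thesis .
  qed
  have cis_m [measurable]: "cis \<in> borel_measurable borel"
    by (rule borel_measurable_continuous_onI[OF smooth_continuous_on[OF smooth_cis[OF smooth_id]]])
  have "emeasure (distr lborel borel (\<lambda>g. g \<cdot> h)) A = (\<integral>\<^sup>+g. f (g \<cdot> h) \<partial>lborel)"
    by (simp add: f_def nn_integral_distr flip: nn_integral_indicator)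
  also have "\<dots> = (\<integral>\<^sup>+t. \<integral>\<^sup>+\<xi>. \<integral>\<^sup>+z. f ((\<xi>, z, t) \<cdot> h) \<partial>lborel \<partial>lborel \<partial>lborel)"
    by (subst nn_integral_osc, measurable) (rule swap, measurable)
  also have "\<dots> = (\<integral>\<^sup>+t. \<integral>\<^sup>+\<xi>. \<integral>\<^sup>+z. f (cis t * a + \<xi>, (b + omega \<xi> (cis t * a) / 2) + z, c + t) \<partial>lborel \<partial>lborel \<partial>lborel)"
    by (simp add: abc algebra_simps)
  also have "\<dots> = (\<integral>\<^sup>+t. \<integral>\<^sup>+\<xi>. \<integral>\<^sup>+z. f (cis t * a + \<xi>, z, c + t) \<partial>lborel \<partial>lborel \<partial>lborel)"
    by (rule nn_integral_cong, rule nn_integral_cong, rule nn_integral_shift) measurable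
  also have "\<dots> = (\<integral>\<^sup>+t. \<integral>\<^sup>+\<xi>. \<integral>\<^sup>+z. f (\<xi>, z, c + t) \<partial>lborel \<partial>lborel \<partial>lborel)"
    by (rule nn_integral_cong, rule nn_integral_shift) measurable
  also have "\<dots> = (\<integral>\<^sup>+t. \<integral>\<^sup>+\<xi>. \<integral>\<^sup>+z. f (\<xi>, z, t) \<partial>lborel \<partial>lborel \<partial>lborel)"
    by (rule nn_integral_shift) measurable
  also have "\<dots> = (\<integral>\<^sup>+g. f g \<partial>lborel)"
    by (simp add: nn_integral_osc swap)
  finally show "emeasure (distr lborel borel (\<lambda>g. g \<cdot> h)) A = emeasure lborel A"
    by (simp add: f_def)
qed simp

lemma nn_integral_osc_mult_left:
  fixes f :: "osc \<Rightarrow> ennreal"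
  assumes "cis (snd (snd l)) = 1" and [measurable]: "f \<in> borel_measurable borel"
  shows "(\<integral>\<^sup>+g. f (l \<cdot> g) \<partial>lborel) = (\<integral>\<^sup>+g. f g \<partial>lborel)"
proof -
  have m: "(\<lambda>g. l \<cdot> g) \<in> measurable lborel borel"
    by measurable
  have "(\<integral>\<^sup>+g. f (l \<cdot> g) \<partial>lborel) = (\<integral>\<^sup>+g. f g \<partial>distr lborel borel (\<lambda>g. l \<cdot> g))"
    by (rule nn_integral_distr[symmetric]) (use m in measurable)
  then show ?thesis using osc_mult_left_measure_preserving[OF assms(1)] by simp
qed

lemma nn_integral_osc_mult_right:
  fixes f :: "osc \<Rightarrow> ennreal"
  assumes [measurable]: "f \<in> borel_measurable borel"
  shows "(\<integral>\<^sup>+g. f (g \<cdot> h) \<partial>lborel) = (\<integral>\<^sup>+g. f g \<partial>lborel)"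
proof -
  have m: "(\<lambda>g. g \<cdot> h) \<in> measurable lborel borel"
    by measurable
  have "(\<integral>\<^sup>+g. f (g \<cdot> h) \<partial>lborel) = (\<integral>\<^sup>+g. f g \<partial>distr lborel borel (\<lambda>g. g \<cdot> h))"
    by (rule nn_integral_distr[symmetric]) (use m in measurable)
  then show ?thesis using osc_mult_right_measure_preserving by simp
qed

lemma integral_osc_mult_left:
  fixes f :: "osc \<Rightarrow> 'b::{banach, second_countable_topology}"
  assumes "cis (snd (snd l)) = 1" and [measurable]: "f \<in> borel_measurable borel"
  shows "(\<integral>g. f (l \<cdot> g) \<partial>lborel) = (\<integral>g. f g \<partial>lborel)"
proof -
  have "(\<integral>g. f (l \<cdot> g) \<partial>lborel) = (\<integral>g. f g \<partial>distr lborel borel (\<lambda>g. l \<cdot> g))"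
    by (rule integral_distr[symmetric]) measurable
  then show ?thesis using osc_mult_left_measure_preserving[OF assms(1)] by simp
qed

subsection \<open>Lattices and fundamental domains\<close>

lemma carrier_Osc [simp]: "carrier Osc = UNIV" by (simp add: Osc_def)

text \<open>The sign \<open>s\<close> is \<open>(-1)\<^sup>\<epsilon>\<close> for a spin structure \<open>\<epsilon>\<close>. The condition on \<open>cis\<close>, which holds for basic lattices, says that
  left translations by \<open>L\<close> do not rotate the coordinate \<open>\<xi>\<close>.\<close>

locale osc_lattice =
  fixes L :: "osc set" and s :: "osc \<Rightarrow> real"
  assumes lattice: "group_lattice Osc L"
    and cis_lattice: "l \<in> L \<Longrightarrow> cis (snd (snd l)) = 1"
    and s_mult: "k \<in> L \<Longrightarrow> l \<in> L \<Longrightarrow> s (k \<cdot> l) = s k * s l"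
    and s_sign: "l \<in> L \<Longrightarrow> s l = 1 \<or> s l = - 1"
begin

lemma one_L: "osc_one \<in> L" and mult_L: "k \<in> L \<Longrightarrow> l \<in> L \<Longrightarrow> k \<cdot> l \<in> L"
  and inv_L: "l \<in> L \<Longrightarrow> osc_inv l \<in> L"
proof -
  have sub: "subgroup L Osc" using lattice by (simp add: group_lattice_def)
  show "osc_one \<in> L" using subgroup.one_closed[OF sub] by (simp add: Osc_def)
  show "k \<in> L \<Longrightarrow> l \<in> L \<Longrightarrow> k \<cdot> l \<in> L" using subgroup.m_closed[OF sub] by simp
  assume l: "l \<in> L"
  have "inv\<^bsub>Osc\<^esub> l = osc_inv l"
    by (rule group.inv_equality[OF group_Osc]) (simp_all add: Osc_def)
  then show "osc_inv l \<in> L" using subgroup.m_inv_closed[OF sub l] by simp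
qed

lemma s_one: "s osc_one = 1"
  using s_mult[OF one_L one_L] s_sign[OF one_L] by auto

lemma s_inv: "l \<in> L \<Longrightarrow> s (osc_inv l) = s l"
  using s_mult[OF inv_L, of l l] s_sign[of l] s_sign[OF inv_L, of l] s_one by auto

lemma s_square [simp]: "l \<in> L \<Longrightarrow> s l * s l = 1"
  using s_sign by fastforce

lemma isolated_one: obtains U where "open U" "U \<inter> L = {osc_one}"
  using lattice one_L unfolding group_lattice_def discrete_def isolated_in_def by metis

lemma locally_separated:
  obtains V where "open V" "p \<in> V" "\<And>x y. x \<in> V \<Longrightarrow> y \<in> V \<Longrightarrow> x \<in> L \<Longrightarrow> y \<in> L \<Longrightarrow> x = y"
proof -
  obtain U where U: "open U" "U \<inter> L = {osc_one}" by (rule isolated_one)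
  have "open ((\<lambda>q. osc_inv (fst q) \<cdot> snd q) -` U)"
    by (rule open_vimage[OF U(1)]) (intro continuous_intros)
  moreover have "(p, p) \<in> (\<lambda>q. osc_inv (fst q) \<cdot> snd q) -` U" using U(2) by auto
  ultimately obtain A B where AB: "open A" "open B" "(p, p) \<in> A \<times> B" "A \<times> B \<subseteq> (\<lambda>q. osc_inv (fst q) \<cdot> snd q) -` U"
    by (rule open_prod_elim)
  have "x = y" if "x \<in> A \<inter> B" "y \<in> A \<inter> B" "x \<in> L" "y \<in> L" for x y
  proof -
    have "osc_inv x \<cdot> y \<in> U \<inter> L" using that AB(4) by (auto intro: mult_L inv_L)
    then have "osc_inv x \<cdot> y = osc_one" using U(2) by auto
    then have "x \<cdot> (osc_inv x \<cdot> y) = x" by simp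
    then show ?thesis by (simp only: osc_inv_right')
  qed
  with AB(1-3) show ?thesis by (intro that[of "A \<inter> B"]) auto
qed

lemma finite_L_compact:
  assumes "compact C" shows "finite (L \<inter> C)"
proof -
  have "\<exists>V. open V \<and> p \<in> V \<and> (\<forall>x\<in>V \<inter> L. \<forall>y\<in>V \<inter> L. x = y)" for p
    by (rule locally_separated[of p]) (metis IntE)
  then obtain V where V: "open (V p)" "p \<in> V p" "\<forall>x\<in>V p \<inter> L. \<forall>y\<in>V p \<inter> L. x = y" for p
    by metis
  have "C \<subseteq> (\<Union>p\<in>C. V p)" using V(2) by auto
  from compactE_image[OF \<open>compact C\<close> V(1) this]
  obtain P where P: "finite P" "C \<subseteq> (\<Union>p\<in>P. V p)" by metis
  have "finite (L \<inter> V p)" for p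
  proof (cases "L \<inter> V p = {}")
    case False
    then obtain x where "x \<in> L \<inter> V p" by blast
    then have "L \<inter> V p \<subseteq> {x}" using V(3) by blast
    then show ?thesis using finite_subset by blast
  qed simp
  then have "finite (\<Union>p\<in>P. L \<inter> V p)" using P(1) by blast
  then show ?thesis by (rule rev_finite_subset) (use P(2) in blast)
qed

lemma countable_L: "countable L"
proof -
  have "l \<in> (\<Union>n. L \<inter> cball 0 (real n))" if "l \<in> L" for l
  proof -
    obtain n where "norm l \<le> real n" using real_arch_simple by blast
    then have "l \<in> L \<inter> cball 0 (real n)" using that by (simp only: Int_iff mem_cball_0 simp_thms)
    then show ?thesis by blast
  qed
  then have "L = (\<Union>n. L \<inter> cball 0 (real n))" by blast
  moreover have "countable (\<Union>n. L \<inter> cball 0 (real n))"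
    by (rule countable_UN) (simp_all add: countable_finite finite_L_compact)
  ultimately show ?thesis by simp
qed

lemma separating_neighbourhood:
  obtains V where "open V" "osc_one \<in> V" "\<And>l x y. l \<in> L \<Longrightarrow> x \<in> V \<Longrightarrow> y \<in> V \<Longrightarrow> l \<cdot> x = y \<Longrightarrow> l = osc_one"
proof -
  obtain U where U: "open U" "U \<inter> L = {osc_one}" by (rule isolated_one)
  have "open ((\<lambda>q. snd q \<cdot> osc_inv (fst q)) -` U)"
    by (rule open_vimage[OF U(1)]) (intro continuous_intros)
  moreover have "(osc_one, osc_one) \<in> (\<lambda>q. snd q \<cdot> osc_inv (fst q)) -` U" using U(2) by auto
  ultimately obtain A B where AB: "open A" "open B" "(osc_one, osc_one) \<in> A \<times> B"
      "A \<times> B \<subseteq> (\<lambda>q. snd q \<cdot> osc_inv (fst q)) -` U"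
    by (rule open_prod_elim)
  have "l = osc_one" if "l \<in> L" "x \<in> A \<inter> B" "y \<in> A \<inter> B" "l \<cdot> x = y" for l x y
  proof -
    have "y \<cdot> osc_inv x \<in> U" using that AB(4) by auto
    moreover have "y \<cdot> osc_inv x = l" unfolding that(4)[symmetric] by (simp add: osc_assoc)
    ultimately show ?thesis using U(2) that(1) by auto
  qed
  with AB(1-3) show ?thesis by (intro that[of "A \<inter> B"]) auto
qed

text \<open>Countably many right translates of a neighbourhood that meets no other \<open>L\<close>-translate of itself cover
  the group. Each orbit is represented in the first of them that it meets.\<close>

lemma fundamental_domain_exists: "\<exists>F. fundamental_domain Osc L F"
proof -
  obtain V where V: "open V" "osc_one \<in> V"
    and sep: "\<And>l x y. l \<in> L \<Longrightarrow> x \<in> V \<Longrightarrow> y \<in> V \<Longrightarrow> l \<cdot> x = y \<Longrightarrow> l = osc_one"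
    using separating_neighbourhood by blast
  define W where "W g = {h. h \<cdot> osc_inv g \<in> V}" for g
  have W_open: "open (W g)" for g
  proof -
    have "W g = (\<lambda>h. h \<cdot> osc_inv g) -` V" by (auto simp: W_def)
    moreover have "open ((\<lambda>h. h \<cdot> osc_inv g) -` V)"
      by (rule open_vimage[OF V(1)]) (intro continuous_intros)
    ultimately show ?thesis by simp
  qed
  have W_self: "g \<in> W g" for g using V(2) by (simp add: W_def)
  have W_sep: "l = k" if "l \<in> L" "k \<in> L" "l \<cdot> h \<in> W g" "k \<cdot> h \<in> W g" for l k h g
  proof -
    have "(l \<cdot> osc_inv k) \<cdot> ((k \<cdot> h) \<cdot> osc_inv g) = (l \<cdot> h) \<cdot> osc_inv g" by (simp add: osc_assoc)
    then have "l \<cdot> osc_inv k = osc_one"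
      using sep[of "l \<cdot> osc_inv k"] that by (simp add: W_def mult_L inv_L)
    then have "(l \<cdot> osc_inv k) \<cdot> k = k" by simp
    then show ?thesis by (simp add: osc_assoc)
  qed
  obtain \<F> where \<F>: "\<F> \<subseteq> range W" "countable \<F>" "\<Union>\<F> = \<Union>(range W)"
    using Lindelof[of "range W"] W_open by blast
  have UN: "\<Union>\<F> = UNIV" using \<F>(3) W_self by blast
  then have "\<F> \<noteq> {}" by auto
  define w where "w = from_nat_into \<F>"
  have w: "range w = \<F>" unfolding w_def by (rule range_from_nat_into[OF \<open>\<F> \<noteq> {}\<close> \<F>(2)])
  have w_W: "\<exists>g. w n = W g" for n using w \<F>(1) by blast
  have w_open: "open (w n)" for n using w_W[of n] W_open by auto
  define N where "N j = (\<Union>l\<in>L. {g. l \<cdot> g \<in> w j})" for j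
  have N_open: "open (N j)" for j
  proof -
    have "open ((\<lambda>g. l \<cdot> g) -` w j)" for l
      by (rule open_vimage[OF w_open]) (intro continuous_intros)
    then show ?thesis unfolding N_def vimage_def by blast
  qed
  define F where "F = (\<Union>i. w i - (\<Union>j<i. N j))"
  have "F \<in> sets borel" unfolding F_def using w_open N_open by (intro sets.countable_UN) auto
  moreover have "\<exists>!l. l \<in> L \<and> l \<cdot> g \<in> F" for g
  proof -
    have "\<exists>i. g \<in> N i"
    proof -
      obtain i where "g \<in> w i" using UN w by blast
      then show ?thesis using one_L unfolding N_def by (auto intro!: exI[of _ i] bexI[of _ osc_one])
    qed
    define i where "i = (LEAST i. g \<in> N i)"
    have i: "g \<in> N i" unfolding i_def using \<open>\<exists>i. g \<in> N i\<close> by (rule LeastI_ex)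
    have less: "g \<notin> N j" if "j < i" for j using not_less_Least that i_def by blast
    have N_inv: "l \<cdot> g \<in> N j \<longleftrightarrow> g \<in> N j" if "l \<in> L" for l j
    proof
      assume "l \<cdot> g \<in> N j"
      then obtain k where "k \<in> L" "k \<cdot> (l \<cdot> g) \<in> w j" by (auto simp: N_def)
      then have "k \<cdot> l \<in> L" "(k \<cdot> l) \<cdot> g \<in> w j" by (simp_all add: mult_L that osc_assoc)
      then show "g \<in> N j" unfolding N_def by blast
    next
      assume "g \<in> N j"
      then obtain k where "k \<in> L" "k \<cdot> g \<in> w j" by (auto simp: N_def)
      then have "k \<cdot> osc_inv l \<in> L" "(k \<cdot> osc_inv l) \<cdot> (l \<cdot> g) \<in> w j"
        by (simp_all add: mult_L inv_L that osc_assoc)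
      then show "l \<cdot> g \<in> N j" unfolding N_def by blast
    qed
    have F_iff: "l \<cdot> g \<in> F \<longleftrightarrow> l \<cdot> g \<in> w i" if "l \<in> L" for l
    proof
      assume "l \<cdot> g \<in> F"
      then obtain j where j: "l \<cdot> g \<in> w j" "\<And>m. m < j \<Longrightarrow> l \<cdot> g \<notin> N m" by (auto simp: F_def)
      have "g \<in> N j" using j(1) that by (auto simp: N_def)
      then have "\<not> j < i" using less by blast
      moreover have "\<not> i < j" using j(2) i N_inv[OF that] by blast
      ultimately show "l \<cdot> g \<in> w i" using j(1) by (metis linorder_neqE_nat)
    next
      assume "l \<cdot> g \<in> w i"
      then show "l \<cdot> g \<in> F" unfolding F_def using less N_inv[OF that] by blast
    qed
    obtain l where "l \<in> L" "l \<cdot> g \<in> w i" using i unfolding N_def by blast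
    obtain c where c: "w i = W c" using w_W by blast
    show ?thesis
    proof (rule ex1I[of _ l])
      show "l \<in> L \<and> l \<cdot> g \<in> F" using \<open>l \<in> L\<close> \<open>l \<cdot> g \<in> w i\<close> F_iff by blast
      fix k assume "k \<in> L \<and> k \<cdot> g \<in> F"
      then show "k = l"
        using W_sep[of k l g c] \<open>l \<in> L\<close> \<open>l \<cdot> g \<in> w i\<close> F_iff[of k] unfolding c by blast
    qed
  qed
  ultimately have "fundamental_domain Osc L F" by (auto simp: fundamental_domain_def Osc_def)
  then show ?thesis ..
qed

definition fund_dom :: "osc set" where "fund_dom = (SOME F. fundamental_domain Osc L F)"

lemma fund_dom_borel [measurable]: "fund_dom \<in> sets borel" and fund_dom_ex1: "\<exists>!l. l \<in> L \<and> l \<cdot> g \<in> fund_dom"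
proof -
  have "fundamental_domain Osc L fund_dom"
    unfolding fund_dom_def by (rule someI_ex[OF fundamental_domain_exists])
  then show "fund_dom \<in> sets borel" "\<exists>!l. l \<in> L \<and> l \<cdot> g \<in> fund_dom"
    unfolding fundamental_domain_def carrier_Osc mult_Osc by blast+
qed

text \<open>The images of the balls around the origin are open in the quotient and increase to the whole quotient, which is compact.\<close>

lemma compact_representatives: obtains K where "compact K" "\<And>g. \<exists>l\<in>L. l \<cdot> g \<in> K"
proof -
  have coset: "L #>\<^bsub>Osc\<^esub> g = {l \<cdot> g |l. l \<in> L}" for g by (auto simp: r_coset_def)
  have mem: "g \<in> L #>\<^bsub>Osc\<^esub> g" for g unfolding coset using one_L by force
  have eq: "L #>\<^bsub>Osc\<^esub> (l \<cdot> g) = L #>\<^bsub>Osc\<^esub> g" if "l \<in> L" for l g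
  proof -
    have "\<exists>m. k \<cdot> (l \<cdot> g) = m \<cdot> g \<and> m \<in> L" if "k \<in> L" for k
      using mult_L[OF that \<open>l \<in> L\<close>] by (intro exI[of _ "k \<cdot> l"]) (simp add: osc_assoc)
    moreover have "\<exists>m. k \<cdot> g = m \<cdot> (l \<cdot> g) \<and> m \<in> L" if "k \<in> L" for k
      using mult_L[OF that inv_L[OF \<open>l \<in> L\<close>]] by (intro exI[of _ "k \<cdot> osc_inv l"]) (simp add: osc_assoc)
    ultimately show ?thesis unfolding coset by blast
  qed
  define U where "U n = (\<lambda>g. L #>\<^bsub>Osc\<^esub> g) ` ball 0 (real n)" for n
  have cosets: "rcosets\<^bsub>Osc\<^esub> L = range (\<lambda>g. L #>\<^bsub>Osc\<^esub> g)" by (auto simp: RCOSETS_def Osc_def)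
  have U_iff: "L #>\<^bsub>Osc\<^esub> g \<in> U n \<longleftrightarrow> (\<exists>l\<in>L. l \<cdot> g \<in> ball 0 (real n))" for g n
  proof
    assume "L #>\<^bsub>Osc\<^esub> g \<in> U n"
    then obtain h where h: "h \<in> ball 0 (real n)" "L #>\<^bsub>Osc\<^esub> g = L #>\<^bsub>Osc\<^esub> h" by (auto simp: U_def)
    then have "h \<in> L #>\<^bsub>Osc\<^esub> g" using mem[of h] by simp
    then show "\<exists>l\<in>L. l \<cdot> g \<in> ball 0 (real n)" using h(1) unfolding coset by auto
  next
    assume "\<exists>l\<in>L. l \<cdot> g \<in> ball 0 (real n)"
    then obtain l where "l \<in> L" "l \<cdot> g \<in> ball 0 (real n)" by blast
    then show "L #>\<^bsub>Osc\<^esub> g \<in> U n" unfolding U_def using eq[of l g] by (metis image_eqI)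
  qed
  have U_open: "openin (quotient_top Osc L) (U n)" for n
  proof -
    have "open ((\<lambda>g. l \<cdot> g) -` ball 0 (real n))" for l
      by (rule open_vimage[OF open_ball]) (intro continuous_intros)
    then have "open (\<Union>l\<in>L. (\<lambda>g. l \<cdot> g) -` ball 0 (real n))" by blast
    moreover have "{g. L #>\<^bsub>Osc\<^esub> g \<in> U n} = (\<Union>l\<in>L. (\<lambda>g. l \<cdot> g) -` ball 0 (real n))"
      unfolding U_iff vimage_def by blast
    moreover have "U n \<subseteq> rcosets\<^bsub>Osc\<^esub> L" unfolding cosets U_def by auto
    ultimately show ?thesis unfolding openin_quotient_top by simp
  qed
  have top: "topspace (quotient_top Osc L) \<subseteq> \<Union>(range U)"
  proof
    fix c assume "c \<in> topspace (quotient_top Osc L)"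
    then have "c \<in> rcosets\<^bsub>Osc\<^esub> L" unfolding topspace_def openin_quotient_top by blast
    then obtain g where g: "c = L #>\<^bsub>Osc\<^esub> g" unfolding cosets by blast
    obtain n where "norm g < real n" using reals_Archimedean2 by blast
    then have "c \<in> U n" unfolding U_def g by auto
    then show "c \<in> \<Union>(range U)" by blast
  qed
  have "compact_space (quotient_top Osc L)" using lattice by (simp add: group_lattice_def)
  then have "\<forall>\<U>. (\<forall>U\<in>\<U>. openin (quotient_top Osc L) U) \<and> topspace (quotient_top Osc L) \<subseteq> \<Union>\<U> \<longrightarrow>
      (\<exists>\<F>. finite \<F> \<and> \<F> \<subseteq> \<U> \<and> topspace (quotient_top Osc L) \<subseteq> \<Union>\<F>)"
    unfolding compact_space_def compactin_def by simp
  from spec[OF this, of "range U"] obtain \<F>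
    where \<F>: "finite \<F>" "\<F> \<subseteq> range U" "topspace (quotient_top Osc L) \<subseteq> \<Union>\<F>"
    using top U_open by blast
  obtain J where J: "finite J" "\<F> = U ` J" using finite_subset_image[OF \<F>(1,2)] by blast
  define N where "N = Max (insert 0 J)"
  have "\<exists>l\<in>L. l \<cdot> g \<in> cball 0 (real N)" for g
  proof -
    obtain n where n: "norm g < real n" using reals_Archimedean2 by blast
    then have "L #>\<^bsub>Osc\<^esub> g \<in> U n" unfolding U_def by auto
    then have "L #>\<^bsub>Osc\<^esub> g \<in> topspace (quotient_top Osc L)"
      using openin_subset[OF U_open[of n]] by blast
    then obtain j where j: "j \<in> J" "L #>\<^bsub>Osc\<^esub> g \<in> U j" using \<F>(3) J(2) by blast
    then obtain l where "l \<in> L" "l \<cdot> g \<in> ball 0 (real j)" using U_iff by blast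
    moreover have "j \<le> N" unfolding N_def using J(1) j(1) by simp
    ultimately show ?thesis by (force intro!: bexI[of _ l])
  qed
  then show ?thesis by (rule that[OF compact_cball])
qed

subsection \<open>Unfolding\<close>

abbreviation M :: "osc measure" where "M \<equiv> quotient_measure Osc L"

lemma M_eq: "M = restrict_space lborel fund_dom"
  by (simp add: quotient_measure_def fund_dom_def)

lemma nn_integral_M: "nn_integral M f = (\<integral>\<^sup>+g. f g * indicator fund_dom g \<partial>lborel)"
  unfolding M_eq by (rule nn_integral_restrict_space) simp

lemma measurable_M: "f \<in> borel_measurable borel \<Longrightarrow> f \<in> borel_measurable M"
  unfolding M_eq by (rule measurable_restrict_space1) simp

lemma count_fundamental:
  assumes "\<And>g. \<exists>!l. l \<in> L \<and> l \<cdot> g \<in> F'"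
  shows "(\<integral>\<^sup>+l. indicator F' (osc_inv l \<cdot> g) \<partial>count_space L) = 1"
    and "(\<integral>\<^sup>+l. indicator F' (l \<cdot> g) \<partial>count_space L) = 1"
proof -
  obtain k where k: "k \<in> L" "k \<cdot> g \<in> F'" "\<And>l. l \<in> L \<Longrightarrow> l \<cdot> g \<in> F' \<Longrightarrow> l = k"
    using assms[of g] unfolding Ex1_def by blast
  have "(\<integral>\<^sup>+l. indicator F' (l \<cdot> g) \<partial>count_space L) = (\<Sum>l\<in>{k}. indicator F' (l \<cdot> g))"
  proof (rule nn_integral_count_space')
    fix l assume "l \<in> L" "l \<notin> {k}"
    then have "l \<cdot> g \<notin> F'" using k(3) by blast
    then show "indicator F' (l \<cdot> g) = (0::ennreal)" by simp
  qed (simp_all add: k(1))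
  then show "(\<integral>\<^sup>+l. indicator F' (l \<cdot> g) \<partial>count_space L) = 1" using k(2) by simp
  have "(\<integral>\<^sup>+l. indicator F' (osc_inv l \<cdot> g) \<partial>count_space L) = (\<Sum>l\<in>{osc_inv k}. indicator F' (osc_inv l \<cdot> g))"
  proof (rule nn_integral_count_space')
    fix l assume l: "l \<in> L" "l \<notin> {osc_inv k}"
    then have "osc_inv l \<noteq> k" by auto
    then have "osc_inv l \<cdot> g \<notin> F'" using k(3)[OF inv_L[OF l(1)]] by blast
    then show "indicator F' (osc_inv l \<cdot> g) = (0::ennreal)" by simp
  qed (simp_all add: k(1) inv_L)
  then show "(\<integral>\<^sup>+l. indicator F' (osc_inv l \<cdot> g) \<partial>count_space L) = 1" using k(2) by simp
qed

text \<open>Insert \<open>1 = \<Sum>\<^sub>l 1\<^sub>F(l\<^sup>-\<^sup>1 g)\<close>, with \<open>F\<close> the fundamental domain, and translate each summand back into \<open>F\<close>.\<close>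

lemma unfolding_nn:
  fixes f :: "osc \<Rightarrow> ennreal"
  assumes [measurable]: "f \<in> borel_measurable borel"
  shows "(\<integral>\<^sup>+g. f g \<partial>lborel) = (\<integral>\<^sup>+g. (\<integral>\<^sup>+l. f (l \<cdot> g) \<partial>count_space L) \<partial>M)"
proof -
  have "(\<integral>\<^sup>+g. f g \<partial>lborel) = (\<integral>\<^sup>+g. f g * (\<integral>\<^sup>+l. indicator fund_dom (osc_inv l \<cdot> g) \<partial>count_space L) \<partial>lborel)"
    by (simp add: count_fundamental[OF fund_dom_ex1])
  also have "\<dots> = (\<integral>\<^sup>+g. (\<integral>\<^sup>+l. f g * indicator fund_dom (osc_inv l \<cdot> g) \<partial>count_space L) \<partial>lborel)"
    by (simp add: nn_integral_cmult)
  also have "\<dots> = (\<integral>\<^sup>+l. (\<integral>\<^sup>+g. f g * indicator fund_dom (osc_inv l \<cdot> g) \<partial>lborel) \<partial>count_space L)"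
    by (rule nn_integral_count_space_nn_integral[OF countable_L]) measurable
  also have "\<dots> = (\<integral>\<^sup>+l. (\<integral>\<^sup>+g. f (l \<cdot> g) * indicator fund_dom g \<partial>lborel) \<partial>count_space L)"
  proof (rule nn_integral_cong)
    fix l assume "l \<in> space (count_space L)"
    then have l: "cis (snd (snd l)) = 1" by (simp add: cis_lattice)
    show "(\<integral>\<^sup>+g. f g * indicator fund_dom (osc_inv l \<cdot> g) \<partial>lborel) = (\<integral>\<^sup>+g. f (l \<cdot> g) * indicator fund_dom g \<partial>lborel)"
      using nn_integral_osc_mult_left[OF l, of "\<lambda>g. f g * indicator fund_dom (osc_inv l \<cdot> g)"] by simp
  qed
  also have "\<dots> = (\<integral>\<^sup>+g. (\<integral>\<^sup>+l. f (l \<cdot> g) * indicator fund_dom g \<partial>count_space L) \<partial>lborel)"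
    by (rule nn_integral_count_space_nn_integral[OF countable_L, symmetric]) measurable
  also have "\<dots> = (\<integral>\<^sup>+g. (\<integral>\<^sup>+l. f (l \<cdot> g) \<partial>count_space L) \<partial>M)"
    unfolding nn_integral_M by (simp add: nn_integral_multc)
  finally show ?thesis .
qed

lemma emeasure_fund_dom_finite: "emeasure lborel fund_dom < \<infinity>"
proof -
  obtain K where K: "compact K" "\<And>g. \<exists>l\<in>L. l \<cdot> g \<in> K" using compact_representatives by blast
  have [measurable]: "K \<in> sets borel" using K(1) by (simp add: borel_compact)
  have "emeasure lborel fund_dom = (\<integral>\<^sup>+g. 1 \<partial>M)" unfolding nn_integral_M by simp
  also have "\<dots> \<le> (\<integral>\<^sup>+g. (\<integral>\<^sup>+l. indicator K (l \<cdot> g) \<partial>count_space L) \<partial>M)"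
  proof (rule nn_integral_mono)
    fix g
    obtain l where l: "l \<in> L" "l \<cdot> g \<in> K" using K(2) by blast
    then have "(1::ennreal) = (\<integral>\<^sup>+k. indicator {l} k \<partial>count_space L)"
      by (simp add: nn_integral_indicator)
    also have "\<dots> \<le> (\<integral>\<^sup>+l. indicator K (l \<cdot> g) \<partial>count_space L)"
      by (rule nn_integral_mono) (use l in \<open>auto split: split_indicator\<close>)
    finally show "1 \<le> (\<integral>\<^sup>+l. indicator K (l \<cdot> g) \<partial>count_space L)" .
  qed
  also have "\<dots> = (\<integral>\<^sup>+g. indicator K g \<partial>lborel)" by (rule unfolding_nn[symmetric]) simp
  also have "\<dots> = emeasure lborel K" by simp
  also have "\<dots> < \<infinity>" using K(1) by (intro emeasure_bounded_finite compact_imp_bounded)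
  finally show ?thesis .
qed

lemma finite_measure_M: "finite_measure M"
proof
  show "emeasure M (space M) \<noteq> \<infinity>"
    using emeasure_fund_dom_finite unfolding M_eq by (simp add: emeasure_restrict_space space_restrict_space)
qed

text \<open>Right translation takes a fundamental domain to another one, and unfolding shows that both give the same integral of an
  invariant function.\<close>

lemma nn_integral_invariant_right:
  fixes u :: "osc \<Rightarrow> ennreal"
  assumes [measurable]: "u \<in> borel_measurable borel" and inv: "\<And>l g. l \<in> L \<Longrightarrow> u (l \<cdot> g) = u g"
  shows "(\<integral>\<^sup>+g. u (g \<cdot> a) \<partial>M) = (\<integral>\<^sup>+g. u g \<partial>M)"
proof -
  let ?F = "{g. g \<cdot> osc_inv a \<in> fund_dom}"
  have "\<exists>!l. l \<in> L \<and> l \<cdot> g \<in> ?F" for g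
    using fund_dom_ex1[of "g \<cdot> osc_inv a"] by (simp add: osc_assoc)
  note count = count_fundamental(2)[OF this]
  have ind: "indicator ?F g = (indicator fund_dom (g \<cdot> osc_inv a) :: ennreal)" for g by (simp split: split_indicator)
  have [measurable]: "?F \<in> sets borel" by measurable
  have "(\<integral>\<^sup>+g. u (g \<cdot> a) \<partial>M) = (\<integral>\<^sup>+g. u (g \<cdot> a) * indicator ?F (g \<cdot> a) \<partial>lborel)"
    unfolding nn_integral_M ind by (simp add: osc_assoc)
  also have "\<dots> = (\<integral>\<^sup>+g. u g * indicator ?F g \<partial>lborel)"
    by (rule nn_integral_osc_mult_right[of "\<lambda>g. u g * indicator ?F g"]) measurable
  also have "\<dots> = (\<integral>\<^sup>+g. (\<integral>\<^sup>+l. u (l \<cdot> g) * indicator ?F (l \<cdot> g) \<partial>count_space L) \<partial>M)"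
    by (rule unfolding_nn) measurable
  also have "\<dots> = (\<integral>\<^sup>+g. (\<integral>\<^sup>+l. u g * indicator ?F (l \<cdot> g) \<partial>count_space L) \<partial>M)"
    by (intro nn_integral_cong) (simp add: inv)
  also have "\<dots> = (\<integral>\<^sup>+g. u g \<partial>M)"
    by (simp add: nn_integral_cmult count)
  finally show ?thesis .
qed

lemma integral_invariant_right:
  fixes u :: "osc \<Rightarrow> real"
  assumes [measurable]: "u \<in> borel_measurable borel" and inv: "\<And>l g. l \<in> L \<Longrightarrow> u (l \<cdot> g) = u g"
    and int: "integrable M u"
  shows "integrable M (\<lambda>g. u (g \<cdot> a))" "(\<integral>g. u (g \<cdot> a) \<partial>M) = (\<integral>g. u g \<partial>M)"
proof -
  have nn: "(\<integral>\<^sup>+g. ennreal (v (u (g \<cdot> a))) \<partial>M) = (\<integral>\<^sup>+g. ennreal (v (u g)) \<partial>M)"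
    if [measurable]: "v \<in> borel_measurable borel" for v
    by (rule nn_integral_invariant_right[of "\<lambda>g. ennreal (v (u g))"]) (simp_all add: inv)
  have "(\<lambda>g. u (g \<cdot> a)) \<in> borel_measurable M" by (intro measurable_M) measurable
  then show int': "integrable M (\<lambda>g. u (g \<cdot> a))"
    using int nn[of "\<lambda>x. norm x"] by (simp add: integrable_iff_bounded)
  show "(\<integral>g. u (g \<cdot> a) \<partial>M) = (\<integral>g. u g \<partial>M)"
    unfolding real_lebesgue_integral_def[OF int] real_lebesgue_integral_def[OF int']
    using nn[of "\<lambda>x. x"] nn[of "\<lambda>x. - x"] by simp
qed

end

section \<open>The Hilbert space of sections\<close>

lemma quadratic_nonneg:
  fixes a b c :: real
  assumes "\<And>t. 0 \<le> a + 2 * t * b + t\<^sup>2 * c" "c \<ge> 0"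
  shows "b\<^sup>2 \<le> a * c"
proof (cases "c = 0")
  case True
  have "b = 0"
  proof (rule ccontr)
    assume "b \<noteq> 0"
    then show False using assms(1)[of "- (a + 1) / (2 * b)"] True by (simp add: field_simps)
  qed
  then show ?thesis using True by simp
next
  case False
  have "0 \<le> (a + 2 * (- b / c) * b + (- b / c)\<^sup>2 * c) * c"
    using assms by (intro mult_nonneg_nonneg) blast+
  also have "\<dots> = a * c - b\<^sup>2" using False by (simp add: field_simps power2_eq_square)
  finally show ?thesis by simp
qed

lemma bounded_linear_vector_scalar: "bounded_linear (\<lambda>v :: spinor. c *s v)"
proof -
  have "linear (\<lambda>v :: spinor. c *s v)"
    by (rule linearI) (simp_all add: vec_eq_iff distrib_left)
  then show ?thesis by (simp add: linear_conv_bounded_linear)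
qed

lemma norm_vector_scalar: "norm (c *s (v :: spinor)) = norm c * norm v"
  by (simp add: norm_vec_def L2_set_def norm_mult power_mult_distrib real_sqrt_mult flip: sum_distrib_left)

context osc_lattice
begin

text \<open>Values in any real vector space are admitted, because the wave packets are scalar.\<close>

definition equi :: "(osc \<Rightarrow> 'b::real_vector) \<Rightarrow> bool"
  where "equi f \<longleftrightarrow> (\<forall>l\<in>L. \<forall>g. f (l \<cdot> g) = s l *\<^sub>R f g)"

lemma equiD: "equi f \<Longrightarrow> l \<in> L \<Longrightarrow> f (l \<cdot> g) = s l *\<^sub>R f g"
  unfolding equi_def by blast

lemma s_abs [simp]: "l \<in> L \<Longrightarrow> \<bar>s l\<bar> = 1"
  using s_sign by fastforce

lemma equi_norm: "equi f \<Longrightarrow> l \<in> L \<Longrightarrow> norm (f (l \<cdot> g)) = norm (f g)" for f :: "osc \<Rightarrow> 'b::real_normed_vector"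
  by (simp add: equiD)

lemma equi_inner: "equi f \<Longrightarrow> equi h \<Longrightarrow> l \<in> L \<Longrightarrow> f (l \<cdot> g) \<bullet> h (l \<cdot> g) = f g \<bullet> h g" for f :: "osc \<Rightarrow> 'b::real_inner"
  using s_sign[of l] by (auto simp: equiD)

lemma equi_zero: "equi (\<lambda>g. 0)"
  and equi_add: "equi f \<Longrightarrow> equi h \<Longrightarrow> equi (\<lambda>g. f g + h g)"
  and equi_diff: "equi f \<Longrightarrow> equi h \<Longrightarrow> equi (\<lambda>g. f g - h g)"
  by (simp_all add: equi_def scaleR_add_right scaleR_diff_right)

lemma equi_linear: "linear B \<Longrightarrow> equi f \<Longrightarrow> equi (\<lambda>g. B (f g))"
  by (simp add: equi_def linear_cmul)

lemma equi_left_deriv: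
  assumes "one_parameter \<gamma>" "smooth f" "equi f" shows "equi (left_deriv \<gamma> f)"
  unfolding equi_def
proof (intro ballI allI)
  fix l g assume "l \<in> L"
  then have eq: "(\<lambda>h. f (l \<cdot> h)) = (\<lambda>h. s l *\<^sub>R f h)" using equiD[OF assms(3)] by blast
  have "left_deriv \<gamma> f (l \<cdot> g) = left_deriv \<gamma> (\<lambda>h. s l *\<^sub>R f h) g"
    using left_deriv_translate[of \<gamma> f l g] eq by simp
  then show "left_deriv \<gamma> f (l \<cdot> g) = s l *\<^sub>R left_deriv \<gamma> f g"
    using left_deriv_bounded_linear[OF bounded_linear_scaleR_right assms(1,2), of "s l" g] by simp
qed

lemma bounded_continuous_equi:
  fixes u :: "osc \<Rightarrow> 'b::real_normed_vector"
  assumes cont: "continuous_on UNIV u" and inv: "\<And>l g. l \<in> L \<Longrightarrow> norm (u (l \<cdot> g)) = norm (u g)"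
  obtains B where "B \<ge> 0" "\<And>g. norm (u g) \<le> B"
proof -
  obtain K where K: "compact K" "\<And>g. \<exists>l\<in>L. l \<cdot> g \<in> K" using compact_representatives by blast
  have "compact (u ` K)" using K(1) cont by (metis compact_continuous_image continuous_on_subset subset_UNIV)
  then obtain B where B: "\<And>x. x \<in> K \<Longrightarrow> norm (u x) \<le> B"
    using compact_imp_bounded bounded_iff by (metis imageI)
  have "norm (u g) \<le> max B 0" for g
  proof -
    obtain l where "l \<in> L" "l \<cdot> g \<in> K" using K(2) by blast
    then show ?thesis using B[of "l \<cdot> g"] inv[of l g] by simp
  qed
  then show ?thesis by (intro that[of "max B 0"]) simp_all
qed

lemma integrable_M_bounded:
  fixes u :: "osc \<Rightarrow> 'b::{banach, second_countable_topology}"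
  assumes "u \<in> borel_measurable borel" "\<And>g. norm (u g) \<le> B"
  shows "integrable M u"
  by (rule finite_measure.integrable_const_bound[OF finite_measure_M, of _ B])
     (use assms measurable_M in auto)

lemma integrable_M_continuous:
  fixes u :: "osc \<Rightarrow> 'b::{banach, second_countable_topology}"
  assumes cont: "continuous_on UNIV u" and inv: "\<And>l g. l \<in> L \<Longrightarrow> norm (u (l \<cdot> g)) = norm (u g)"
  shows "integrable M u"
proof -
  obtain B where "\<And>g. norm (u g) \<le> B" using bounded_continuous_equi[OF assms] by blast
  then show ?thesis using integrable_M_bounded borel_measurable_continuous_onI[OF cont] by blast
qed

definition L2 :: "(osc \<Rightarrow> spinor) set"
  where "L2 = {\<psi> \<in> borel_measurable borel. equi \<psi> \<and> integrable M (\<lambda>g. (norm (\<psi> g))\<^sup>2)}"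

definition sections :: "(osc \<Rightarrow> spinor) set"
  where "sections = {\<psi>. smooth \<psi> \<and> equi \<psi>}"

text \<open>The real part of the Hermitian product. A subspace that is closed under complex multiples has the same orthogonal complement
  for both products.\<close>

definition ip :: "(osc \<Rightarrow> spinor) \<Rightarrow> (osc \<Rightarrow> spinor) \<Rightarrow> real"
  where "ip \<psi> \<phi> = (\<integral>g. \<psi> g \<bullet> \<phi> g \<partial>M)"

lemma L2D: assumes "\<psi> \<in> L2"
  shows "\<psi> \<in> borel_measurable borel" "\<psi> \<in> borel_measurable M" "equi \<psi>" "integrable M (\<lambda>g. (norm (\<psi> g))\<^sup>2)"
  using assms by (auto simp: L2_def measurable_M)

lemma sections_L2: assumes "\<psi> \<in> sections" shows "\<psi> \<in> L2"
proof -
  have \<psi>: "smooth \<psi>" "equi \<psi>" using assms by (simp_all add: sections_def)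
  have "integrable M (\<lambda>g. (norm (\<psi> g))\<^sup>2)"
    by (rule integrable_M_continuous) (simp_all add: equi_norm \<psi> continuous_intros smooth_continuous_on)
  then show ?thesis by (simp add: L2_def \<psi> smooth_borel_measurable)
qed

lemma integrable_inner:
  assumes "\<psi> \<in> L2" "\<phi> \<in> L2" shows "integrable M (\<lambda>g. \<psi> g \<bullet> \<phi> g)"
proof (rule Bochner_Integration.integrable_bound)
  show "integrable M (\<lambda>g. (norm (\<psi> g))\<^sup>2 + (norm (\<phi> g))\<^sup>2)"
    by (rule Bochner_Integration.integrable_add[OF L2D(4)[OF assms(1)] L2D(4)[OF assms(2)]])
  show "(\<lambda>g. \<psi> g \<bullet> \<phi> g) \<in> borel_measurable M" by (intro borel_measurable_inner L2D assms)
  show "AE g in M. norm (\<psi> g \<bullet> \<phi> g) \<le> norm ((norm (\<psi> g))\<^sup>2 + (norm (\<phi> g))\<^sup>2)"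
  proof (rule AE_I2)
    fix g
    have "\<bar>\<psi> g \<bullet> \<phi> g\<bar> \<le> norm (\<psi> g) * norm (\<phi> g)" by (rule Cauchy_Schwarz_ineq2)
    also have "\<dots> \<le> (norm (\<psi> g))\<^sup>2 + (norm (\<phi> g))\<^sup>2"
      using sum_squares_bound[of "norm (\<psi> g)" "norm (\<phi> g)"]
        mult_nonneg_nonneg[OF norm_ge_zero[of "\<psi> g"] norm_ge_zero[of "\<phi> g"]] by linarith
    finally show "norm (\<psi> g \<bullet> \<phi> g) \<le> norm ((norm (\<psi> g))\<^sup>2 + (norm (\<phi> g))\<^sup>2)" by simp
  qed
qed

lemma L2_add: assumes "\<psi> \<in> L2" "\<phi> \<in> L2" shows "(\<lambda>g. \<psi> g + \<phi> g) \<in> L2"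
proof -
  have "integrable M (\<lambda>g. (norm (\<psi> g))\<^sup>2 + 2 * (\<psi> g \<bullet> \<phi> g) + (norm (\<phi> g))\<^sup>2)"
    by (intro Bochner_Integration.integrable_add integrable_mult_right L2D integrable_inner assms)
  moreover have "(norm (\<psi> g + \<phi> g))\<^sup>2 = (norm (\<psi> g))\<^sup>2 + 2 * (\<psi> g \<bullet> \<phi> g) + (norm (\<phi> g))\<^sup>2" for g
    by (simp add: power2_norm_eq_inner inner_add_left inner_add_right inner_commute)
  ultimately show ?thesis using L2D[OF assms(1)] L2D[OF assms(2)] by (simp add: L2_def equi_add)
qed

lemma L2_bounded_linear:
  assumes B: "bounded_linear B" and \<psi>: "\<psi> \<in> L2" shows "(\<lambda>g. B (\<psi> g)) \<in> L2"
proof -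
  obtain c where c: "\<And>x. norm (B x) \<le> norm x * c" using bounded_linear.bounded[OF B] by blast
  have m: "(\<lambda>g. B (\<psi> g)) \<in> borel_measurable borel"
    using measurable_compose[OF L2D(1)[OF \<psi>] borel_measurable_continuous_onI[OF linear_continuous_on[OF B]]] .
  have "integrable M (\<lambda>g. (norm (B (\<psi> g)))\<^sup>2)"
  proof (rule Bochner_Integration.integrable_bound)
    show "integrable M (\<lambda>g. c\<^sup>2 * (norm (\<psi> g))\<^sup>2)" by (intro integrable_mult_right L2D \<psi>)
    show "(\<lambda>g. (norm (B (\<psi> g)))\<^sup>2) \<in> borel_measurable M"
      using measurable_M[OF m] by measurable
    show "AE g in M. norm ((norm (B (\<psi> g)))\<^sup>2) \<le> norm (c\<^sup>2 * (norm (\<psi> g))\<^sup>2)"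
    proof (rule AE_I2)
      fix g
      have "(norm (B (\<psi> g)))\<^sup>2 \<le> (norm (\<psi> g) * c)\<^sup>2" by (rule power_mono[OF c]) simp
      then show "norm ((norm (B (\<psi> g)))\<^sup>2) \<le> norm (c\<^sup>2 * (norm (\<psi> g))\<^sup>2)"
        by (simp add: power_mult_distrib mult.commute)
    qed
  qed
  then show ?thesis using m equi_linear[OF bounded_linear.linear[OF B] L2D(3)[OF \<psi>]] by (simp add: L2_def)
qed

lemma L2_scaleR: "\<psi> \<in> L2 \<Longrightarrow> (\<lambda>g. c *\<^sub>R \<psi> g) \<in> L2"
  by (rule L2_bounded_linear[OF bounded_linear_scaleR_right])

lemma L2_vector_scalar: "\<psi> \<in> L2 \<Longrightarrow> (\<lambda>g. c *s \<psi> g) \<in> L2"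
  by (rule L2_bounded_linear[OF bounded_linear_vector_scalar])

lemma L2_diff: "\<psi> \<in> L2 \<Longrightarrow> \<phi> \<in> L2 \<Longrightarrow> (\<lambda>g. \<psi> g - \<phi> g) \<in> L2"
  using L2_add[OF _ L2_scaleR[of \<phi> "- 1"], of \<psi>] by simp

lemma ip_commute: "ip \<psi> \<phi> = ip \<phi> \<psi>" by (simp add: ip_def inner_commute)

lemma ip_add: "\<psi> \<in> L2 \<Longrightarrow> \<phi> \<in> L2 \<Longrightarrow> \<theta> \<in> L2 \<Longrightarrow> ip (\<lambda>g. \<psi> g + \<phi> g) \<theta> = ip \<psi> \<theta> + ip \<phi> \<theta>"
  unfolding ip_def inner_add_left by (rule Bochner_Integration.integral_add) (rule integrable_inner; assumption)+

lemma ip_diff: "\<psi> \<in> L2 \<Longrightarrow> \<phi> \<in> L2 \<Longrightarrow> \<theta> \<in> L2 \<Longrightarrow> ip (\<lambda>g. \<psi> g - \<phi> g) \<theta> = ip \<psi> \<theta> - ip \<phi> \<theta>"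
  unfolding ip_def inner_diff_left by (rule Bochner_Integration.integral_diff) (rule integrable_inner; assumption)+

lemma ip_scaleR: "ip (\<lambda>g. c *\<^sub>R \<psi> g) \<theta> = c * ip \<psi> \<theta>"
  by (simp add: ip_def)

lemma ip_add_right: "\<psi> \<in> L2 \<Longrightarrow> \<phi> \<in> L2 \<Longrightarrow> \<theta> \<in> L2 \<Longrightarrow> ip \<theta> (\<lambda>g. \<psi> g + \<phi> g) = ip \<theta> \<psi> + ip \<theta> \<phi>"
  and ip_diff_right: "\<psi> \<in> L2 \<Longrightarrow> \<phi> \<in> L2 \<Longrightarrow> \<theta> \<in> L2 \<Longrightarrow> ip \<theta> (\<lambda>g. \<psi> g - \<phi> g) = ip \<theta> \<psi> - ip \<theta> \<phi>"
  and ip_scaleR_right: "ip \<theta> (\<lambda>g. c *\<^sub>R \<psi> g) = c * ip \<theta> \<psi>"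
  by (simp_all add: ip_commute[of \<theta>] ip_add ip_diff ip_scaleR)

lemma ip_nonneg: "ip \<psi> \<psi> \<ge> 0"
  by (simp add: ip_def)

lemma l2_norm_eq: "l2_norm L \<psi> = sqrt (ip \<psi> \<psi>)"
  by (simp add: l2_norm_def ip_def power2_norm_eq_inner)

lemma l2_norm_square: "(l2_norm L \<psi>)\<^sup>2 = ip \<psi> \<psi>"
  by (simp add: l2_norm_eq ip_nonneg)

lemma l2_norm_nonneg: "l2_norm L \<psi> \<ge> 0"
  by (simp add: l2_norm_eq ip_nonneg)

lemma ip_square_add:
  assumes "\<psi> \<in> L2" "\<phi> \<in> L2"
  shows "ip (\<lambda>g. \<psi> g + t *\<^sub>R \<phi> g) (\<lambda>g. \<psi> g + t *\<^sub>R \<phi> g) = ip \<psi> \<psi> + 2 * t * ip \<psi> \<phi> + t\<^sup>2 * ip \<phi> \<phi>"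
  using assms by (simp add: ip_add ip_add_right ip_scaleR ip_scaleR_right L2_add L2_scaleR ip_commute[of \<phi> \<psi>]
      power2_eq_square algebra_simps)

lemma ip_Cauchy_Schwarz:
  assumes "\<psi> \<in> L2" "\<phi> \<in> L2" shows "\<bar>ip \<psi> \<phi>\<bar> \<le> l2_norm L \<psi> * l2_norm L \<phi>"
proof -
  have "(ip \<psi> \<phi>)\<^sup>2 \<le> ip \<psi> \<psi> * ip \<phi> \<phi>"
  proof (rule quadratic_nonneg)
    show "0 \<le> ip \<psi> \<psi> + 2 * t * ip \<psi> \<phi> + t\<^sup>2 * ip \<phi> \<phi>" for t
      unfolding ip_square_add[OF assms, symmetric] by (rule ip_nonneg)
  qed (rule ip_nonneg)
  then have "(ip \<psi> \<phi>)\<^sup>2 \<le> (l2_norm L \<psi> * l2_norm L \<phi>)\<^sup>2"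
    by (simp add: power_mult_distrib l2_norm_square)
  then show ?thesis
    unfolding abs_le_square_iff[symmetric] by (simp add: l2_norm_nonneg)
qed

lemma l2_norm_triangle:
  assumes "\<psi> \<in> L2" "\<phi> \<in> L2" shows "l2_norm L (\<lambda>g. \<psi> g + \<phi> g) \<le> l2_norm L \<psi> + l2_norm L \<phi>"
proof (rule power2_le_imp_le)
  have "(l2_norm L (\<lambda>g. \<psi> g + \<phi> g))\<^sup>2 = (l2_norm L \<psi>)\<^sup>2 + 2 * ip \<psi> \<phi> + (l2_norm L \<phi>)\<^sup>2"
    using ip_square_add[OF assms, of 1] by (simp add: l2_norm_square)
  also have "\<dots> \<le> (l2_norm L \<psi>)\<^sup>2 + 2 * (l2_norm L \<psi> * l2_norm L \<phi>) + (l2_norm L \<phi>)\<^sup>2"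
    using ip_Cauchy_Schwarz[OF assms] by simp
  finally show "(l2_norm L (\<lambda>g. \<psi> g + \<phi> g))\<^sup>2 \<le> (l2_norm L \<psi> + l2_norm L \<phi>)\<^sup>2"
    by (simp add: power2_sum)
  show "0 \<le> l2_norm L \<psi> + l2_norm L \<phi>" by (simp add: l2_norm_nonneg)
qed

lemma l2_norm_scaleR: "l2_norm L (\<lambda>g. c *\<^sub>R \<psi> g) = \<bar>c\<bar> * l2_norm L \<psi>"
proof -
  have "ip (\<lambda>g. c *\<^sub>R \<psi> g) (\<lambda>g. c *\<^sub>R \<psi> g) = c\<^sup>2 * ip \<psi> \<psi>"
    by (simp only: ip_scaleR ip_scaleR_right power2_eq_square mult.assoc)
  then show ?thesis by (simp add: l2_norm_eq real_sqrt_mult)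
qed

lemma l2_norm_minus_commute: "l2_norm L (\<lambda>g. \<psi> g - \<phi> g) = l2_norm L (\<lambda>g. \<phi> g - \<psi> g)"
  by (simp add: l2_norm_def norm_minus_commute)

lemma l2_norm_vector_scalar: "l2_norm L (\<lambda>g. c *s \<psi> g) = norm c * l2_norm L \<psi>"
  by (simp add: l2_norm_def norm_vector_scalar power_mult_distrib real_sqrt_mult)

lemma ip_tendsto:
  assumes "\<And>n. f n \<in> L2" "\<psi> \<in> L2" "\<theta> \<in> L2" and lim: "(\<lambda>n. l2_norm L (\<lambda>g. f n g - \<psi> g)) \<longlonglongrightarrow> 0"
  shows "(\<lambda>n. ip \<theta> (f n)) \<longlonglongrightarrow> ip \<theta> \<psi>"
proof -
  have "(\<lambda>n. l2_norm L \<theta> * l2_norm L (\<lambda>g. f n g - \<psi> g)) \<longlonglongrightarrow> l2_norm L \<theta> * 0"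
    by (intro tendsto_intros lim)
  then have "(\<lambda>n. l2_norm L \<theta> * l2_norm L (\<lambda>g. f n g - \<psi> g)) \<longlonglongrightarrow> 0" by simp
  moreover have "\<forall>\<^sub>F n in sequentially. norm (ip \<theta> (f n) - ip \<theta> \<psi>) \<le> l2_norm L \<theta> * l2_norm L (\<lambda>g. f n g - \<psi> g)"
  proof (rule eventuallyI)
    fix n
    have "ip \<theta> (f n) - ip \<theta> \<psi> = ip \<theta> (\<lambda>g. f n g - \<psi> g)" using assms by (simp add: ip_diff_right)
    then show "norm (ip \<theta> (f n) - ip \<theta> \<psi>) \<le> l2_norm L \<theta> * l2_norm L (\<lambda>g. f n g - \<psi> g)"
      using ip_Cauchy_Schwarz[OF assms(3) L2_diff[OF assms(1)[of n] assms(2)]] by simp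
  qed
  ultimately have "(\<lambda>n. ip \<theta> (f n) - ip \<theta> \<psi>) \<longlonglongrightarrow> 0" by (rule Lim_null_comparison[rotated])
  then show ?thesis by (simp add: LIM_zero_iff)
qed

subsection \<open>Integration by parts\<close>

text \<open>The difference quotients of \<open>u\<close> along \<open>\<gamma>\<close> have integral zero, because right translations preserve the integral. By the mean
  value theorem they are bounded, so the limit can be taken under the integral.\<close>

lemma integral_left_deriv_eq_0:
  fixes u :: "osc \<Rightarrow> real"
  assumes \<gamma>: "one_parameter \<gamma>" and u: "smooth u" and inv: "\<And>l g. l \<in> L \<Longrightarrow> u (l \<cdot> g) = u g"
  shows "(\<integral>g. left_deriv \<gamma> u g \<partial>M) = 0"
proof -
  let ?v = "left_deriv \<gamma> u"
  have v: "smooth ?v" by (rule smooth_left_deriv[OF \<gamma> u])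
  have vinv: "?v (l \<cdot> g) = ?v g" if "l \<in> L" for l g
  proof -
    have "(\<lambda>h. u (l \<cdot> h)) = u" using inv[OF that] by blast
    then show ?thesis using left_deriv_translate[of \<gamma> u l g] by simp
  qed
  obtain B where B: "B \<ge> 0" "\<And>g. norm (?v g) \<le> B"
    using bounded_continuous_equi[OF smooth_continuous_on[OF v]] vinv by metis
  define h where "h n = inverse (real (Suc n))" for n
  have h: "h n > 0" "h n \<noteq> 0" for n by (simp_all add: h_def)
  have h_lim: "h \<longlonglongrightarrow> 0" unfolding h_def by (rule LIMSEQ_inverse_real_of_nat)
  have DU: "((\<lambda>r. u (g \<cdot> \<gamma> r)) has_real_derivative ?v (g \<cdot> \<gamma> r)) (at r)" for g r
    using left_deriv_has_vector_derivative[OF \<gamma> u] by (simp add: has_real_derivative_iff_has_vector_derivative)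
  define f where "f n g = (u (g \<cdot> \<gamma> (h n)) - u g) / h n" for n g
  have int_u: "integrable M u"
    by (rule integrable_M_continuous[OF smooth_continuous_on[OF u]]) (simp add: inv)
  have int_zero: "(\<integral>g. f n g \<partial>M) = 0" for n
    unfolding f_def
    using integral_invariant_right[OF smooth_borel_measurable[OF u] inv int_u, of "\<gamma> (h n)"] int_u
    by (simp add: divide_inverse)
  have lim: "(\<lambda>n. f n g) \<longlonglongrightarrow> ?v g" for g
  proof -
    have "(\<lambda>k. (u (g \<cdot> \<gamma> (0 + k)) - u (g \<cdot> \<gamma> 0)) / k) \<midarrow>0\<rightarrow> ?v g"
      using DERIV_D[OF DU[of g 0]] by (simp add: one_parameter_0[OF \<gamma>])
    then have "(\<lambda>n. (u (g \<cdot> \<gamma> (0 + h n)) - u (g \<cdot> \<gamma> 0)) / h n) \<longlonglongrightarrow> ?v g"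
      using h(2) h_lim unfolding LIMSEQ_SEQ_conv[symmetric] by blast
    then show ?thesis by (simp add: f_def one_parameter_0[OF \<gamma>])
  qed
  have bound: "norm (f n g) \<le> B" for n g
  proof -
    obtain z where "u (g \<cdot> \<gamma> (h n)) - u (g \<cdot> \<gamma> 0) = (h n - 0) * ?v (g \<cdot> \<gamma> z)"
      using MVT2[OF h(1)[of n] DU] by blast
    then have "f n g = ?v (g \<cdot> \<gamma> z)" using h(2)[of n] by (simp add: f_def one_parameter_0[OF \<gamma>])
    then show ?thesis using B(2) by simp
  qed
  have [measurable]: "u \<in> borel_measurable borel" by (rule smooth_borel_measurable[OF u])
  have "(\<lambda>n. \<integral>g. f n g \<partial>M) \<longlonglongrightarrow> (\<integral>g. ?v g \<partial>M)"
  proof (rule integral_dominated_convergence[where w="\<lambda>_. B"])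
    show "?v \<in> borel_measurable M" by (intro measurable_M smooth_borel_measurable v)
    show "f n \<in> borel_measurable M" for n unfolding f_def[abs_def] by (intro measurable_M) measurable
    show "integrable M (\<lambda>_. B)" by (rule finite_measure.integrable_const[OF finite_measure_M])
  qed (use lim bound in auto)
  moreover have "(\<lambda>n. \<integral>g. f n g \<partial>M) = (\<lambda>n. 0)" by (rule ext, rule int_zero)
  ultimately show ?thesis by (simp add: LIMSEQ_const_iff)
qed

lemma integration_by_parts:
  assumes \<gamma>: "one_parameter \<gamma>" and \<psi>: "\<psi> \<in> sections" and \<phi>: "\<phi> \<in> sections"
  shows "ip \<psi> (left_deriv \<gamma> \<phi>) = - ip (left_deriv \<gamma> \<psi>) \<phi>"
proof -
  have sm: "smooth \<psi>" "smooth \<phi>" "equi \<psi>" "equi \<phi>" using \<psi> \<phi> by (simp_all add: sections_def)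
  have S: "left_deriv \<gamma> \<psi> \<in> sections" "left_deriv \<gamma> \<phi> \<in> sections"
    using sm \<gamma> by (simp_all add: sections_def smooth_left_deriv equi_left_deriv)
  have "0 = (\<integral>g. left_deriv \<gamma> (\<lambda>g. \<psi> g \<bullet> \<phi> g) g \<partial>M)"
    by (rule integral_left_deriv_eq_0[OF \<gamma>, symmetric]) (simp_all add: smooth_inner sm equi_inner)
  also have "\<dots> = (\<integral>g. \<psi> g \<bullet> left_deriv \<gamma> \<phi> g + left_deriv \<gamma> \<psi> g \<bullet> \<phi> g \<partial>M)"
    by (simp only: left_deriv_bilinear[OF bounded_bilinear_inner \<gamma> sm(1,2)])
  also have "\<dots> = ip \<psi> (left_deriv \<gamma> \<phi>) + ip (left_deriv \<gamma> \<psi>) \<phi>"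
    unfolding ip_def by (rule Bochner_Integration.integral_add) (intro integrable_inner sections_L2 S \<psi> \<phi>)+
  finally show ?thesis by simp
qed

lemma sections_left_deriv: "one_parameter \<gamma> \<Longrightarrow> \<psi> \<in> sections \<Longrightarrow> left_deriv \<gamma> \<psi> \<in> sections"
  by (simp add: sections_def smooth_left_deriv equi_left_deriv)

lemma sections_add: "\<psi> \<in> sections \<Longrightarrow> \<phi> \<in> sections \<Longrightarrow> (\<lambda>g. \<psi> g + \<phi> g) \<in> sections"
  by (simp add: sections_def smooth_add equi_add)

lemma sections_bounded_linear: "bounded_linear B \<Longrightarrow> \<psi> \<in> sections \<Longrightarrow> (\<lambda>g. B (\<psi> g)) \<in> sections"
  by (simp add: sections_def smooth_bounded_linear equi_linear bounded_linear.linear)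

lemma sections_scaleR: "\<psi> \<in> sections \<Longrightarrow> (\<lambda>g. c *\<^sub>R \<psi> g) \<in> sections"
  by (rule sections_bounded_linear[OF bounded_linear_scaleR_right])

lemma sections_vector_scalar: "\<psi> \<in> sections \<Longrightarrow> (\<lambda>g. c *s \<psi> g) \<in> sections"
  by (rule sections_bounded_linear[OF bounded_linear_vector_scalar])

lemma sections_casimir:
  assumes "\<psi> \<in> sections" shows "casimir_op \<psi> \<in> sections"
  unfolding casimir_op_def[abs_def]
  by (intro sections_add sections_scaleR sections_left_deriv one_parameter_exp assms)

lemma sections_dirac:
  assumes "\<psi> \<in> sections" shows "dirac \<psi> \<in> sections"
  unfolding dirac_eq[abs_def]
  by (intro sections_add sections_scaleR sections_bounded_linear[OF bounded_linear_matrix_vector]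
      sections_left_deriv one_parameter_exp assms)

text \<open>Integration by parts, twice in each term. The order of the two fields is reversed, but \<open>Z\<close> and \<open>T\<close> commute.\<close>

lemma casimir_symmetric:
  assumes \<psi>: "\<psi> \<in> sections" and \<phi>: "\<phi> \<in> sections"
  shows "ip \<psi> (casimir_op \<phi>) = ip (casimir_op \<psi>) \<phi>"
proof -
  have two: "ip \<psi> (left_deriv \<gamma> (left_deriv \<delta> \<phi>)) = ip (left_deriv \<delta> (left_deriv \<gamma> \<psi>)) \<phi>"
    if "one_parameter \<gamma>" "one_parameter \<delta>" for \<gamma> \<delta>
    using that \<psi> \<phi> by (simp add: integration_by_parts sections_left_deriv)
  have comm: "left_deriv exp_T (left_deriv exp_Z \<psi>) = left_deriv exp_Z (left_deriv exp_T \<psi>)"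
    using commutators(6)[of \<psi>] \<psi> by (auto simp: sections_def)
  note S = sections_L2 sections_left_deriv one_parameter_exp L2_add L2_scaleR \<psi> \<phi>
  show ?thesis
    unfolding casimir_op_def[abs_def]
    by (simp add: S ip_add ip_add_right ip_scaleR ip_scaleR_right two comm)
qed

text \<open>The adjoint of \<open>M \<cdot> V\<close>, for a matrix \<open>M\<close> and a left-invariant field \<open>V\<close>, is \<open>- V M\<^sup>*\<close>.\<close>

lemma dirac_formal_adjoint:
  assumes \<psi>: "\<psi> \<in> sections"
  obtains \<theta> where "\<theta> \<in> sections" "\<And>\<phi>. \<phi> \<in> sections \<Longrightarrow> ip \<psi> (dirac \<phi>) = ip \<theta> \<phi>"
proof -
  define adj where "adj A = adjoint (\<lambda>v. (A :: complex ^ 4 ^ 4) *v v)" for A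
  have lin: "linear (\<lambda>v. (A :: complex ^ 4 ^ 4) *v v)" for A
    by (rule bounded_linear.linear[OF bounded_linear_matrix_vector])
  have adj_bl: "bounded_linear (adj A)" for A
    unfolding adj_def by (simp add: linear_conv_bounded_linear[symmetric] adjoint_linear lin)
  have adj: "x \<bullet> (A *v y) = adj A x \<bullet> y" for x y A
    using adjoint_works[OF lin, of y A x] unfolding adj_def by (simp add: inner_commute)
  define \<eta> where "\<eta> A = (\<lambda>g. adj A (\<psi> g))" for A
  have \<eta>: "\<eta> A \<in> sections" for A unfolding \<eta>_def by (rule sections_bounded_linear[OF adj_bl \<psi>])
  define k where "k = (1/2::real)"
  have 1: "ip \<psi> (\<lambda>g. A *v \<phi> g) = ip (\<eta> A) \<phi>" for A \<phi>
    by (simp add: ip_def adj \<eta>_def)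
  define \<theta> where "\<theta> g = (- 1) *\<^sub>R left_deriv exp_X (\<eta> cliff_X) g + (- 1) *\<^sub>R left_deriv exp_Y (\<eta> cliff_Y) g
     + (- 1) *\<^sub>R left_deriv exp_T (\<eta> cliff_Z) g + (- 1) *\<^sub>R left_deriv exp_Z (\<eta> cliff_T) g
     + k *\<^sub>R \<eta> (cliff_X ** cliff_Y ** cliff_Z) g" for g
  have "\<theta> \<in> sections" unfolding \<theta>_def[abs_def]
    by (intro sections_add sections_scaleR sections_left_deriv one_parameter_exp \<eta>)
  moreover have "ip \<psi> (dirac \<phi>) = ip \<theta> \<phi>" if \<phi>: "\<phi> \<in> sections" for \<phi>
  proof -
    note S = sections_L2 sections_left_deriv one_parameter_exp sections_add sections_scaleR
      sections_bounded_linear[OF bounded_linear_matrix_vector] \<psi> \<phi> \<eta>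
    have "ip \<psi> (dirac \<phi>) = ip (\<eta> cliff_X) (left_deriv exp_X \<phi>) + ip (\<eta> cliff_Y) (left_deriv exp_Y \<phi>)
      + ip (\<eta> cliff_Z) (left_deriv exp_T \<phi>) + ip (\<eta> cliff_T) (left_deriv exp_Z \<phi>)
      + k * ip (\<eta> (cliff_X ** cliff_Y ** cliff_Z)) \<phi>"
      unfolding dirac_eq[abs_def] k_def[symmetric] by (simp add: ip_add_right ip_scaleR_right S 1)
    also have "\<dots> = ip \<theta> \<phi>"
      unfolding \<theta>_def[abs_def]
      by (simp only: ip_add ip_scaleR S integration_by_parts)
    finally show ?thesis .
  qed
  ultimately show ?thesis by (rule that)
qed

subsection \<open>Completeness and orthogonal projection\<close>

lemma integrable_norm_L2: assumes "\<psi> \<in> L2" shows "integrable M \<psi>"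
proof (rule Bochner_Integration.integrable_bound)
  show "integrable M (\<lambda>g. 1 + (norm (\<psi> g))\<^sup>2)"
    by (intro Bochner_Integration.integrable_add finite_measure.integrable_const[OF finite_measure_M] L2D assms)
  show "AE g in M. norm (\<psi> g) \<le> norm (1 + (norm (\<psi> g))\<^sup>2)"
  proof (rule AE_I2)
    fix g
    have "0 \<le> (norm (\<psi> g) - 1)\<^sup>2" by simp
    then have "2 * norm (\<psi> g) \<le> 1 + (norm (\<psi> g))\<^sup>2" by (simp add: power2_diff)
    then have "norm (\<psi> g) \<le> 1 + (norm (\<psi> g))\<^sup>2" using norm_ge_zero[of "\<psi> g"] by linarith
    then show "norm (\<psi> g) \<le> norm (1 + (norm (\<psi> g))\<^sup>2)" by simp
  qed
qed (rule L2D[OF assms])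

text \<open>This is \<open>x \<le> a x\<^sup>2 + 1/a\<close>, integrated. With \<open>a\<close> large it makes sequences that are Cauchy for \<open>l2_norm\<close> also Cauchy
  in mean.\<close>

lemma integral_norm_le:
  assumes \<psi>: "\<psi> \<in> L2" and a: "a > 0"
  shows "(\<integral>g. norm (\<psi> g) \<partial>M) \<le> a * (l2_norm L \<psi>)\<^sup>2 + measure M (space M) / a"
proof -
  interpret finite_measure M by (rule finite_measure_M)
  have "(\<integral>g. norm (\<psi> g) \<partial>M) \<le> (\<integral>g. a * (norm (\<psi> g))\<^sup>2 + 1 / a \<partial>M)"
  proof (rule integral_mono)
    show "integrable M (\<lambda>g. norm (\<psi> g))" using integrable_norm_L2[OF \<psi>] by simp
    show "integrable M (\<lambda>g. a * (norm (\<psi> g))\<^sup>2 + 1 / a)" using L2D(4)[OF \<psi>] by simp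
    fix g
    have "0 \<le> (a * norm (\<psi> g) - 1)\<^sup>2" by simp
    then have "a * (2 * norm (\<psi> g)) \<le> a * (a * (norm (\<psi> g))\<^sup>2 + 1 / a)"
      using a by (simp add: power2_diff power2_eq_square algebra_simps)
    then have "2 * norm (\<psi> g) \<le> a * (norm (\<psi> g))\<^sup>2 + 1 / a" using a by (simp only: mult_le_cancel_left_pos)
    then show "norm (\<psi> g) \<le> a * (norm (\<psi> g))\<^sup>2 + 1 / a" using norm_ge_zero[of "\<psi> g"] by linarith
  qed
  also have "\<dots> = a * (l2_norm L \<psi>)\<^sup>2 + measure M (space M) / a"
    using L2D(4)[OF \<psi>] by (simp add: l2_norm_square ip_def power2_norm_eq_inner)
  finally show ?thesis .
qed

text \<open>A subsequence converges almost everywhere, and by Fatou the whole sequence converges in norm to its limit.\<close>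

lemma L2_complete:
  assumes v: "\<And>n. v n \<in> L2"
    and Cauchy: "\<And>e. e > 0 \<Longrightarrow> \<exists>N. \<forall>i\<ge>N. \<forall>j\<ge>N. l2_norm L (\<lambda>g. v i g - v j g) < e"
  obtains \<zeta> where "\<zeta> \<in> L2" "(\<lambda>n. l2_norm L (\<lambda>g. v n g - \<zeta> g)) \<longlonglongrightarrow> 0"
proof -
  define V where "V = measure M (space M)"
  have V: "V \<ge> 0" by (simp add: V_def)
  have m [measurable]: "v n \<in> borel_measurable borel" for n by (rule L2D(1)[OF v])
  obtain r where r: "strict_mono r" "AE g in M. Cauchy (\<lambda>i. v (r i) g)"
  proof (rule cauchy_L1_AE_cauchy_subseq)
    show "integrable M (v n)" for n by (rule integrable_norm_L2[OF v])
    fix e :: real assume e: "e > 0"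
    define a where "a = 2 * (V + 1) / e"
    have a: "a > 0" using e V by (simp add: a_def)
    obtain N where N: "\<forall>i\<ge>N. \<forall>j\<ge>N. l2_norm L (\<lambda>g. v i g - v j g) < sqrt (e / (2 * a))"
      using Cauchy[of "sqrt (e / (2 * a))"] e a by auto
    have "(\<integral>g. norm (v i g - v j g) \<partial>M) < e" if "i \<ge> N" "j \<ge> N" for i j
    proof -
      have "(l2_norm L (\<lambda>g. v i g - v j g))\<^sup>2 < (sqrt (e / (2 * a)))\<^sup>2"
        using N that by (intro power_strict_mono) (simp_all add: l2_norm_nonneg)
      then have "(l2_norm L (\<lambda>g. v i g - v j g))\<^sup>2 < e / (2 * a)" using a e by simp
      then have "a * (l2_norm L (\<lambda>g. v i g - v j g))\<^sup>2 < a * (e / (2 * a))"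
        by (rule mult_strict_left_mono[OF _ a])
      also have "\<dots> = e / 2" using a by simp
      finally have "a * (l2_norm L (\<lambda>g. v i g - v j g))\<^sup>2 < e / 2" .
      moreover have "V / a \<le> e / 2" using e V by (simp add: a_def field_simps)
      moreover have "(\<integral>g. norm (v i g - v j g) \<partial>M) \<le> a * (l2_norm L (\<lambda>g. v i g - v j g))\<^sup>2 + V / a"
        unfolding V_def by (rule integral_norm_le[OF L2_diff[OF v v] a])
      ultimately show ?thesis by linarith
    qed
    then show "\<exists>N. \<forall>i\<ge>N. \<forall>j\<ge>N. (\<integral>g. norm (v i g - v j g) \<partial>M) < e" by blast
  qed blast
  \<comment> \<open>the set of convergence is invariant under \<open>L\<close>, so the default value keeps the limit equivariant at every point\<close>
  define \<zeta> where "\<zeta> g = (if Cauchy (\<lambda>i. v (r i) g) then lim (\<lambda>i. v (r i) g) else 0)" for g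
  have \<zeta>_lim: "(\<lambda>i. v (r i) g) \<longlonglongrightarrow> \<zeta> g" if "Cauchy (\<lambda>i. v (r i) g)" for g
    using that by (simp add: \<zeta>_def Cauchy_convergent_iff convergent_LIMSEQ_iff)
  have \<zeta>_m [measurable]: "\<zeta> \<in> borel_measurable borel" unfolding \<zeta>_def[abs_def] by measurable
  have \<zeta>_equi: "equi \<zeta>"
    unfolding equi_def
  proof (intro ballI allI)
    fix l g assume l: "l \<in> L"
    have eq: "v (r i) (l \<cdot> g) = s l *\<^sub>R v (r i) g" for i by (rule equiD[OF L2D(3)[OF v] l])
    show "\<zeta> (l \<cdot> g) = s l *\<^sub>R \<zeta> g"
    proof (cases "Cauchy (\<lambda>i. v (r i) g)")
      case True
      have lim: "(\<lambda>i. v (r i) (l \<cdot> g)) \<longlonglongrightarrow> s l *\<^sub>R \<zeta> g"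
        unfolding eq by (intro tendsto_intros \<zeta>_lim True)
      then have "Cauchy (\<lambda>i. v (r i) (l \<cdot> g))" by (rule LIMSEQ_imp_Cauchy)
      from LIMSEQ_unique[OF \<zeta>_lim[OF this] lim] show ?thesis .
    next
      case False
      have "\<not> Cauchy (\<lambda>i. v (r i) (l \<cdot> g))"
      proof
        assume "Cauchy (\<lambda>i. v (r i) (l \<cdot> g))"
        then have "Cauchy (\<lambda>i. s l *\<^sub>R v (r i) (l \<cdot> g))"
          by (rule bounded_linear.Cauchy[OF bounded_linear_scaleR_right])
        moreover have "s l *\<^sub>R v (r i) (l \<cdot> g) = v (r i) g" for i unfolding eq using l by simp
        ultimately show False using False by simp
      qed
      then show ?thesis using False by (simp add: \<zeta>_def)
    qed
  qed
  have key: "(\<integral>\<^sup>+g. ennreal ((norm (v n g - \<zeta> g))\<^sup>2) \<partial>M) \<le> ennreal (e\<^sup>2)"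
    if e: "\<forall>i\<ge>N. \<forall>j\<ge>N. l2_norm L (\<lambda>g. v i g - v j g) < e" and n: "n \<ge> N" for n N e
  proof -
    have "e > 0" using e n l2_norm_nonneg le_less_trans by blast
    have nn: "(\<integral>\<^sup>+g. ennreal ((norm (v n g - v (r i) g))\<^sup>2) \<partial>M) \<le> ennreal (e\<^sup>2)" if "i \<ge> N" for i
    proof -
      have "r i \<ge> N" using seq_suble[OF r(1), of i] that by simp
      then have "(l2_norm L (\<lambda>g. v n g - v (r i) g))\<^sup>2 \<le> e\<^sup>2"
        using e n by (intro power_mono) (auto simp: l2_norm_nonneg less_imp_le)
      then show ?thesis
        using L2D(4)[OF L2_diff[OF v v], of n "r i"]
        by (subst nn_integral_eq_integral) (simp_all add: l2_norm_square ip_def power2_norm_eq_inner)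
    qed
    have "(\<integral>\<^sup>+g. ennreal ((norm (v n g - \<zeta> g))\<^sup>2) \<partial>M)
        = (\<integral>\<^sup>+g. liminf (\<lambda>i. ennreal ((norm (v n g - v (r i) g))\<^sup>2)) \<partial>M)"
    proof (rule nn_integral_cong_AE)
      show "AE g in M. ennreal ((norm (v n g - \<zeta> g))\<^sup>2) = liminf (\<lambda>i. ennreal ((norm (v n g - v (r i) g))\<^sup>2))"
        using r(2)
      proof eventually_elim
        case (elim g)
        have "(\<lambda>i. ennreal ((norm (v n g - v (r i) g))\<^sup>2)) \<longlonglongrightarrow> ennreal ((norm (v n g - \<zeta> g))\<^sup>2)"
          by (intro tendsto_ennrealI tendsto_intros \<zeta>_lim elim)
        then show ?case by (intro lim_imp_Liminf[symmetric]) simp_all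
      qed
    qed
    also have "\<dots> \<le> liminf (\<lambda>i. \<integral>\<^sup>+g. ennreal ((norm (v n g - v (r i) g))\<^sup>2) \<partial>M)"
      by (rule nn_integral_liminf) (intro measurable_M[of "\<lambda>g. (norm (v n g - v (r _) g))\<^sup>2", THEN measurable_compose[OF _ measurable_ennreal]], measurable)
    also have "\<dots> \<le> liminf (\<lambda>i. ennreal (e\<^sup>2))"
      by (rule Liminf_mono) (rule eventually_mono[OF eventually_ge_at_top[of N] nn])
    also have "\<dots> = ennreal (e\<^sup>2)" by (simp add: Liminf_const)
    finally show ?thesis .
  qed
  have diff_L2: "(\<lambda>g. v n g - \<zeta> g) \<in> L2" if "\<forall>i\<ge>N. \<forall>j\<ge>N. l2_norm L (\<lambda>g. v i g - v j g) < e" "n \<ge> N" for n N e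
  proof -
    have "integrable M (\<lambda>g. (norm (v n g - \<zeta> g))\<^sup>2)"
      unfolding integrable_iff_bounded
    proof
      show "(\<lambda>g. (norm (v n g - \<zeta> g))\<^sup>2) \<in> borel_measurable M" by (intro measurable_M) measurable
      show "(\<integral>\<^sup>+g. ennreal (norm ((norm (v n g - \<zeta> g))\<^sup>2)) \<partial>M) < \<infinity>"
        using key[OF that] by (simp add: le_less_trans)
    qed
    then show ?thesis using equi_diff[OF L2D(3)[OF v] \<zeta>_equi, of n] by (simp add: L2_def)
  qed
  have "\<zeta> \<in> L2"
  proof -
    obtain N where "\<forall>i\<ge>N. \<forall>j\<ge>N. l2_norm L (\<lambda>g. v i g - v j g) < 1" using Cauchy[of 1] by auto
    from L2_diff[OF v diff_L2[OF this order_refl], of N] show ?thesis by simp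
  qed
  moreover have "(\<lambda>n. l2_norm L (\<lambda>g. v n g - \<zeta> g)) \<longlonglongrightarrow> 0"
  proof (rule LIMSEQ_I)
    fix e :: real assume e: "e > 0"
    then obtain N where N: "\<forall>i\<ge>N. \<forall>j\<ge>N. l2_norm L (\<lambda>g. v i g - v j g) < e / 2" using Cauchy[of "e / 2"] by auto
    have "l2_norm L (\<lambda>g. v n g - \<zeta> g) < e" if "n \<ge> N" for n
    proof -
      have "ennreal ((l2_norm L (\<lambda>g. v n g - \<zeta> g))\<^sup>2) \<le> ennreal ((e / 2)\<^sup>2)"
        using key[OF N that] L2D(4)[OF diff_L2[OF N that]]
        by (subst (asm) nn_integral_eq_integral) (simp_all add: l2_norm_square ip_def power2_norm_eq_inner)
      then have "(l2_norm L (\<lambda>g. v n g - \<zeta> g))\<^sup>2 \<le> (e / 2)\<^sup>2" by (subst (asm) ennreal_le_iff) simp_all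
      then have "l2_norm L (\<lambda>g. v n g - \<zeta> g) \<le> e / 2" by (rule power2_le_imp_le) (use e in simp)
      then show ?thesis using e by simp
    qed
    then show "\<exists>no. \<forall>n\<ge>no. norm (l2_norm L (\<lambda>g. v n g - \<zeta> g) - 0) < e"
      by (auto simp: l2_norm_nonneg)
  qed
  ultimately show ?thesis by (rule that)
qed

text \<open>A sequence in \<open>W\<close> that minimises the distance to \<open>\<eta>\<close> is Cauchy by the parallelogram law. The limit of the differences to \<open>\<eta>\<close>
  is orthogonal to \<open>W\<close>, since moving along \<open>W\<close> cannot shorten it, and has norm at least \<open>e\<close>.\<close>

lemma orthogonal_vector_exists:
  assumes W: "W \<subseteq> L2" "W \<noteq> {}" "\<And>a b. a \<in> W \<Longrightarrow> b \<in> W \<Longrightarrow> (\<lambda>g. a g + b g) \<in> W" "\<And>a c. a \<in> W \<Longrightarrow> (\<lambda>g. c *\<^sub>R a g) \<in> W"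
    and \<eta>: "\<eta> \<in> L2" and e: "e > 0" and far: "\<And>w. w \<in> W \<Longrightarrow> l2_norm L (\<lambda>g. w g - \<eta> g) \<ge> e"
  obtains \<zeta> where "\<zeta> \<in> L2" "l2_norm L \<zeta> \<noteq> 0" "\<And>w. w \<in> W \<Longrightarrow> ip \<zeta> w = 0"
proof -
  define q where "q w = ip (\<lambda>g. \<eta> g - w g) (\<lambda>g. \<eta> g - w g)" for w
  define d where "d = Inf (q ` W)"
  have bdd: "bdd_below (q ` W)" by (rule bdd_belowI[of _ 0]) (auto simp: q_def ip_nonneg)
  have d_le: "d \<le> q w" if "w \<in> W" for w unfolding d_def using that by (intro cINF_lower bdd)
  have d_ge: "e\<^sup>2 \<le> d" unfolding d_def
  proof (rule cINF_greatest)
    fix w assume "w \<in> W"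
    then have "e\<^sup>2 \<le> (l2_norm L (\<lambda>g. \<eta> g - w g))\<^sup>2"
      using far[of w] e by (intro power_mono) (simp_all add: l2_norm_minus_commute[of \<eta> w])
    then show "e\<^sup>2 \<le> q w" by (simp add: q_def l2_norm_square)
  qed (rule W)
  have "\<exists>w\<in>W. q w < d + inverse (real (Suc n))" for n
    using cInf_lessD[of "q ` W" "d + inverse (real (Suc n))"] W(2) by (auto simp: d_def)
  then obtain w where w: "w n \<in> W" "q (w n) < d + inverse (real (Suc n))" for n by metis
  define v where "v n g = \<eta> g - w n g" for n g
  have v: "v n \<in> L2" for n unfolding v_def[abs_def] using \<eta> w(1) W(1) by (intro L2_diff) auto
  have v_ip: "ip (v n) (v n) < d + inverse (real (Suc n))" for n using w(2)[of n] by (simp add: q_def v_def[abs_def])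
  have shift: "d \<le> ip (\<lambda>g. v n g + t *\<^sub>R a g) (\<lambda>g. v n g + t *\<^sub>R a g)" if "a \<in> W" for n t a
  proof -
    have "(\<lambda>g. w n g + (- t) *\<^sub>R a g) \<in> W" using w(1) that W(3,4) by blast
    from d_le[OF this] show ?thesis by (simp add: q_def v_def algebra_simps)
  qed
  \<comment> \<open>parallelogram law, applied to \<open>v i\<close> and \<open>v j\<close>, whose midpoint has squared norm at least \<open>d\<close>\<close>
  have cauchy: "(l2_norm L (\<lambda>g. v i g - v j g))\<^sup>2 \<le> 2 * inverse (real (Suc i)) + 2 * inverse (real (Suc j))" for i j
  proof -
    have "(\<lambda>g. (1/2) *\<^sub>R w i g + (1/2) *\<^sub>R w j g) \<in> W" using w(1) W(3,4) by blast
    then have "d \<le> q (\<lambda>g. (1/2) *\<^sub>R w i g + (1/2) *\<^sub>R w j g)" by (rule d_le)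
    also have "(\<lambda>g. \<eta> g - ((1/2) *\<^sub>R w i g + (1/2) *\<^sub>R w j g)) = (\<lambda>g. (1/2) *\<^sub>R (v i g + v j g))"
      by (rule ext) (simp add: v_def algebra_simps flip: scaleR_2)
    then have "q (\<lambda>g. (1/2) *\<^sub>R w i g + (1/2) *\<^sub>R w j g) = (1/4) * ip (\<lambda>g. v i g + v j g) (\<lambda>g. v i g + v j g)"
      unfolding q_def by (simp add: ip_scaleR ip_scaleR_right del: scaleR_add_right)
    finally have "4 * d \<le> ip (\<lambda>g. v i g + v j g) (\<lambda>g. v i g + v j g)" by simp
    moreover have "ip (\<lambda>g. v i g + v j g) (\<lambda>g. v i g + v j g) + ip (\<lambda>g. v i g - v j g) (\<lambda>g. v i g - v j g)
        = 2 * ip (v i) (v i) + 2 * ip (v j) (v j)"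
      using ip_square_add[OF v v, of i 1 j] ip_square_add[OF v v, of i "- 1" j] by simp
    ultimately show ?thesis using v_ip[of i] v_ip[of j] by (simp add: l2_norm_square)
  qed
  obtain \<zeta> where \<zeta>: "\<zeta> \<in> L2" "(\<lambda>n. l2_norm L (\<lambda>g. v n g - \<zeta> g)) \<longlonglongrightarrow> 0"
  proof (rule L2_complete[OF v])
    fix \<epsilon> :: real assume \<epsilon>: "\<epsilon> > 0"
    obtain N where N: "inverse (real (Suc N)) < \<epsilon>\<^sup>2 / 4"
      using reals_Archimedean[of "\<epsilon>\<^sup>2 / 4"] \<epsilon> by auto
    have "l2_norm L (\<lambda>g. v i g - v j g) < \<epsilon>" if "i \<ge> N" "j \<ge> N" for i j
    proof (rule power_less_imp_less_base)
      have "inverse (real (Suc i)) \<le> inverse (real (Suc N))" "inverse (real (Suc j)) \<le> inverse (real (Suc N))"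
        using that by (simp_all add: le_imp_inverse_le)
      then show "(l2_norm L (\<lambda>g. v i g - v j g))\<^sup>2 < \<epsilon>\<^sup>2" using cauchy[of i j] N by linarith
      show "0 \<le> \<epsilon>" using \<epsilon> by simp
    qed
    then show "\<exists>N. \<forall>i\<ge>N. \<forall>j\<ge>N. l2_norm L (\<lambda>g. v i g - v j g) < \<epsilon>" by blast
  qed blast
  have lim_ip: "(\<lambda>n. ip a (v n)) \<longlonglongrightarrow> ip a \<zeta>" if "a \<in> L2" for a
    using ip_tendsto[OF v \<zeta>(1) that \<zeta>(2)] .
  have lim_sq: "(\<lambda>n. ip (v n) (v n)) \<longlonglongrightarrow> ip \<zeta> \<zeta>"
  proof -
    have "(\<lambda>n. (l2_norm L (\<lambda>g. v n g - \<zeta> g))\<^sup>2 + 2 * ip \<zeta> (v n) - ip \<zeta> \<zeta>) \<longlonglongrightarrow> 0\<^sup>2 + 2 * ip \<zeta> \<zeta> - ip \<zeta> \<zeta>"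
      by (intro tendsto_intros \<zeta> lim_ip)
    moreover have "(l2_norm L (\<lambda>g. v n g - \<zeta> g))\<^sup>2 + 2 * ip \<zeta> (v n) - ip \<zeta> \<zeta> = ip (v n) (v n)" for n
      using ip_square_add[OF v \<zeta>(1), of n "- 1"] by (simp add: l2_norm_square ip_commute)
    ultimately show ?thesis by simp
  qed
  have lim_shift: "d \<le> ip \<zeta> \<zeta> + 2 * t * ip \<zeta> a + t\<^sup>2 * ip a a" if a: "a \<in> W" for t a
  proof (rule LIMSEQ_le_const)
    have aL: "a \<in> L2" using a W(1) by blast
    show "(\<lambda>n. ip (v n) (v n) + 2 * t * ip a (v n) + t\<^sup>2 * ip a a) \<longlonglongrightarrow> ip \<zeta> \<zeta> + 2 * t * ip \<zeta> a + t\<^sup>2 * ip a a"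
      unfolding ip_commute[of \<zeta> a] by (intro tendsto_intros lim_sq lim_ip aL)
    show "\<exists>N. \<forall>n\<ge>N. d \<le> ip (v n) (v n) + 2 * t * ip a (v n) + t\<^sup>2 * ip a a"
      using shift[OF a, of _ t] unfolding ip_square_add[OF v aL] ip_commute[of "v _" a] by blast
  qed
  have sq_le: "ip \<zeta> \<zeta> \<le> d"
  proof (rule LIMSEQ_le)
    show "(\<lambda>n. ip (v n) (v n)) \<longlonglongrightarrow> ip \<zeta> \<zeta>" by (rule lim_sq)
    have "(\<lambda>n. d + inverse (real (Suc n))) \<longlonglongrightarrow> d + 0"
      by (intro tendsto_add tendsto_const LIMSEQ_inverse_real_of_nat)
    then show "(\<lambda>n. d + inverse (real (Suc n))) \<longlonglongrightarrow> d" by simp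
    show "\<exists>N. \<forall>n\<ge>N. ip (v n) (v n) \<le> d + inverse (real (Suc n))" using v_ip less_imp_le by blast
  qed
  have "ip \<zeta> a = 0" if a: "a \<in> W" for a
  proof -
    have "0 \<le> 0 + 2 * t * ip \<zeta> a + t\<^sup>2 * ip a a" for t using lim_shift[OF a, of t] sq_le by simp
    from quadratic_nonneg[OF this ip_nonneg] show ?thesis by simp
  qed
  moreover have "l2_norm L \<zeta> \<noteq> 0"
  proof -
    obtain a where "a \<in> W" using W(2) by blast
    from lim_shift[OF this, of 0] have "d \<le> ip \<zeta> \<zeta>" by simp
    moreover have "d > 0" using d_ge e zero_less_power[of e 2] by linarith
    ultimately show ?thesis by (simp add: l2_norm_eq)
  qed
  ultimately show ?thesis using that \<zeta>(1) by blast
qed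

end

section \<open>Smoothing kernels\<close>

text \<open>Under this condition a continuous kernel can be integrated against functions that are only locally integrable.\<close>

definition properly_supported :: "('a::topological_space \<times> 'b::topological_space \<Rightarrow> real) \<Rightarrow> bool"
  where "properly_supported K \<longleftrightarrow> (\<forall>h. \<exists>U C. open U \<and> h \<in> U \<and> compact C \<and> (\<forall>x\<in>U. \<forall>y. y \<notin> C \<longrightarrow> K (x, y) = 0))"

definition kernel_integral ::
    "('b::euclidean_space \<Rightarrow> 'c::euclidean_space) \<Rightarrow> ('a \<times> 'b \<Rightarrow> real) \<Rightarrow> 'a \<Rightarrow> 'c"
  where "kernel_integral f K x = (\<integral>y. K (x, y) *\<^sub>R f y \<partial>lborel)"

lemma dir_deriv_zero_outside:
  fixes K :: "'a::real_normed_vector \<times> 'b::real_normed_vector \<Rightarrow> 'c::real_normed_vector"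
  assumes "open U" "closed C" "\<And>x y. x \<in> U \<Longrightarrow> y \<notin> C \<Longrightarrow> K (x, y) = 0" "x \<in> U" "y \<notin> C"
  shows "dir_deriv v K (x, y) = 0"
proof -
  have op: "open (U \<times> (- C))" using assms(1,2) by (simp add: open_Times open_Compl)
  have "(K has_derivative (\<lambda>v. 0)) (at (x, y))"
    by (rule has_derivative_transform_within_open[OF has_derivative_const[of 0] op])
       (use assms(3-5) in auto)
  then show ?thesis by (rule dir_derivI)
qed

lemma properly_supported_dir_deriv:
  fixes K :: "'a::euclidean_space \<times> 'b::euclidean_space \<Rightarrow> real"
  assumes "properly_supported K" shows "properly_supported (dir_deriv v K)"
  unfolding properly_supported_def
proof
  fix h :: 'a
  obtain U C where UC: "open U" "h \<in> U" "compact C" "\<And>x y. x \<in> U \<Longrightarrow> y \<notin> C \<Longrightarrow> K (x, y) = 0"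
    using assms unfolding properly_supported_def by metis
  have "dir_deriv v K (x, y) = 0" if "x \<in> U" "y \<notin> C" for x y
    by (rule dir_deriv_zero_outside[OF UC(1) compact_imp_closed[OF UC(3)] _ that]) (rule UC(4))
  with UC show "\<exists>U C. open U \<and> h \<in> U \<and> compact C \<and> (\<forall>x\<in>U. \<forall>y. y \<notin> C \<longrightarrow> dir_deriv v K (x, y) = 0)"
    by blast
qed

lemma kernel_integrable:
  fixes f :: "'b::euclidean_space \<Rightarrow> 'c::euclidean_space" and K :: "'a::euclidean_space \<times> 'b \<Rightarrow> real"
  assumes loc: "\<And>C. compact C \<Longrightarrow> integrable lborel (\<lambda>y. indicator C y *\<^sub>R f y)"
    and cont: "continuous_on UNIV K" and ps: "properly_supported K"
  shows "integrable lborel (\<lambda>y. K (x, y) *\<^sub>R f y)"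
proof -
  obtain U C where UC: "open U" "x \<in> U" "compact C" "\<And>x y. x \<in> U \<Longrightarrow> y \<notin> C \<Longrightarrow> K (x, y) = 0"
    using ps unfolding properly_supported_def by metis
  have contx: "continuous_on UNIV (\<lambda>y. K (x, y))"
    by (rule continuous_on_compose2[OF cont]) (auto intro!: continuous_intros)
  then have "compact ((\<lambda>y. K (x, y)) ` C)"
    by (metis UC(3) compact_continuous_image continuous_on_subset subset_UNIV)
  then obtain B where B: "\<And>y. y \<in> C \<Longrightarrow> norm (K (x, y)) \<le> B"
    using compact_imp_bounded bounded_iff by (metis imageI)
  have [measurable]: "(\<lambda>y. K (x, y)) \<in> borel_measurable borel" by (rule borel_measurable_continuous_onI[OF contx])
  have eq: "K (x, y) *\<^sub>R f y = K (x, y) *\<^sub>R (indicator C y *\<^sub>R f y)" for y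
    using UC(4)[OF UC(2), of y] by (cases "y \<in> C") simp_all
  show ?thesis unfolding eq
  proof (rule Bochner_Integration.integrable_bound)
    show "integrable lborel (\<lambda>y. B *\<^sub>R (indicator C y *\<^sub>R f y))"
      by (intro integrable_scaleR_right loc UC(3))
    show "(\<lambda>y. K (x, y) *\<^sub>R indicat_real C y *\<^sub>R f y) \<in> borel_measurable lborel"
      using loc[OF UC(3), THEN borel_measurable_integrable] by measurable
    show "AE y in lborel. norm (K (x, y) *\<^sub>R indicat_real C y *\<^sub>R f y) \<le> norm (B *\<^sub>R (indicat_real C y *\<^sub>R f y))"
    proof (rule AE_I2)
      fix y
      show "norm (K (x, y) *\<^sub>R indicat_real C y *\<^sub>R f y) \<le> norm (B *\<^sub>R (indicat_real C y *\<^sub>R f y))"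
        using B[of y] by (cases "y \<in> C") (auto intro!: mult_right_mono)
    qed
  qed
qed

lemma dir_deriv_partial:
  fixes K :: "'a::euclidean_space \<times> 'b::euclidean_space \<Rightarrow> 'c::real_normed_vector"
  assumes "smooth K"
  shows "((\<lambda>x. K (x, y)) has_derivative (\<lambda>v. dir_deriv (v, 0) K (x, y))) (at x)"
proof -
  have "((\<lambda>x. (x, y)) has_derivative (\<lambda>v. (v, 0))) (at x)" by (auto intro!: derivative_eq_intros)
  from has_derivative_compose[OF this smooth_has_derivative[OF assms]] show ?thesis .
qed

lemma linear_dir_deriv_partial:
  fixes K :: "'a::euclidean_space \<times> 'b::euclidean_space \<Rightarrow> 'c::real_normed_vector"
  assumes "smooth K"
  shows "dir_deriv (v, 0) K p = (\<Sum>b\<in>Basis. (v \<bullet> b) *\<^sub>R dir_deriv (b, 0) K p)"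
proof -
  obtain x y where p: "p = (x, y)" by (cases p)
  interpret linear "\<lambda>v. dir_deriv (v, 0) K p"
    unfolding p by (rule has_derivative_linear[OF dir_deriv_partial[OF assms]])
  have "dir_deriv (\<Sum>b\<in>Basis. (v \<bullet> b) *\<^sub>R b, 0) K p = (\<Sum>b\<in>Basis. (v \<bullet> b) *\<^sub>R dir_deriv (b, 0) K p)"
    by (simp only: sum scale)
  then show ?thesis by (simp only: euclidean_representation)
qed

text \<open>Differentiation under the integral sign. As \<open>f\<close> is merely integrable on compact sets, the remainder of the first order
  expansion of \<open>K\<close> is estimated uniformly in \<open>y\<close>, from the uniform continuity of the partial derivatives on a compact set.\<close>

lemma kernel_integral_has_derivative:
  fixes f :: "'b::euclidean_space \<Rightarrow> 'c::euclidean_space" and K :: "'a::euclidean_space \<times> 'b \<Rightarrow> real"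
  assumes loc: "\<And>C. compact C \<Longrightarrow> integrable lborel (\<lambda>y. indicator C y *\<^sub>R f y)"
    and K: "smooth K" and ps: "properly_supported K"
  shows "(kernel_integral f K has_derivative (\<lambda>v. kernel_integral f (dir_deriv (v, 0) K) x)) (at x)"
proof -
  have int: "integrable lborel (\<lambda>y. K (x, y) *\<^sub>R f y)" for x
    by (rule kernel_integrable[OF loc smooth_continuous_on[OF K] ps])
  have int': "integrable lborel (\<lambda>y. dir_deriv v K (x, y) *\<^sub>R f y)" for x v
    by (rule kernel_integrable[OF loc smooth_continuous_on[OF smooth_dir_deriv[OF K]] properly_supported_dir_deriv[OF ps]])
  have lin: "kernel_integral f (dir_deriv (v, 0) K) x = (\<Sum>b\<in>Basis. (v \<bullet> b) *\<^sub>R kernel_integral f (dir_deriv (b, 0) K) x)" for v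
    unfolding kernel_integral_def
    by (subst linear_dir_deriv_partial[OF K]) (simp add: scaleR_sum_left int' flip: scaleR_scaleR)
  have bl: "bounded_linear (\<lambda>v. kernel_integral f (dir_deriv (v, 0) K) x)"
  proof -
    have eq: "(\<lambda>v. kernel_integral f (dir_deriv (v, 0) K) x)
        = (\<lambda>v. \<Sum>b\<in>Basis. (v \<bullet> b) *\<^sub>R kernel_integral f (dir_deriv (b, 0) K) x)"
      by (rule ext, rule lin)
    have "bounded_linear (\<lambda>v. \<Sum>b\<in>Basis. (v \<bullet> b) *\<^sub>R kernel_integral f (dir_deriv (b, 0) K) x)"
      by (intro bounded_linear_sum bounded_linear_scaleR_const bounded_linear_inner_left)
    then show ?thesis by (rule arg_cong[OF eq, of bounded_linear, THEN iffD2])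
  qed
  obtain U C where UC: "open U" "x \<in> U" "compact C" "\<And>x y. x \<in> U \<Longrightarrow> y \<notin> C \<Longrightarrow> K (x, y) = 0"
    "\<And>v x y. x \<in> U \<Longrightarrow> y \<notin> C \<Longrightarrow> dir_deriv v K (x, y) = 0"
  proof -
    obtain U C where UC: "open U" "x \<in> U" "compact C" "\<And>x y. x \<in> U \<Longrightarrow> y \<notin> C \<Longrightarrow> K (x, y) = 0"
      using ps unfolding properly_supported_def by metis
    have "dir_deriv v K (x, y) = 0" if "x \<in> U" "y \<notin> C" for v x y
      by (rule dir_deriv_zero_outside[OF UC(1) compact_imp_closed[OF UC(3)] _ that]) (rule UC(4))
    with UC show ?thesis by (rule that)
  qed
  obtain r where r: "r > 0" "cball x r \<subseteq> U" using UC(1,2) open_contains_cball by blast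
  define A where "A = (\<integral>y. norm (indicator C y *\<^sub>R f y) \<partial>lborel)"
  have A: "A \<ge> 0" by (simp add: A_def)
  define n where "n = real DIM('a)"
  have n: "n > 0" by (simp add: n_def)
  have "\<exists>d>0. \<forall>z. norm (z - x) < d \<longrightarrow>
      norm (kernel_integral f K z - kernel_integral f K x - kernel_integral f (dir_deriv (z - x, 0) K) x) \<le> e * norm (z - x)"
    if e: "e > 0" for e
  proof -
    define e' where "e' = e / (n * (A + 1))"
    have e': "e' > 0" using e n A by (simp add: e'_def)
    have "\<exists>d>0. \<forall>z\<in>cball x r. \<forall>y\<in>C. dist z x < d \<longrightarrow> \<bar>dir_deriv (b, 0) K (z, y) - dir_deriv (b, 0) K (x, y)\<bar> < e'"
      for b :: 'a
    proof -
      have "uniformly_continuous_on (cball x r \<times> C) (dir_deriv (b, 0) K)"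
        by (intro compact_uniformly_continuous smooth_continuous_on smooth_dir_deriv K compact_Times compact_cball UC(3))
      then obtain d where d: "d > 0" "\<And>p q. p \<in> cball x r \<times> C \<Longrightarrow> q \<in> cball x r \<times> C \<Longrightarrow> dist q p < d \<Longrightarrow>
          dist (dir_deriv (b, 0) K q) (dir_deriv (b, 0) K p) < e'"
        unfolding uniformly_continuous_on_def using e' by metis
      have "\<bar>dir_deriv (b, 0) K (z, y) - dir_deriv (b, 0) K (x, y)\<bar> < e'"
        if "z \<in> cball x r" "y \<in> C" "dist z x < d" for z y
        using d(2)[of "(x, y)" "(z, y)"] that r(1) by (simp add: dist_Pair_Pair dist_real_def)
      with d(1) show ?thesis by blast
    qed
    then obtain d where d: "d b > 0" "\<And>z y. z \<in> cball x r \<Longrightarrow> y \<in> C \<Longrightarrow> dist z x < d b \<Longrightarrow>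
        \<bar>dir_deriv (b, 0) K (z, y) - dir_deriv (b, 0) K (x, y)\<bar> < e'" for b :: 'a
      by metis
    define \<delta> where "\<delta> = Min (insert r (d ` Basis))"
    have \<delta>: "\<delta> > 0" using r(1) d(1) by (simp add: \<delta>_def)
    have \<delta>_le: "\<delta> \<le> r" "\<And>b. b \<in> Basis \<Longrightarrow> \<delta> \<le> d b"
      unfolding \<delta>_def by (rule Min_le; simp)+
    have est: "norm (K (z, y) - K (x, y) - dir_deriv (z - x, 0) K (x, y)) \<le> norm (z - x) * (n * e')"
      if z: "norm (z - x) < \<delta>" and y: "y \<in> C" for z y
    proof (rule differentiable_bound_linearization[where S="ball x \<delta>" and f'="\<lambda>z v. dir_deriv (v, 0) K (z, y)"])
      show "x + t *\<^sub>R (z - x) \<in> ball x \<delta>" if "t \<in> {0..1}" for t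
      proof -
        have "\<bar>t\<bar> * norm (z - x) \<le> 1 * norm (z - x)" using that by (intro mult_right_mono) auto
        then show ?thesis using z by (simp add: dist_norm norm_minus_commute)
      qed
      show "x \<in> ball x \<delta>" using \<delta> by simp
      fix w assume w: "w \<in> ball x \<delta>"
      show "((\<lambda>x. K (x, y)) has_derivative (\<lambda>v. dir_deriv (v, 0) K (w, y))) (at w within ball x \<delta>)"
        by (rule has_derivative_at_withinI[OF dir_deriv_partial[OF K]])
      show "onorm ((\<lambda>v. dir_deriv (v, 0) K (w, y)) - (\<lambda>v. dir_deriv (v, 0) K (x, y))) \<le> n * e'"
      proof (rule onorm_bound)
        show "0 \<le> n * e'" using n e' by simp
        fix v :: 'a
        have "norm (((\<lambda>v. dir_deriv (v, 0) K (w, y)) - (\<lambda>v. dir_deriv (v, 0) K (x, y))) v)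
          = norm (\<Sum>b\<in>Basis. (v \<bullet> b) *\<^sub>R (dir_deriv (b, 0) K (w, y) - dir_deriv (b, 0) K (x, y)))"
          by (simp add: linear_dir_deriv_partial[OF K, of v] sum_subtractf right_diff_distrib)
        also have "\<dots> \<le> (\<Sum>b\<in>(Basis :: 'a set). norm v * e')"
        proof (rule sum_norm_le)
          fix b :: 'a assume b: "b \<in> Basis"
          have wr: "w \<in> cball x r" "dist w x < d b"
            using w \<delta>_le(1) \<delta>_le(2)[OF b] by (simp_all add: dist_commute)
          have "norm ((v \<bullet> b) *\<^sub>R (dir_deriv (b, 0) K (w, y) - dir_deriv (b, 0) K (x, y)))
             = \<bar>v \<bullet> b\<bar> * \<bar>dir_deriv (b, 0) K (w, y) - dir_deriv (b, 0) K (x, y)\<bar>" by (simp add: abs_mult)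
          also have "\<dots> \<le> norm v * e'"
            using d(2)[OF wr(1) y wr(2)] Basis_le_norm[OF b, of v] e' by (intro mult_mono) auto
          finally show "norm ((v \<bullet> b) *\<^sub>R (dir_deriv (b, 0) K (w, y) - dir_deriv (b, 0) K (x, y))) \<le> norm v * e'" .
        qed
        also have "\<dots> = n * e' * norm v" by (simp add: n_def)
        finally show "norm (((\<lambda>v. dir_deriv (v, 0) K (w, y)) - (\<lambda>v. dir_deriv (v, 0) K (x, y))) v) \<le> n * e' * norm v" .
      qed
    qed
    have "norm (kernel_integral f K z - kernel_integral f K x - kernel_integral f (dir_deriv (z - x, 0) K) x) \<le> e * norm (z - x)"
      if z: "norm (z - x) < \<delta>" for z
    proof -
      have zU: "z \<in> U" using z \<delta>_le(1) r(2) by (auto simp: dist_norm norm_minus_commute)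
      have "kernel_integral f K z - kernel_integral f K x - kernel_integral f (dir_deriv (z - x, 0) K) x
        = (\<integral>y. (K (z, y) - K (x, y) - dir_deriv (z - x, 0) K (x, y)) *\<^sub>R f y \<partial>lborel)"
        unfolding kernel_integral_def by (simp add: scaleR_diff_left int int')
      also have "norm \<dots> \<le> (\<integral>y. (norm (z - x) * (n * e')) * norm (indicator C y *\<^sub>R f y) \<partial>lborel)"
      proof (rule Bochner_Integration.integral_norm_bound_integral)
        show "integrable lborel (\<lambda>y. (K (z, y) - K (x, y) - dir_deriv (z - x, 0) K (x, y)) *\<^sub>R f y)"
          by (simp add: scaleR_diff_left int int')
        show "integrable lborel (\<lambda>y. norm (z - x) * (n * e') * norm (indicat_real C y *\<^sub>R f y))"
          by (intro integrable_mult_right integrable_norm loc UC(3))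
        fix y
        show "norm ((K (z, y) - K (x, y) - dir_deriv (z - x, 0) K (x, y)) *\<^sub>R f y)
          \<le> norm (z - x) * (n * e') * norm (indicat_real C y *\<^sub>R f y)"
        proof (cases "y \<in> C")
          case True
          then show ?thesis using mult_right_mono[OF est[OF z True] norm_ge_zero[of "f y"]] by simp
        next
          case False
          then show ?thesis using UC(4)[OF zU] UC(4,5)[OF UC(2)] by simp
        qed
      qed
      also have "\<dots> = (n * e' * A) * norm (z - x)" unfolding A_def by simp
      also have "\<dots> \<le> e * norm (z - x)"
      proof (rule mult_right_mono)
        have "n * e' * A \<le> n * e' * (A + 1)" using n e' by simp
        also have "\<dots> = e" using n A by (simp add: e'_def)
        finally show "n * e' * A \<le> e" .
      qed simp
      finally show ?thesis .
    qed
    with \<delta> show ?thesis by blast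
  qed
  then show ?thesis unfolding has_derivative_at_alt using bl by blast
qed

lemma smooth_kernel_integral:
  fixes f :: "'b::euclidean_space \<Rightarrow> 'c::euclidean_space" and K :: "'a::euclidean_space \<times> 'b \<Rightarrow> real"
  assumes loc: "\<And>C. compact C \<Longrightarrow> integrable lborel (\<lambda>y. indicator C y *\<^sub>R f y)"
    and K: "smooth K" and ps: "properly_supported K"
  shows "smooth (kernel_integral f K)"
proof -
  have "C_k k (kernel_integral f K)" if "smooth K" "properly_supported K" for k and K :: "'a \<times> 'b \<Rightarrow> real"
    using that
  proof (induction k arbitrary: K)
    case 0
    have "isCont (kernel_integral f K) x" for x
      by (rule has_derivative_continuous[OF kernel_integral_has_derivative[OF loc 0]])
    then show ?case by (simp add: continuous_on_eq_continuous_at)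
  next
    case (Suc k)
    have "(kernel_integral f K has_derivative (\<lambda>v. kernel_integral f (dir_deriv (v, 0) K) x)) (at x)" for x
      by (rule kernel_integral_has_derivative[OF loc Suc.prems])
    then show ?case
      by (rule C_k_SucI)
         (rule Suc.IH[OF smooth_dir_deriv[OF Suc.prems(1)] properly_supported_dir_deriv[OF Suc.prems(2)]])
  qed
  then show ?thesis using K ps by (simp add: smooth_def)
qed

lemma dir_deriv_kernel_integral:
  fixes f :: "'b::euclidean_space \<Rightarrow> 'c::euclidean_space" and K :: "'a::euclidean_space \<times> 'b \<Rightarrow> real"
  assumes "\<And>C. compact C \<Longrightarrow> integrable lborel (\<lambda>y. indicator C y *\<^sub>R f y)" "smooth K" "properly_supported K"
  shows "dir_deriv v (kernel_integral f K) = kernel_integral f (dir_deriv (v, 0) K)"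
  by (rule ext, rule dir_derivI, rule kernel_integral_has_derivative[OF assms])

lemma casimir_kernel_integral:
  fixes f :: "osc \<Rightarrow> spinor" and K :: "osc \<times> osc \<Rightarrow> real"
  assumes loc: "\<And>C. compact C \<Longrightarrow> integrable lborel (\<lambda>y. indicator C y *\<^sub>R f y)"
    and K: "smooth K" and ps: "properly_supported K"
  shows "casimir_op (kernel_integral f K) h = (\<integral>g. casimir_op (\<lambda>h. K (h, g)) h *\<^sub>R f g \<partial>lborel)"
proof -
  define P :: "osc \<Rightarrow> (osc \<times> osc \<Rightarrow> real) \<Rightarrow> osc \<times> osc \<Rightarrow> real" where "P v = dir_deriv (v, 0)" for v
  have P: "smooth (P v k)" "properly_supported (P v k)" if "smooth k" "properly_supported k" for v and k :: "osc \<times> osc \<Rightarrow> real"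
    using that by (simp_all add: P_def smooth_dir_deriv properly_supported_dir_deriv)
  have D: "dir_deriv v (kernel_integral f k) = kernel_integral f (P v k)" if "smooth k" "properly_supported k"
    for v and k :: "osc \<times> osc \<Rightarrow> real"
    unfolding P_def by (rule dir_deriv_kernel_integral[OF loc that])
  have Dp: "dir_deriv v (\<lambda>h. k (h, g)) = (\<lambda>h. P v k (h, g))" if "smooth k" for v g and k :: "osc \<times> osc \<Rightarrow> real"
    unfolding P_def by (rule ext, rule dir_derivI, rule dir_deriv_partial[OF that])
  have int: "integrable lborel (\<lambda>y. k (h, y) *\<^sub>R f y)" if "smooth k" "properly_supported k" for k :: "osc \<times> osc \<Rightarrow> real"
    by (rule kernel_integrable[OF loc smooth_continuous_on[OF that(1)] that(2)])
  have smg: "smooth (\<lambda>h. K (h, g))" for g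
    by (rule smooth_compose[OF K]) (intro smooth_intros)
  have smu: "smooth (kernel_integral f K)" by (rule smooth_kernel_integral[OF loc K ps])
  define c where "c = ((Re (fst h))\<^sup>2 + (Im (fst h))\<^sup>2) / 4"
  show ?thesis
    unfolding casimir_op_coordinates[OF smu] casimir_op_coordinates[OF smg] c_def[symmetric]
    by (simp add: D Dp P K ps kernel_integral_def scaleR_add_left scaleR_diff_left int flip: scaleR_scaleR)
qed

section \<open>Weak eigensections of the Casimir operator can be smoothed\<close>

definition test_function :: "(osc \<Rightarrow> 'b::real_normed_vector) \<Rightarrow> bool"
  where "test_function f \<longleftrightarrow> smooth f \<and> (\<exists>C. compact C \<and> (\<forall>g. g \<notin> C \<longrightarrow> f g = 0))"

lemma compact_osc_product: "compact A \<Longrightarrow> compact B \<Longrightarrow> compact ((\<lambda>p. fst p \<cdot> snd p) ` (A \<times> B))"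
  by (intro compact_continuous_image compact_Times continuous_intros)

lemma compact_osc_quotient: "compact A \<Longrightarrow> compact B \<Longrightarrow> compact ((\<lambda>p. fst p \<cdot> osc_inv (snd p)) ` (A \<times> B))"
  by (intro compact_continuous_image compact_Times continuous_intros)

lemma smooth_translate: "smooth f \<Longrightarrow> smooth (\<lambda>g. f (l \<cdot> g))"
  by (rule smooth_compose[where g=f]) (simp_all add: smooth_osc_mult[OF smooth_const smooth_id])

lemma casimir_op_sum:
  fixes f :: "'i \<Rightarrow> osc \<Rightarrow> 'b::real_normed_vector"
  assumes "finite J" "\<And>l. l \<in> J \<Longrightarrow> smooth (f l)"
  shows "casimir_op (\<lambda>g. \<Sum>l\<in>J. f l g) g = (\<Sum>l\<in>J. casimir_op (f l) g)"
proof -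
  have D: "left_deriv \<gamma> (\<lambda>g. \<Sum>l\<in>J. f l g) = (\<lambda>g. \<Sum>l\<in>J. left_deriv \<gamma> (f l) g)"
    if "one_parameter \<gamma>" "\<And>l. l \<in> J \<Longrightarrow> smooth (f l)" for \<gamma> and f :: "'i \<Rightarrow> osc \<Rightarrow> 'b"
  proof
    fix g
    show "left_deriv \<gamma> (\<lambda>g. \<Sum>l\<in>J. f l g) g = (\<Sum>l\<in>J. left_deriv \<gamma> (f l) g)"
      using assms(1) that(2)
    proof (induction J)
      case empty
      then show ?case by (simp add: left_deriv_def)
    next
      case (insert a J)
      then show ?case using left_deriv_add[OF that(1), of "f a" "\<lambda>g. \<Sum>l\<in>J. f l g" g]
        by (simp add: smooth_sum)
    qed
  qed
  show ?thesis
    by (simp add: casimir_op_def D one_parameter_exp assms(2) smooth_left_deriv sum.distrib scaleR_sum_right)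
qed

lemma casimir_op_outside:
  assumes "compact C" "\<And>g. g \<notin> C \<Longrightarrow> f g = 0" "g \<notin> C"
  shows "casimir_op f g = 0"
proof -
  have "casimir_op f g = casimir_op (\<lambda>g. 0) g"
    by (rule casimir_op_local[OF open_Compl[OF compact_imp_closed[OF assms(1)]]]) (simp_all add: assms)
  then show ?thesis by (simp add: casimir_op_def left_deriv_def)
qed

context osc_lattice
begin

text \<open>\<open>L\<close> acts properly discontinuously: such an \<open>l\<close> lies in the compact set \<open>C B\<^sup>-\<^sup>1\<close>.\<close>

lemma finite_returns:
  assumes "compact C" "compact B" shows "finite {l \<in> L. \<exists>g\<in>B. l \<cdot> g \<in> C}"
proof (rule finite_subset)
  show "finite (L \<inter> (\<lambda>p. fst p \<cdot> osc_inv (snd p)) ` (C \<times> B))"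
    by (rule finite_L_compact[OF compact_osc_quotient[OF assms]])
  show "{l \<in> L. \<exists>g\<in>B. l \<cdot> g \<in> C} \<subseteq> L \<inter> (\<lambda>p. fst p \<cdot> osc_inv (snd p)) ` (C \<times> B)"
  proof
    fix l assume "l \<in> {l \<in> L. \<exists>g\<in>B. l \<cdot> g \<in> C}"
    then obtain g where g: "l \<in> L" "g \<in> B" "l \<cdot> g \<in> C" by blast
    then have "l = (\<lambda>p. fst p \<cdot> osc_inv (snd p)) (l \<cdot> g, g)" by (simp add: osc_assoc)
    with g show "l \<in> L \<inter> (\<lambda>p. fst p \<cdot> osc_inv (snd p)) ` (C \<times> B)" by blast
  qed
qed

text \<open>The number of points that an orbit has in \<open>C\<close> is bounded. By unfolding, the integral over \<open>C\<close> is at most this bound times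
  the integral over the quotient.\<close>

lemma locally_integrable_L2:
  assumes \<zeta>: "\<zeta> \<in> L2" and C: "compact C"
  shows "integrable lborel (\<lambda>g. indicator C g *\<^sub>R \<zeta> g)"
proof -
  have [measurable]: "C \<in> sets borel" "\<zeta> \<in> borel_measurable borel"
    using C L2D(1)[OF \<zeta>] by (simp_all add: borel_compact)
  obtain K where K: "compact K" "\<And>g. \<exists>l\<in>L. l \<cdot> g \<in> K" using compact_representatives by blast
  define J where "J = {l \<in> L. \<exists>g\<in>K. l \<cdot> g \<in> C}"
  have J: "finite J" unfolding J_def by (rule finite_returns[OF C K(1)])
  have count: "(\<integral>\<^sup>+l. indicator C (l \<cdot> g) \<partial>count_space L) \<le> ennreal (real (card J))" for g
  proof -
    obtain k where k: "k \<in> L" "k \<cdot> g \<in> K" using K(2) by blast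
    let ?A = "{l \<in> L. l \<cdot> g \<in> C}"
    have inj: "inj_on (\<lambda>l. l \<cdot> osc_inv k) ?A"
    proof (rule inj_onI)
      fix a b assume "a \<cdot> osc_inv k = b \<cdot> osc_inv k"
      then have "(a \<cdot> osc_inv k) \<cdot> k = (b \<cdot> osc_inv k) \<cdot> k" by simp
      then show "a = b" by (simp add: osc_assoc)
    qed
    have im: "(\<lambda>l. l \<cdot> osc_inv k) ` ?A \<subseteq> J"
    proof
      fix m assume "m \<in> (\<lambda>l. l \<cdot> osc_inv k) ` ?A"
      then obtain l where l: "l \<in> L" "l \<cdot> g \<in> C" "m = l \<cdot> osc_inv k" by blast
      then have "m \<in> L" "m \<cdot> (k \<cdot> g) \<in> C" using k(1) by (simp_all add: mult_L inv_L osc_assoc)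
      then show "m \<in> J" unfolding J_def using k(2) by blast
    qed
    have fin: "finite ?A" by (rule finite_imageD[OF finite_subset[OF im J] inj])
    have "(\<integral>\<^sup>+l. indicator C (l \<cdot> g) \<partial>count_space L) = (\<Sum>l\<in>?A. indicator C (l \<cdot> g))"
      by (rule nn_integral_count_space'[OF fin]) simp_all
    also have "\<dots> = of_nat (card ?A)" by simp
    also have "\<dots> \<le> of_nat (card J)" using card_inj_on_le[OF inj im J] by simp
    finally show ?thesis by (simp add: ennreal_of_nat_eq_real_of_nat)
  qed
  have "(\<integral>\<^sup>+g. ennreal (norm (indicator C g *\<^sub>R \<zeta> g)) \<partial>lborel)
      = (\<integral>\<^sup>+g. (\<integral>\<^sup>+l. ennreal (norm (indicator C (l \<cdot> g) *\<^sub>R \<zeta> (l \<cdot> g))) \<partial>count_space L) \<partial>M)"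
    by (rule unfolding_nn) measurable
  also have "\<dots> = (\<integral>\<^sup>+g. (\<integral>\<^sup>+l. ennreal (norm (\<zeta> g)) * indicator C (l \<cdot> g) \<partial>count_space L) \<partial>M)"
  proof (intro nn_integral_cong)
    fix g l assume "l \<in> space (count_space L)"
    then have "norm (\<zeta> (l \<cdot> g)) = norm (\<zeta> g)" by (simp add: equi_norm[OF L2D(3)[OF \<zeta>]])
    then show "ennreal (norm (indicator C (l \<cdot> g) *\<^sub>R \<zeta> (l \<cdot> g))) = ennreal (norm (\<zeta> g)) * indicator C (l \<cdot> g)"
      by (simp split: split_indicator)
  qed
  also have "\<dots> = (\<integral>\<^sup>+g. ennreal (norm (\<zeta> g)) * (\<integral>\<^sup>+l. indicator C (l \<cdot> g) \<partial>count_space L) \<partial>M)"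
    by (intro nn_integral_cong nn_integral_cmult) simp
  also have "\<dots> \<le> (\<integral>\<^sup>+g. ennreal (norm (\<zeta> g)) * ennreal (real (card J)) \<partial>M)"
    by (intro nn_integral_mono mult_left_mono count) simp
  also have "\<dots> = (\<integral>\<^sup>+g. ennreal (norm (\<zeta> g)) \<partial>M) * ennreal (real (card J))"
    by (rule nn_integral_multc) (use L2D(2)[OF \<zeta>] in measurable)
  also have "\<dots> < \<infinity>"
    using integrable_norm_L2[OF \<zeta>] by (simp add: integrable_iff_bounded ennreal_mult_less_top)
  finally show ?thesis by (simp add: integrable_iff_bounded)
qed

lemma measurable_orbit_integral:
  fixes f :: "osc \<Rightarrow> ennreal"
  assumes [measurable]: "f \<in> borel_measurable borel"
  shows "(\<lambda>g. \<integral>\<^sup>+l. f (l \<cdot> g) \<partial>count_space L) \<in> borel_measurable M"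
proof -
  have [simp]: "sigma_finite_measure (count_space L)"
    by (rule sigma_finite_measure_count_space_countable[OF countable_L])
  have "(\<lambda>p. f (snd p \<cdot> fst p)) \<in> borel_measurable (borel \<Otimes>\<^sub>M count_space L)"
    by (rule measurable_compose_countable'[where g=snd and I=L and f="\<lambda>l p. f (l \<cdot> fst p)", OF _ _ countable_L]) measurable
  then have "(\<lambda>g. \<integral>\<^sup>+l. f (l \<cdot> g) \<partial>count_space L) \<in> borel_measurable borel"
    by (intro sigma_finite_measure.borel_measurable_nn_integral) (simp_all add: split_beta')
  then show ?thesis by (rule measurable_M)
qed

text \<open>The sum is over finite sets \<open>J g\<close> that contain all non-zero terms; the positive and the negative part of \<open>G\<close> are unfolded
  separately.\<close>

lemma unfolding_real:
  fixes G :: "osc \<Rightarrow> real"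
  assumes [measurable]: "G \<in> borel_measurable borel" and int: "integrable lborel G"
    and J: "\<And>g. finite (J g)" "\<And>g. J g \<subseteq> L" "\<And>g l. l \<in> L \<Longrightarrow> l \<notin> J g \<Longrightarrow> G (l \<cdot> g) = 0"
  shows "(\<integral>g. (\<Sum>l\<in>J g. G (l \<cdot> g)) \<partial>M) = (\<integral>g. G g \<partial>lborel)"
proof -
  define P where "P H g = (\<Sum>l\<in>J g. max 0 (H (l \<cdot> g)))" for H :: "osc \<Rightarrow> real" and g
  have P_nn: "P H g \<ge> 0" for H g by (simp add: P_def sum_nonneg)
  have P: "ennreal (P H g) = (\<integral>\<^sup>+l. ennreal (H (l \<cdot> g)) \<partial>count_space L)"
    if "\<And>g l. l \<in> L \<Longrightarrow> l \<notin> J g \<Longrightarrow> H (l \<cdot> g) = 0" for H g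
  proof -
    have "(\<integral>\<^sup>+l. ennreal (H (l \<cdot> g)) \<partial>count_space L) = (\<Sum>l\<in>J g. ennreal (H (l \<cdot> g)))"
      by (rule nn_integral_count_space'[OF J(1) _ J(2)]) (simp add: that)
    also have "\<dots> = (\<Sum>l\<in>J g. ennreal (max 0 (H (l \<cdot> g))))"
      by (intro sum.cong) (simp_all add: max_def ennreal_neg)
    also have "\<dots> = ennreal (P H g)" unfolding P_def by (rule sum_ennreal) simp
    finally show ?thesis ..
  qed
  have PM: "integrable M (P H) \<and> (\<integral>g. P H g \<partial>M) = enn2real (\<integral>\<^sup>+g. ennreal (H g) \<partial>lborel)"
    if [measurable]: "H \<in> borel_measurable borel" and H: "\<And>g l. l \<in> L \<Longrightarrow> l \<notin> J g \<Longrightarrow> H (l \<cdot> g) = 0"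
      and Hint: "integrable lborel H" for H
  proof -
    have P_H: "ennreal (P H g) = (\<integral>\<^sup>+l. ennreal (H (l \<cdot> g)) \<partial>count_space L)" for g
      by (rule P) (rule H)
    have fin: "(\<integral>\<^sup>+g. ennreal (H g) \<partial>lborel) < \<infinity>"
    proof -
      have "(\<integral>\<^sup>+g. ennreal (H g) \<partial>lborel) \<le> (\<integral>\<^sup>+g. ennreal (norm (H g)) \<partial>lborel)"
        by (intro nn_integral_mono) (simp add: ennreal_leI)
      then show ?thesis using Hint by (simp add: integrable_iff_bounded le_less_trans)
    qed
    have eq: "(\<integral>\<^sup>+g. ennreal (P H g) \<partial>M) = (\<integral>\<^sup>+g. ennreal (H g) \<partial>lborel)"
      unfolding P_H by (rule unfolding_nn[symmetric]) measurable
    have "(\<lambda>g. enn2real (ennreal (P H g))) \<in> borel_measurable M"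
      unfolding P_H using measurable_orbit_integral[of "\<lambda>g. ennreal (H g)"] by measurable
    then have m: "P H \<in> borel_measurable M" using P_nn by simp
    have "integrable M (P H)"
      unfolding integrable_iff_bounded using m eq fin P_nn by simp
    moreover have "(\<integral>g. P H g \<partial>M) = enn2real (\<integral>\<^sup>+g. ennreal (P H g) \<partial>M)"
      by (rule integral_eq_nn_integral) (use m P_nn in simp_all)
    ultimately show ?thesis using eq by simp
  qed
  have sum: "(\<Sum>l\<in>J g. G (l \<cdot> g)) = P G g - P (\<lambda>g. - G g) g" for g
    unfolding P_def sum_subtractf[symmetric] by (intro sum.cong) (auto simp: max_def)
  have 1: "integrable M (P G)" "(\<integral>g. P G g \<partial>M) = enn2real (\<integral>\<^sup>+g. ennreal (G g) \<partial>lborel)"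
    using PM[of G] int J(3) by simp_all
  have 2: "integrable M (P (\<lambda>g. - G g))" "(\<integral>g. P (\<lambda>g. - G g) g \<partial>M) = enn2real (\<integral>\<^sup>+g. ennreal (- G g) \<partial>lborel)"
    using PM[of "\<lambda>g. - G g"] int J(3) by simp_all
  show ?thesis
    unfolding sum using 1 2 by (simp add: real_lebesgue_integral_def[OF int])
qed

subsection \<open>Periodization\<close>

text \<open>The Poincare series of a test function. Only non-zero terms are listed, so that the sum is finite.\<close>

definition periodize :: "(osc \<Rightarrow> spinor) \<Rightarrow> osc \<Rightarrow> spinor"
  where "periodize f g = (\<Sum>l\<in>{l \<in> L. f (l \<cdot> g) \<noteq> 0}. s l *\<^sub>R f (l \<cdot> g))"

lemma periodize_eq:
  assumes "finite J" "J \<subseteq> L" "\<And>l. l \<in> L \<Longrightarrow> l \<notin> J \<Longrightarrow> f (l \<cdot> g) = 0"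
  shows "periodize f g = (\<Sum>l\<in>J. s l *\<^sub>R f (l \<cdot> g))"
  unfolding periodize_def
proof (rule sum.mono_neutral_left[OF assms(1)])
  show "{l \<in> L. f (l \<cdot> g) \<noteq> 0} \<subseteq> J"
  proof
    fix l assume "l \<in> {l \<in> L. f (l \<cdot> g) \<noteq> 0}"
    then show "l \<in> J" using assms(3)[of l] by (cases "l \<in> J") simp_all
  qed
  show "\<forall>l\<in>J - {l \<in> L. f (l \<cdot> g) \<noteq> 0}. s l *\<^sub>R f (l \<cdot> g) = 0"
  proof
    fix l assume "l \<in> J - {l \<in> L. f (l \<cdot> g) \<noteq> 0}"
    then have "f (l \<cdot> g) = 0" using assms(2) by blast
    then show "s l *\<^sub>R f (l \<cdot> g) = 0" by simp
  qed
qed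

lemma periodize_local:
  assumes C: "compact C" "\<And>g. g \<notin> C \<Longrightarrow> f g = 0"
  shows "\<exists>J. finite J \<and> J \<subseteq> L \<and> (\<forall>g\<in>ball p 1. periodize f g = (\<Sum>l\<in>J. s l *\<^sub>R f (l \<cdot> g)))
    \<and> (\<forall>g\<in>ball p 1. \<forall>l\<in>L. l \<notin> J \<longrightarrow> l \<cdot> g \<notin> C)"
proof -
  let ?J = "{l \<in> L. \<exists>g\<in>cball p 1. l \<cdot> g \<in> C}"
  have fin: "finite ?J" by (rule finite_returns[OF C(1) compact_cball])
  have out: "l \<cdot> g \<notin> C" if "g \<in> ball p 1" "l \<in> L" "l \<notin> ?J" for g l
    using that ball_subset_cball by blast
  have "periodize f g = (\<Sum>l\<in>?J. s l *\<^sub>R f (l \<cdot> g))" if "g \<in> ball p 1" for g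
  proof (rule periodize_eq[OF fin])
    fix l assume "l \<in> L" "l \<notin> ?J"
    then show "f (l \<cdot> g) = 0" by (rule C(2)[OF out[OF that]])
  qed simp
  with fin out show ?thesis by (intro exI[of _ ?J] conjI ballI impI) simp_all
qed

lemma periodize_equi: "equi (periodize f)"
  unfolding equi_def
proof (intro ballI allI)
  fix k g assume k: "k \<in> L"
  have "periodize f (k \<cdot> g) = (\<Sum>l\<in>{l \<in> L. f (l \<cdot> (k \<cdot> g)) \<noteq> 0}. s l *\<^sub>R f (l \<cdot> (k \<cdot> g)))"
    by (simp add: periodize_def)
  also have "\<dots> = (\<Sum>m\<in>{m \<in> L. f (m \<cdot> g) \<noteq> 0}. s k *\<^sub>R s m *\<^sub>R f (m \<cdot> g))"
  proof (rule sum.reindex_bij_witness[where i="\<lambda>m. m \<cdot> osc_inv k" and j="\<lambda>l. l \<cdot> k"])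
    fix l assume l: "l \<in> {l \<in> L. f (l \<cdot> (k \<cdot> g)) \<noteq> 0}"
    show "l \<cdot> k \<cdot> osc_inv k = l" by (simp add: osc_assoc)
    show "l \<cdot> k \<in> {m \<in> L. f (m \<cdot> g) \<noteq> 0}" using l k by (simp add: mult_L osc_assoc)
    have "s k * s (l \<cdot> k) = s l" using l k s_mult[of l k] s_square[OF k] by simp
    then show "s k *\<^sub>R s (l \<cdot> k) *\<^sub>R f (l \<cdot> k \<cdot> g) = s l *\<^sub>R f (l \<cdot> (k \<cdot> g))" by (simp add: osc_assoc)
  next
    fix m assume m: "m \<in> {m \<in> L. f (m \<cdot> g) \<noteq> 0}"
    show "m \<cdot> osc_inv k \<cdot> k = m" by (simp add: osc_assoc)
    show "m \<cdot> osc_inv k \<in> {l \<in> L. f (l \<cdot> (k \<cdot> g)) \<noteq> 0}" using m k by (simp add: mult_L inv_L osc_assoc)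
  qed
  also have "\<dots> = s k *\<^sub>R periodize f g" by (simp only: periodize_def scaleR_sum_right)
  finally show "periodize f (k \<cdot> g) = s k *\<^sub>R periodize f g" .
qed

lemma periodize_sections:
  assumes "test_function f" shows "periodize f \<in> sections"
proof -
  obtain C where C: "compact C" "\<And>g. g \<notin> C \<Longrightarrow> f g = 0" and f: "smooth f"
    using assms unfolding test_function_def by blast
  have "smooth (periodize f)"
  proof (rule smooth_local)
    fix g0
    from periodize_local[where C=C and f=f and p=g0, OF C]
    obtain J where "finite J \<and> J \<subseteq> L \<and> (\<forall>g\<in>ball g0 1. periodize f g = (\<Sum>l\<in>J. s l *\<^sub>R f (l \<cdot> g)))
      \<and> (\<forall>g\<in>ball g0 1. \<forall>l\<in>L. l \<notin> J \<longrightarrow> l \<cdot> g \<notin> C)" ..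
    then have J: "periodize f g = (\<Sum>l\<in>J. s l *\<^sub>R f (l \<cdot> g))" if "g \<in> ball g0 1" for g
      using that by blast
    show "\<exists>U h. open U \<and> g0 \<in> U \<and> smooth h \<and> (\<forall>g\<in>U. periodize f g = h g)"
      by (intro exI[of _ "ball g0 1"] exI[of _ "\<lambda>g. \<Sum>l\<in>J. s l *\<^sub>R f (l \<cdot> g)"] conjI ballI J
          smooth_sum smooth_scaleR smooth_const smooth_translate f) simp_all
  qed
  then show ?thesis using periodize_equi by (simp add: sections_def)
qed

lemma casimir_periodize:
  assumes "test_function f" shows "casimir_op (periodize f) = periodize (casimir_op f)"
proof
  fix g0
  obtain C where C: "compact C" "\<And>g. g \<notin> C \<Longrightarrow> f g = 0" and f: "smooth f"
    using assms unfolding test_function_def by blast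
  have cas0: "casimir_op f g = 0" if "g \<notin> C" for g
    by (rule casimir_op_outside[of C]) (use that C in blast)+
  from periodize_local[where C=C and f=f and p=g0, OF C]
  obtain J where "finite J \<and> J \<subseteq> L \<and> (\<forall>g\<in>ball g0 1. periodize f g = (\<Sum>l\<in>J. s l *\<^sub>R f (l \<cdot> g)))
    \<and> (\<forall>g\<in>ball g0 1. \<forall>l\<in>L. l \<notin> J \<longrightarrow> l \<cdot> g \<notin> C)" ..
  then have J: "finite J" "J \<subseteq> L" "\<And>g. g \<in> ball g0 1 \<Longrightarrow> periodize f g = (\<Sum>l\<in>J. s l *\<^sub>R f (l \<cdot> g))"
    and out: "\<And>l. l \<in> L \<Longrightarrow> l \<notin> J \<Longrightarrow> l \<cdot> g0 \<notin> C"
    by (blast, blast, blast, simp)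
  have "casimir_op (periodize f) g0 = casimir_op (\<lambda>g. \<Sum>l\<in>J. s l *\<^sub>R f (l \<cdot> g)) g0"
    by (rule casimir_op_local[of "ball g0 1"]) (use J(3) in simp_all)
  also have "\<dots> = (\<Sum>l\<in>J. casimir_op (\<lambda>g. s l *\<^sub>R f (l \<cdot> g)) g0)"
    by (rule casimir_op_sum[OF J(1)]) (intro smooth_scaleR smooth_const smooth_translate f)
  also have "\<dots> = (\<Sum>l\<in>J. s l *\<^sub>R casimir_op f (l \<cdot> g0))"
    by (simp only: casimir_op_bounded_linear[OF bounded_linear_scaleR_right smooth_translate[OF f]] casimir_op_translate)
  also have "\<dots> = periodize (casimir_op f) g0"
    by (rule periodize_eq[symmetric, OF J(1,2)]) (rule cas0, rule out)
  finally show "casimir_op (periodize f) g0 = periodize (casimir_op f) g0" .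
qed

lemma test_function_casimir: "test_function f \<Longrightarrow> test_function (casimir_op f)"
  unfolding test_function_def
proof (elim conjE exE)
  fix C assume f: "smooth f" and C: "compact C" "\<forall>g. g \<notin> C \<longrightarrow> f g = 0"
  have "casimir_op f g = 0" if "g \<notin> C" for g
    by (rule casimir_op_outside[of C]) (use that C in blast)+
  then show "smooth (casimir_op f) \<and> (\<exists>C. compact C \<and> (\<forall>g. g \<notin> C \<longrightarrow> casimir_op f g = 0))"
    using smooth_casimir_op[OF f] C(1) by blast
qed

text \<open>Through this identity, a weak equation on the quotient becomes a weak equation on the group, where convolution is available.\<close>

lemma ip_periodize:
  assumes \<zeta>: "\<zeta> \<in> L2" and f: "test_function f"
  shows "ip \<zeta> (periodize f) = (\<integral>g. \<zeta> g \<bullet> f g \<partial>lborel)"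
proof -
  obtain C where C: "compact C" "\<And>g. g \<notin> C \<Longrightarrow> f g = 0" and sm: "smooth f"
    using f unfolding test_function_def by blast
  have [measurable]: "\<zeta> \<in> borel_measurable borel" "f \<in> borel_measurable borel" "C \<in> sets borel"
    using L2D(1)[OF \<zeta>] smooth_borel_measurable[OF sm] C(1) by (simp_all add: borel_compact)
  have "bounded (f ` C)"
    by (intro compact_imp_bounded compact_continuous_image smooth_continuous_on sm C(1))
  then obtain B where B: "\<And>g. g \<in> C \<Longrightarrow> norm (f g) \<le> B" unfolding bounded_iff by blast
  have int: "integrable lborel (\<lambda>g. \<zeta> g \<bullet> f g)"
  proof (rule Bochner_Integration.integrable_bound)
    show "integrable lborel (\<lambda>g. B *\<^sub>R (indicator C g *\<^sub>R \<zeta> g))"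
      by (intro integrable_scaleR_right locally_integrable_L2 \<zeta> C(1))
    show "AE g in lborel. norm (\<zeta> g \<bullet> f g) \<le> norm (B *\<^sub>R (indicat_real C g *\<^sub>R \<zeta> g))"
    proof (rule AE_I2)
      fix g
      show "norm (\<zeta> g \<bullet> f g) \<le> norm (B *\<^sub>R (indicat_real C g *\<^sub>R \<zeta> g))"
      proof (cases "g \<in> C")
        case True
        have "norm (\<zeta> g \<bullet> f g) \<le> norm (\<zeta> g) * norm (f g)" using Cauchy_Schwarz_ineq2 by simp
        also have "\<dots> \<le> norm (\<zeta> g) * \<bar>B\<bar>" using B[OF True] by (intro mult_left_mono) auto
        finally show ?thesis using True by (simp add: mult.commute)
      qed (simp add: C(2))
    qed
  qed measurable
  let ?J = "\<lambda>g. {l \<in> L. l \<cdot> g \<in> C}"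
  have fin: "finite (?J g)" for g
    using finite_returns[OF C(1), of "{g}"] by simp
  have "(\<integral>g. (\<Sum>l\<in>?J g. \<zeta> (l \<cdot> g) \<bullet> f (l \<cdot> g)) \<partial>M) = (\<integral>g. \<zeta> g \<bullet> f g \<partial>lborel)"
    by (rule unfolding_real[OF _ int]) (use fin C(2) in auto)
  moreover have "(\<Sum>l\<in>?J g. \<zeta> (l \<cdot> g) \<bullet> f (l \<cdot> g)) = \<zeta> g \<bullet> periodize f g" for g
  proof -
    have "periodize f g = (\<Sum>l\<in>?J g. s l *\<^sub>R f (l \<cdot> g))"
      by (rule periodize_eq[OF fin]) (simp_all add: C(2))
    then show ?thesis
      by (simp add: inner_sum_right equiD[OF L2D(3)[OF \<zeta>]])
  qed
  ultimately show ?thesis by (simp add: ip_def)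
qed

end

subsection \<open>Vanishing almost everywhere\<close>

definition box_bump :: "osc \<Rightarrow> osc \<Rightarrow> real \<Rightarrow> osc \<Rightarrow> real"
  where "box_bump a b n g = (\<Prod>i\<in>Basis. flat (n * (g \<bullet> i - a \<bullet> i)) * flat (n * (b \<bullet> i - g \<bullet> i)))"

lemma smooth_box_bump: "smooth (box_bump a b n)"
  unfolding box_bump_def[abs_def]
  by (intro smooth_prod smooth_mult smooth_flat_compose smooth_diff smooth_inner smooth_const smooth_id)

lemma box_bump_nonneg: "0 \<le> box_bump a b n g" and box_bump_le_1: "box_bump a b n g \<le> 1"
  unfolding box_bump_def
  by (intro prod_nonneg prod_le_1 ballI conjI mult_nonneg_nonneg mult_le_one flat_nonneg flat_le_1)+

lemma box_bump_outside:
  assumes "n \<ge> 0" "g \<notin> box a b" shows "box_bump a b n g = 0"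
proof -
  obtain i where i: "i \<in> Basis" "g \<bullet> i \<le> a \<bullet> i \<or> b \<bullet> i \<le> g \<bullet> i"
    using assms(2) unfolding mem_box by (auto simp: not_less)
  then have "flat (n * (g \<bullet> i - a \<bullet> i)) * flat (n * (b \<bullet> i - g \<bullet> i)) = 0"
    using assms(1) by (auto simp: flat_def zero_less_mult_iff)
  then show ?thesis unfolding box_bump_def using i(1) by (intro prod_zero) auto
qed

lemma box_bump_tendsto: "(\<lambda>n. box_bump a b (real n) g) \<longlonglongrightarrow> indicator (box a b) g"
proof -
  have "(\<lambda>n. box_bump a b (real n) g) \<longlonglongrightarrow>
      (\<Prod>i\<in>Basis. indicator {0<..} (g \<bullet> i - a \<bullet> i) * indicator {0<..} (b \<bullet> i - g \<bullet> i))"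
    unfolding box_bump_def by (intro tendsto_prod tendsto_mult flat_tendsto_indicator)
  moreover have "(\<Prod>i\<in>Basis. indicator {0<..} (g \<bullet> i - a \<bullet> i) * indicator {0<..} (b \<bullet> i - g \<bullet> i)) = (indicator (box a b) g :: real)"
  proof (cases "g \<in> box a b")
    case True
    then show ?thesis by (simp add: mem_box)
  next
    case False
    then obtain i where i: "i \<in> Basis" "g \<bullet> i \<le> a \<bullet> i \<or> b \<bullet> i \<le> g \<bullet> i"
      unfolding mem_box by (auto simp: not_less)
    then have "indicator {0<..} (g \<bullet> i - a \<bullet> i) * indicator {0<..} (b \<bullet> i - g \<bullet> i) = (0::real)"
      by (auto simp: indicator_def)
    then have "(\<Prod>i\<in>Basis. indicator {0<..} (g \<bullet> i - a \<bullet> i) * indicator {0<..} (b \<bullet> i - g \<bullet> i)) = (0::real)"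
      using i(1) by (intro prod_zero) auto
    then show ?thesis using False by simp
  qed
  ultimately show ?thesis by simp
qed

lemma test_function_box_bump: assumes "n \<ge> 0" shows "test_function (box_bump a b n)"
  unfolding test_function_def
proof (intro conjI exI[of _ "cbox a b"] allI impI)
  fix g assume "g \<notin> cbox a b"
  then have "g \<notin> box a b" using box_subset_cbox by blast
  then show "box_bump a b n g = 0" by (rule box_bump_outside[OF assms])
qed (rule smooth_box_bump, rule compact_cbox)

text \<open>Indicators of boxes are bounded limits of test functions, and boxes generate the Borel sets.\<close>

lemma AE_zero_if_test_integrals_zero:
  fixes f :: "osc \<Rightarrow> 'c::euclidean_space"
  assumes [measurable]: "f \<in> borel_measurable borel"
    and loc: "\<And>C. compact C \<Longrightarrow> integrable lborel (\<lambda>g. indicator C g *\<^sub>R f g)"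
    and zero: "\<And>\<phi> :: osc \<Rightarrow> real. test_function \<phi> \<Longrightarrow> (\<integral>g. \<phi> g *\<^sub>R f g \<partial>lborel) = 0"
  shows "AE g in lborel. f g = 0"
proof -
  have int_box: "integrable lborel (\<lambda>g. indicator (box a b) g *\<^sub>R f g)" for a b
  proof (rule Bochner_Integration.integrable_bound[OF loc[OF compact_cbox[of a b]]])
    show "AE g in lborel. norm (indicat_real (box a b) g *\<^sub>R f g) \<le> norm (indicat_real (cbox a b) g *\<^sub>R f g)"
      using box_subset_cbox[of a b] by (intro AE_I2) (auto split: split_indicator)
  qed measurable
  have box: "(\<integral>g. indicator (box a b) g *\<^sub>R f g \<partial>lborel) = 0" for a b
  proof -
    have "(\<lambda>n. \<integral>g. box_bump a b (real n) g *\<^sub>R f g \<partial>lborel) \<longlonglongrightarrow> (\<integral>g. indicator (box a b) g *\<^sub>R f g \<partial>lborel)"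
    proof (rule integral_dominated_convergence[where w="\<lambda>g. norm (indicator (box a b) g *\<^sub>R f g)"])
      show "integrable lborel (\<lambda>g. norm (indicat_real (box a b) g *\<^sub>R f g))" by (rule integrable_norm[OF int_box])
      show "(\<lambda>g. box_bump a b (real n) g *\<^sub>R f g) \<in> borel_measurable lborel" for n
        using smooth_borel_measurable[OF smooth_box_bump, of a b "real n"] by measurable
      show "AE g in lborel. (\<lambda>n. box_bump a b (real n) g *\<^sub>R f g) \<longlonglongrightarrow> indicator (box a b) g *\<^sub>R f g"
        by (intro AE_I2 tendsto_scaleR box_bump_tendsto tendsto_const)
      show "AE g in lborel. norm (box_bump a b (real n) g *\<^sub>R f g) \<le> norm (indicator (box a b) g *\<^sub>R f g)" for n
      proof (rule AE_I2)
        fix g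
        show "norm (box_bump a b (real n) g *\<^sub>R f g) \<le> norm (indicator (box a b) g *\<^sub>R f g)"
          using box_bump_nonneg[of a b "real n" g] box_bump_le_1[of a b "real n" g] box_bump_outside[of "real n" g a b]
          by (cases "g \<in> box a b") (simp_all add: mult_left_le_one_le)
      qed
    qed measurable
    moreover have "(\<integral>g. box_bump a b (real n) g *\<^sub>R f g \<partial>lborel) = 0" for n
      by (rule zero[OF test_function_box_bump]) simp
    ultimately show ?thesis by (simp add: LIMSEQ_const_iff)
  qed
  have boxes_Int: "\<exists>m n. box a b \<inter> box c d = box m n" for a b c d :: osc
    unfolding box_Int_box by (intro exI) (rule refl)
  have "AE g in lborel. indicator (box (- (real N *\<^sub>R One)) (real N *\<^sub>R One)) g *\<^sub>R f g = 0" for N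
  proof (rule sigma_finite_measure.density_zero[OF sigma_finite_lborel int_box])
    define Q where "Q = box (- (real N *\<^sub>R One)) (real N *\<^sub>R One :: osc)"
    define fN where "fN g = indicator Q g *\<^sub>R f g" for g
    have int: "integrable lborel fN" unfolding fN_def[abs_def] Q_def by (rule int_box)
    have intA: "integrable lborel (\<lambda>g. indicator A g *\<^sub>R fN g)" if "A \<in> sets borel" for A
      by (rule integrable_mult_indicator[OF _ int]) (use that in simp)
    fix A assume "A \<in> sets (lborel :: osc measure)"
    then have mem: "A \<in> sigma_sets UNIV (range (\<lambda>(a, b). box a b :: osc set))"
      using borel_eq_box[where 'a=osc] by (metis sets_lborel sets_measure_of subset_UNIV Pow_UNIV)
    have stable: "Int_stable (range (\<lambda>(a, b). box a b :: osc set))"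
    proof (rule Int_stableI)
      fix a b assume "a \<in> range (\<lambda>(a, b). box a b :: osc set)" "b \<in> range (\<lambda>(a, b). box a b :: osc set)"
      then obtain x y where "a = (\<lambda>(a, b). box a b) x" "b = (\<lambda>(a, b). box a b) y" by (elim rangeE)
      then have "a = box (fst x) (snd x)" "b = box (fst y) (snd y)" by (simp_all only: split_beta)
      then obtain m n where "a \<inter> b = box m n" using boxes_Int by metis
      then show "a \<inter> b \<in> range (\<lambda>(a, b). box a b :: osc set)" by (intro range_eqI[of _ _ "(m, n)"]) simp
    qed
    have sub: "range (\<lambda>(a, b). box a b :: osc set) \<subseteq> Pow UNIV" by simp
    from stable sub mem have "(\<integral>g. indicator A g *\<^sub>R fN g \<partial>lborel) = 0"
    proof (induction rule: sigma_sets_induct_disjoint)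
      case (basic A)
      then obtain x where "A = (\<lambda>(a, b). box a b) x" by (elim rangeE)
      then have A: "A = box (fst x) (snd x)" by (simp only: split_beta)
      obtain c d where cd: "A \<inter> Q = box c d" unfolding A Q_def using boxes_Int by metis
      have "indicator A g *\<^sub>R fN g = indicator (box c d) g *\<^sub>R f g" for g
        unfolding fN_def cd[symmetric] by (simp add: indicator_inter_arith)
      then show ?case by (simp add: box)
    next
      case empty
      show ?case by simp
    next
      case (compl A)
      then have A: "A \<in> sets borel" using borel_eq_box[where 'a=osc] by (metis sets_measure_of subset_UNIV Pow_UNIV)
      have "(\<integral>g. indicator (UNIV - A) g *\<^sub>R fN g \<partial>lborel) = (\<integral>g. fN g - indicator A g *\<^sub>R fN g \<partial>lborel)"
        by (intro Bochner_Integration.integral_cong) (auto split: split_indicator)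
      also have "\<dots> = (\<integral>g. fN g \<partial>lborel) - 0"
        by (simp only: Bochner_Integration.integral_diff[OF int intA[OF A]] compl.IH)
      also have "(\<integral>g. fN g \<partial>lborel) = 0" unfolding fN_def Q_def by (rule box)
      finally show ?case by simp
    next
      case (union A)
      have A: "A i \<in> sets borel" for i
        using union(2) borel_eq_box[where 'a=osc] by (metis range_subsetD sets_measure_of subset_UNIV Pow_UNIV)
      have "set_integrable lborel (\<Union>i. A i) fN"
        unfolding set_integrable_def by (rule intA) (use A in blast)
      then have "(LINT g:(\<Union>i. A i)|lborel. fN g) = (\<Sum>i. LINT g:A i|lborel. fN g)"
        using A union(1) by (intro lebesgue_integral_countable_add) (auto simp: disjoint_family_on_def)
      then show ?case using union.IH by (simp add: set_lebesgue_integral_def)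
    qed
    then show "set_lebesgue_integral lborel A (\<lambda>g. indicat_real (box (- (real N *\<^sub>R One)) (real N *\<^sub>R One)) g *\<^sub>R f g) = 0"
      by (simp add: set_lebesgue_integral_def fN_def Q_def)
  qed
  then have "AE g in lborel. \<forall>N::nat. indicator (box (- (real N *\<^sub>R One)) (real N *\<^sub>R One)) g *\<^sub>R f g = 0"
    by (subst AE_all_countable) blast
  then show ?thesis
  proof eventually_elim
    case (elim g)
    obtain N :: nat where "g \<in> box (- (real N *\<^sub>R One)) (real N *\<^sub>R One)"
      using UN_box_eq_UNIV[where 'a=osc] by blast
    then show ?case using spec[OF elim, of N] by simp
  qed
qed

lemma inner_vector_scalar: "x \<bullet> (c *s y) = (cnj c *s x) \<bullet> (y :: spinor)"
  by (simp add: inner_vec_def inner_complex_def algebra_simps)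

lemma test_function_scaleR:
  assumes "test_function \<phi>" shows "test_function (\<lambda>g. \<phi> g *\<^sub>R v)"
proof -
  obtain C where "compact C" "\<forall>g. g \<notin> C \<longrightarrow> \<phi> g = 0" and \<phi>: "smooth \<phi>"
    using assms unfolding test_function_def by blast
  then have "compact C \<and> (\<forall>g. g \<notin> C \<longrightarrow> \<phi> g *\<^sub>R v = 0)" by simp
  then show ?thesis unfolding test_function_def using smooth_scaleR[OF \<phi> smooth_const] by blast
qed

context osc_lattice
begin

lemma l2_norm_zero_if_AE_zero:
  assumes "\<zeta> \<in> L2" "AE g in lborel. \<zeta> g = 0" shows "l2_norm L \<zeta> = 0"
proof -
  have "ip \<zeta> \<zeta> = (\<integral>g. indicator fund_dom g *\<^sub>R (\<zeta> g \<bullet> \<zeta> g) \<partial>lborel)"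
    unfolding ip_def M_eq by (rule integral_restrict_space) simp
  also have "\<dots> = 0"
    by (rule integral_eq_zero_AE) (use assms(2) in \<open>auto elim: eventually_mono\<close>)
  finally show ?thesis by (simp add: l2_norm_eq)
qed

text \<open>If the norm is zero, unfolding shows that \<open>u\<close> vanishes almost everywhere on the group, but a non-empty open set is not a
  null set.\<close>

lemma l2_norm_nonzero:
  assumes u: "u \<in> sections" and nz: "u p \<noteq> 0" shows "l2_norm L u \<noteq> 0"
proof
  assume "l2_norm L u = 0"
  then have ip0: "(\<integral>g. (norm (u g))\<^sup>2 \<partial>M) = 0" by (simp add: l2_norm_def)
  have sm: "smooth u" "equi u" using u by (simp_all add: sections_def)
  have [measurable]: "u \<in> borel_measurable borel" by (rule smooth_borel_measurable[OF sm(1)])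
  have ae: "AE g in M. (norm (u g))\<^sup>2 = 0"
    using integral_nonneg_eq_0_iff_AE[OF L2D(4)[OF sections_L2[OF u]]] ip0 by simp
  have "(\<integral>\<^sup>+g. ennreal (norm (u g)) \<partial>lborel) = (\<integral>\<^sup>+g. (\<integral>\<^sup>+l. ennreal (norm (u (l \<cdot> g))) \<partial>count_space L) \<partial>M)"
    by (rule unfolding_nn) measurable
  also have "\<dots> = (\<integral>\<^sup>+g. 0 \<partial>M)"
  proof (rule nn_integral_cong_AE)
    show "AE g in M. (\<integral>\<^sup>+l. ennreal (norm (u (l \<cdot> g))) \<partial>count_space L) = 0"
      using ae
    proof eventually_elim
      case (elim g)
      have "(\<integral>\<^sup>+l. ennreal (norm (u (l \<cdot> g))) \<partial>count_space L) = (\<integral>\<^sup>+l. 0 \<partial>count_space L)"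
        by (rule nn_integral_cong) (use elim in \<open>simp add: equi_norm[OF sm(2)]\<close>)
      then show ?case by simp
    qed
  qed
  finally have "AE g in lborel. ennreal (norm (u g)) = 0"
    by (subst nn_integral_0_iff_AE[symmetric]) simp_all
  then have "AE g in lborel. u g = 0" by simp
  then have null: "{g. u g \<noteq> 0} \<in> null_sets lborel"
    by (subst (asm) AE_iff_null) simp_all
  have "open {g. u g \<noteq> 0}"
    using open_Collect_neq[OF smooth_continuous_on[OF sm(1)] continuous_on_const] .
  moreover have "{g. u g \<noteq> 0} \<noteq> {}" using nz by blast
  ultimately have "\<not> negligible {g. u g \<noteq> 0}" by (rule open_not_negligible)
  then show False using null null_sets_completionI[OF null] by (simp add: negligible_iff_null_sets)
qed

text \<open>The section \<open>u(h) = \<integral> \<phi>(h\<^sup>-\<^sup>1 g) \<zeta>(g) dg\<close> is smooth. Applying the Casimir operator in \<open>h\<close> to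
  the kernel gives the same as applying it in \<open>g\<close>, where it can be moved to \<open>\<zeta>\<close>. The value of \<open>u\<close> at the identity is the
  integral of \<open>\<phi> \<zeta>\<close>, which is non-zero for some test function \<open>\<phi>\<close>. The conjugate of \<open>c\<close> arises because \<open>c\<close> stands
  on the side of the test section.\<close>

lemma smooth_eigensection_of_weak:
  assumes \<zeta>: "\<zeta> \<in> L2" and nz: "l2_norm L \<zeta> \<noteq> 0"
    and weak: "\<And>f. f \<in> sections \<Longrightarrow> ip \<zeta> (casimir_op f) = ip \<zeta> (\<lambda>g. c *s f g)"
  obtains u where "u \<in> sections" "l2_norm L u \<noteq> 0" "\<And>g. casimir_op u g = cnj c *s u g"
proof -
  have [measurable]: "\<zeta> \<in> borel_measurable borel" by (rule L2D(1)[OF \<zeta>])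
  note loc = locally_integrable_L2[OF \<zeta>]
  have "\<exists>\<phi> :: osc \<Rightarrow> real. test_function \<phi> \<and> (\<integral>g. \<phi> g *\<^sub>R \<zeta> g \<partial>lborel) \<noteq> 0"
  proof (rule ccontr)
    assume no: "\<not> ?thesis"
    have "AE g in lborel. \<zeta> g = 0"
    proof (rule AE_zero_if_test_integrals_zero)
      show "\<zeta> \<in> borel_measurable borel" by measurable
      show "integrable lborel (\<lambda>g. indicat_real C g *\<^sub>R \<zeta> g)" if "compact C" for C by (rule loc[OF that])
      show "(\<integral>g. \<phi> g *\<^sub>R \<zeta> g \<partial>lborel) = 0" if "test_function \<phi>" for \<phi> :: "osc \<Rightarrow> real"
        using no that by blast
    qed
    then show False using l2_norm_zero_if_AE_zero[OF \<zeta>] nz by simp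
  qed
  then obtain \<phi> :: "osc \<Rightarrow> real" where \<phi>: "test_function \<phi>" and \<phi>_nz: "(\<integral>g. \<phi> g *\<^sub>R \<zeta> g \<partial>lborel) \<noteq> 0"
    by blast
  then obtain C where sm\<phi>: "smooth \<phi>" and C: "compact C" "\<And>g. g \<notin> C \<Longrightarrow> \<phi> g = 0"
    unfolding test_function_def by blast
  define K where "K p = \<phi> (osc_inv (fst p) \<cdot> snd p)" for p :: "osc \<times> osc"
  have K: "smooth K" unfolding K_def[abs_def] by (rule smooth_compose[OF sm\<phi>]) (intro smooth_intros)
  have Kh: "test_function (\<lambda>g. K (h, g))" for h
  proof -
    have "smooth (\<lambda>g. K (h, g))" by (rule smooth_compose[OF K]) (intro smooth_intros)
    moreover have "compact ((\<lambda>p. fst p \<cdot> snd p) ` ({h} \<times> C))" by (rule compact_osc_product) (simp_all add: C)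
    moreover have "K (h, g) = 0" if "g \<notin> (\<lambda>p. fst p \<cdot> snd p) ` ({h} \<times> C)" for g
    proof -
      have "osc_inv h \<cdot> g \<notin> C"
      proof
        assume "osc_inv h \<cdot> g \<in> C"
        then have "(h, osc_inv h \<cdot> g) \<in> {h} \<times> C" by simp
        from imageI[OF this, of "\<lambda>p. fst p \<cdot> snd p"] that show False by simp
      qed
      then show ?thesis by (simp add: K_def C(2))
    qed
    ultimately show ?thesis unfolding test_function_def by blast
  qed
  have ps: "properly_supported K"
    unfolding properly_supported_def
  proof
    fix h0
    let ?C = "(\<lambda>p. fst p \<cdot> snd p) ` (cball h0 1 \<times> C)"
    have "compact ?C" by (rule compact_osc_product) (simp_all add: C)
    moreover have "K (h, g) = 0" if "h \<in> ball h0 1" "g \<notin> ?C" for h g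
    proof -
      have "osc_inv h \<cdot> g \<notin> C"
      proof
        assume "osc_inv h \<cdot> g \<in> C"
        then have "(h, osc_inv h \<cdot> g) \<in> cball h0 1 \<times> C" using that(1) ball_subset_cball by blast
        from imageI[OF this, of "\<lambda>p. fst p \<cdot> snd p"] that(2) show False by simp
      qed
      then show ?thesis by (simp add: K_def C(2))
    qed
    moreover have "open (ball h0 1)" "h0 \<in> ball h0 1" by simp_all
    ultimately show "\<exists>U C. open U \<and> h0 \<in> U \<and> compact C \<and> (\<forall>h\<in>U. \<forall>g. g \<notin> C \<longrightarrow> K (h, g) = 0)" by blast
  qed
  define u where "u = kernel_integral \<zeta> K"
  have "smooth u" unfolding u_def by (rule smooth_kernel_integral[OF loc K ps])
  moreover have "equi u"
    unfolding equi_def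
  proof (intro ballI allI)
    fix l h assume l: "l \<in> L"
    have [measurable]: "K \<in> borel_measurable borel" by (rule smooth_borel_measurable[OF K])
    have "u (l \<cdot> h) = (\<integral>g. K (l \<cdot> h, l \<cdot> g) *\<^sub>R \<zeta> (l \<cdot> g) \<partial>lborel)"
      unfolding u_def kernel_integral_def
      by (rule integral_osc_mult_left[OF cis_lattice[OF l], symmetric]) measurable
    also have "\<dots> = (\<integral>g. s l *\<^sub>R (K (h, g) *\<^sub>R \<zeta> g) \<partial>lborel)"
      by (simp add: K_def osc_inv_mult osc_assoc equiD[OF L2D(3)[OF \<zeta>] l] mult.commute)
    also have "\<dots> = s l *\<^sub>R u h" by (simp add: u_def kernel_integral_def del: scaleR_scaleR)
    finally show "u (l \<cdot> h) = s l *\<^sub>R u h" .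
  qed
  ultimately have u: "u \<in> sections" by (simp add: sections_def)
  have "u osc_one = (\<integral>g. \<phi> g *\<^sub>R \<zeta> g \<partial>lborel)"
    unfolding u_def kernel_integral_def K_def by (simp add: osc_inv_unique[of osc_one osc_one])
  then have "l2_norm L u \<noteq> 0" using \<phi>_nz by (intro l2_norm_nonzero[OF u, of osc_one]) simp
  moreover have "casimir_op u h = cnj c *s u h" for h
  proof -
    define k where "k = (\<lambda>g. K (h, g))"
    have k: "test_function k" unfolding k_def by (rule Kh)
    have smk: "smooth k" using k by (simp add: test_function_def)
    have kern: "casimir_op (\<lambda>h. K (h, g)) h = casimir_op k g" for g
      unfolding k_def K_def fst_conv snd_conv casimir_op_inverse[OF sm\<phi>] casimir_op_translate ..
    have int: "integrable lborel (\<lambda>g. k' g *\<^sub>R \<zeta> g)" if k': "test_function k'" for k' :: "osc \<Rightarrow> real"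
    proof -
      obtain C' where C': "compact C'" "\<And>g. g \<notin> C' \<Longrightarrow> k' g = 0" and smk': "smooth k'"
        using k' unfolding test_function_def by blast
      have "properly_supported (\<lambda>p :: osc \<times> osc. k' (snd p))"
        unfolding properly_supported_def
      proof
        fix h :: osc
        show "\<exists>U C. open U \<and> h \<in> U \<and> compact C \<and> (\<forall>x\<in>U. \<forall>y. y \<notin> C \<longrightarrow> k' (snd (x, y)) = 0)"
          by (intro exI[of _ UNIV] exI[of _ C'] conjI ballI allI impI) (simp_all add: C')
      qed
      moreover have "continuous_on UNIV (\<lambda>p :: osc \<times> osc. k' (snd p))"
        by (rule continuous_on_compose2[OF smooth_continuous_on[OF smk', of UNIV]]) (auto intro!: continuous_intros)
      ultimately have "integrable lborel (\<lambda>y. (\<lambda>p :: osc \<times> osc. k' (snd p)) (osc_one, y) *\<^sub>R \<zeta> y)"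
        by (intro kernel_integrable loc)
      then show ?thesis by simp
    qed
    have "casimir_op u h = (\<integral>g. casimir_op k g *\<^sub>R \<zeta> g \<partial>lborel)"
    proof -
      have "casimir_op u h = (\<integral>g. casimir_op (\<lambda>h. K (h, g)) h *\<^sub>R \<zeta> g \<partial>lborel)"
        unfolding u_def by (rule casimir_kernel_integral[OF loc K ps])
      then show ?thesis unfolding kern .
    qed
    moreover have "(\<integral>g. casimir_op k g *\<^sub>R \<zeta> g \<partial>lborel) \<bullet> v = (cnj c *s u h) \<bullet> v" for v
    proof -
      let ?f = "\<lambda>g. k g *\<^sub>R v"
      have f: "test_function ?f" by (rule test_function_scaleR[OF k])
      have fc: "test_function (\<lambda>g. k g *\<^sub>R (c *s v))" by (rule test_function_scaleR[OF k])
      have kc: "test_function (casimir_op k)" by (rule test_function_casimir[OF k])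
      have cas_f: "casimir_op ?f = (\<lambda>g. casimir_op k g *\<^sub>R v)"
        by (rule ext, rule casimir_op_bounded_linear[OF bounded_linear_scaleR_left smk])
      have per_c: "(\<lambda>g. c *s periodize ?f g) = periodize (\<lambda>g. k g *\<^sub>R (c *s v))"
      proof
        fix g
        obtain C' where C': "compact C'" "\<And>g. g \<notin> C' \<Longrightarrow> k g = 0"
          using k unfolding test_function_def by blast
        have fin: "finite {l \<in> L. l \<cdot> g \<in> C'}" using finite_returns[OF C'(1), of "{g}"] by simp
        have 1: "periodize ?f g = (\<Sum>l\<in>{l \<in> L. l \<cdot> g \<in> C'}. s l *\<^sub>R ?f (l \<cdot> g))"
          by (rule periodize_eq[OF fin]) (simp_all add: C'(2))
        have 2: "periodize (\<lambda>g. k g *\<^sub>R (c *s v)) g = (\<Sum>l\<in>{l \<in> L. l \<cdot> g \<in> C'}. s l *\<^sub>R (k (l \<cdot> g) *\<^sub>R (c *s v)))"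
          by (rule periodize_eq[OF fin]) (simp_all add: C'(2))
        interpret linear "\<lambda>v :: spinor. c *s v" by (rule bounded_linear.linear[OF bounded_linear_vector_scalar])
        show "c *s periodize ?f g = periodize (\<lambda>g. k g *\<^sub>R (c *s v)) g"
          unfolding 1 2 sum scale ..
      qed
      have "(\<integral>g. casimir_op k g *\<^sub>R \<zeta> g \<partial>lborel) \<bullet> v = (\<integral>g. (casimir_op k g *\<^sub>R \<zeta> g) \<bullet> v \<partial>lborel)"
        by (rule integral_inner_left[symmetric]) (rule int[OF kc])
      also have "\<dots> = (\<integral>g. \<zeta> g \<bullet> casimir_op ?f g \<partial>lborel)" by (simp add: cas_f)
      also have "\<dots> = ip \<zeta> (casimir_op (periodize ?f))"
        unfolding casimir_periodize[OF f] by (rule ip_periodize[OF \<zeta> test_function_casimir[OF f], symmetric])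
      also have "\<dots> = ip \<zeta> (periodize (\<lambda>g. k g *\<^sub>R (c *s v)))"
        unfolding weak[OF periodize_sections[OF f]] per_c ..
      also have "\<dots> = (\<integral>g. \<zeta> g \<bullet> (k g *\<^sub>R (c *s v)) \<partial>lborel)" by (rule ip_periodize[OF \<zeta> fc])
      also have "\<dots> = (\<integral>g. (k g *\<^sub>R \<zeta> g) \<bullet> (c *s v) \<partial>lborel)" by simp
      also have "\<dots> = u h \<bullet> (c *s v)"
        unfolding u_def kernel_integral_def k_def[symmetric]
        by (subst integral_inner_left) (simp_all add: int[OF k] k_def int[OF Kh])
      finally show ?thesis by (simp add: inner_vector_scalar)
    qed
    ultimately have "casimir_op u h \<bullet> v = (cnj c *s u h) \<bullet> v" for v by simp
    then show ?thesis using vector_eq_rdot by blast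
  qed
  ultimately show ?thesis using u that by blast
qed

end

section \<open>Eigensections of the Dirac and of the Casimir operator\<close>

lemma inner_vector_scalar_same: "(a *s x) \<bullet> (b *s x) = Re (cnj a * b) * (x \<bullet> (x :: spinor))"
  by (simp add: inner_vec_def inner_complex_def sum_distrib_left algebra_simps)

lemma casimir_op_vector_scalar: "smooth u \<Longrightarrow> casimir_op (\<lambda>g. c *s u g) g = c *s casimir_op u g"
  for u :: "osc \<Rightarrow> spinor"
  by (rule casimir_op_bounded_linear[OF bounded_linear_vector_scalar])

lemma dirac_vector_scalar:
  assumes "smooth u" shows "dirac (\<lambda>g. c *s u g) g = c *s dirac u g"
proof -
  have D: "left_deriv \<gamma> (\<lambda>g. c *s u g) g = c *s left_deriv \<gamma> u g" if "one_parameter \<gamma>" for \<gamma>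
    by (rule left_deriv_bounded_linear[OF bounded_linear_vector_scalar that assms])
  have M: "A *v (c *s x) = c *s (A *v x)" for A :: "complex ^ 4 ^ 4" and x
    by (simp add: matrix_vector_mult_def vec_eq_iff sum_distrib_left mult_ac)
  have S: "(1/2) *\<^sub>R (c *s x) = c *s ((1/2) *\<^sub>R x)" for x :: spinor by (simp add: vec_eq_iff)
  interpret linear "\<lambda>x :: spinor. c *s x" by (rule bounded_linear.linear[OF bounded_linear_vector_scalar])
  show ?thesis unfolding dirac_eq by (simp only: D M S one_parameter_exp add)
qed

lemma dirac_add:
  assumes "smooth u" "smooth v"
  shows "dirac (\<lambda>g. u g + v g) g = dirac u g + dirac v g"
  unfolding dirac_eq
  by (simp add: left_deriv_add assms one_parameter_exp matrix_vector_right_distrib scaleR_add_right)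

context osc_lattice
begin

text \<open>By symmetry, the real products of \<open>i u\<close> with \<open>\<Omega> u\<close> and of \<open>\<Omega> (i u)\<close> with \<open>u\<close> agree; they are \<open>Im c\<close> and \<open>- Im c\<close> times
  the squared norm of \<open>u\<close>.\<close>

lemma casimir_eigenvalue_real:
  assumes u: "u \<in> sections" "l2_norm L u \<noteq> 0" and eig: "\<And>g. casimir_op u g = c *s u g"
  shows "cnj c = c"
proof -
  have sm: "smooth u" using u(1) by (simp add: sections_def)
  have "ip (\<lambda>g. \<i> *s u g) (casimir_op u) = ip (casimir_op (\<lambda>g. \<i> *s u g)) u"
    by (rule casimir_symmetric[OF sections_vector_scalar[OF u(1)] u(1)])
  moreover have "ip (\<lambda>g. \<i> *s u g) (casimir_op u) = Im c * ip u u"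
    unfolding ip_def eig inner_vector_scalar_same by simp
  moreover have "ip (casimir_op (\<lambda>g. \<i> *s u g)) u = - Im c * ip u u"
    unfolding ip_def casimir_op_vector_scalar[OF sm] eig
    using inner_vector_scalar_same[of "\<i> * c" _ 1] by simp
  ultimately have "Im c = 0" using u(2) by (simp add: l2_norm_eq)
  then show ?thesis by (simp add: complex_eq_iff)
qed

text \<open>If \<open>-\<Omega>\<close> has the eigenvalue \<open>\<nu>\<^sup>2\<close>, then \<open>D + \<nu>\<close> maps the eigenspace into the kernel of \<open>D - \<nu>\<close>. It does not
  vanish there for \<open>\<nu> \<noteq> 0\<close>: the eigenspace contains a section of the form \<open>f u\<^sub>2\<close>, and the component of \<open>D (f u\<^sub>2)\<close>
  along \<open>u\<^sub>2\<close> is zero. For \<open>\<nu> = 0\<close>, either \<open>D u\<close> is non-zero and in the kernel of \<open>D\<close>, or \<open>u\<close> itself is in the kernel.\<close>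

lemma dirac_eigensection_of_casimir:
  assumes u: "u \<in> sections" "u p \<noteq> 0" and eig: "\<And>g. casimir_op u g = - (\<nu>\<^sup>2) *s u g"
  obtains \<psi> q where "\<psi> \<in> sections" "\<psi> q \<noteq> 0" "\<And>g. dirac \<psi> g = \<nu> *s \<psi> g"
proof (cases "\<nu> = 0")
  case True
  have sm: "smooth u" using u(1) by (simp add: sections_def)
  have sq: "dirac (dirac u) g = 0" for g using dirac_square[OF sm, of g] eig[of g] True by simp
  show ?thesis
  proof (cases "\<exists>q. dirac u q \<noteq> 0")
    case True
    then obtain q where "dirac u q \<noteq> 0" ..
    then show ?thesis using that[OF sections_dirac[OF u(1)]] sq \<open>\<nu> = 0\<close> by simp
  next
    case False
    then have "dirac u g = \<nu> *s u g" for g using \<open>\<nu> = 0\<close> by (metis vector_smult_lzero)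
    then show ?thesis by (rule that[OF u])
  qed
next
  case False
  obtain k where k: "u p $ k \<noteq> 0" using u(2) by (auto simp: vec_eq_iff)
  \<comment> \<open>\<open>\<Omega>\<close> acts on each component of \<open>u\<close>, so a non-zero component may be put along \<open>u\<^sub>2\<close>\<close>
  define B :: "spinor \<Rightarrow> spinor" where "B x = (\<chi> i. if i = 2 then x $ k else 0)" for x
  have "linear B" unfolding B_def by (rule linearI) (simp_all add: vec_eq_iff)
  then have B: "bounded_linear B" by (simp add: linear_conv_bounded_linear)
  have B_scalar: "B (c *s x) = c *s B x" for c x by (simp add: B_def vec_eq_iff)
  define w where "w g = B (u g)" for g
  have sm: "smooth u" using u(1) by (simp add: sections_def)
  have w: "w \<in> sections" unfolding w_def[abs_def] by (rule sections_bounded_linear[OF B u(1)])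
  then have smw: "smooth w" by (simp add: sections_def)
  have cas_w: "casimir_op w g = - (\<nu>\<^sup>2) *s w g" for g
    unfolding w_def[abs_def] casimir_op_bounded_linear[OF B sm] eig B_scalar ..
  have D: "left_deriv \<gamma> w g = B (left_deriv \<gamma> u g)" if "one_parameter \<gamma>" for \<gamma> g
    unfolding w_def[abs_def] by (rule left_deriv_bounded_linear[OF B that sm])
  have comp2: "dirac w g $ 2 = 0" for g
    unfolding dirac_eq by (simp add: D one_parameter_exp w_def B_def matrix_vector_mult_def matrix_matrix_mult_def sum_4
        cliff_X_def cliff_Y_def cliff_Z_def cliff_T_def)
  define \<psi> where "\<psi> g = dirac w g + \<nu> *s w g" for g
  have "\<psi> \<in> sections" unfolding \<psi>_def[abs_def] by (intro sections_add sections_dirac sections_vector_scalar w)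
  moreover have "\<psi> p \<noteq> 0"
  proof
    assume "\<psi> p = 0"
    then have "\<psi> p $ 2 = 0" by simp
    then show False using comp2[of p] k False by (simp add: \<psi>_def w_def B_def)
  qed
  moreover have "dirac \<psi> g = \<nu> *s \<psi> g" for g
  proof -
    have "dirac \<psi> g = dirac (dirac w) g + \<nu> *s dirac w g"
      unfolding \<psi>_def[abs_def]
      using dirac_add[OF smooth_dirac[OF smw] smooth_bounded_linear[OF bounded_linear_vector_scalar smw]]
        dirac_vector_scalar[OF smw] by simp
    also have "dirac (dirac w) g = \<nu>\<^sup>2 *s w g" unfolding dirac_square[OF smw] cas_w by (simp add: vec_eq_iff)
    also have "\<nu>\<^sup>2 *s w g + \<nu> *s dirac w g = \<nu> *s \<psi> g"
      by (simp add: \<psi>_def vec_eq_iff power2_eq_square algebra_simps)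
    finally show ?thesis .
  qed
  ultimately show ?thesis by (rule that)
qed

definition closed_dirac :: "((osc \<Rightarrow> spinor) \<times> (osc \<Rightarrow> spinor)) set"
  where "closed_dirac = graph_closure L2 (l2_norm L) {(\<psi>, dirac \<psi>) |\<psi>. \<psi> \<in> sections}"

definition closed_casimir :: "((osc \<Rightarrow> spinor) \<times> (osc \<Rightarrow> spinor)) set"
  where "closed_casimir = graph_closure L2 (l2_norm L) {(\<psi>, casimir_op \<psi>) |\<psi>. \<psi> \<in> sections}"

lemma graph_closure_self:
  assumes "(\<psi>, \<phi>) \<in> G" "\<psi> \<in> L2" "\<phi> \<in> L2"
  shows "(\<psi>, \<phi>) \<in> graph_closure L2 (l2_norm L) G"
  unfolding graph_closure_def mem_Collect_eq prod.case
  by (intro conjI assms exI[of _ "\<lambda>_::nat. \<psi>"] exI[of _ "\<lambda>_::nat. \<phi>"] allI) (simp_all add: l2_norm_def)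

lemma closed_dirac_sections: assumes "\<psi> \<in> sections" shows "(\<psi>, dirac \<psi>) \<in> closed_dirac"
  unfolding closed_dirac_def
  by (rule graph_closure_self) (use assms in \<open>blast intro: sections_L2 sections_dirac\<close>)+

lemma closed_casimir_sections: assumes "\<psi> \<in> sections" shows "(\<psi>, casimir_op \<psi>) \<in> closed_casimir"
  unfolding closed_casimir_def
  by (rule graph_closure_self) (use assms in \<open>blast intro: sections_L2 sections_casimir\<close>)+

lemma ip_vector_scalar: "ip \<psi> (\<lambda>g. c *s \<phi> g) = ip (\<lambda>g. cnj c *s \<psi> g) \<phi>"
  unfolding ip_def inner_vector_scalar ..

lemma smooth_eigensection_of_closed_casimir:
  assumes A: "(\<psi>, \<lambda>g. c *s \<psi> g) \<in> closed_casimir" and nz: "l2_norm L \<psi> \<noteq> 0"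
  obtains u where "u \<in> sections" "l2_norm L u \<noteq> 0" "\<And>g. casimir_op u g = c *s u g"
proof -
  obtain f h where \<psi>: "\<psi> \<in> L2" and fh: "\<And>n::nat. (f n, h n) \<in> {(\<psi>, casimir_op \<psi>) |\<psi>. \<psi> \<in> sections}"
    and f_lim: "(\<lambda>n. l2_norm L (\<lambda>g. f n g - \<psi> g)) \<longlonglongrightarrow> 0"
    and h_lim: "(\<lambda>n. l2_norm L (\<lambda>g. h n g - c *s \<psi> g)) \<longlonglongrightarrow> 0"
    using A unfolding closed_casimir_def graph_closure_def by blast
  have f: "f n \<in> sections" and h: "h n = casimir_op (f n)" for n using fh[of n] by blast+
  have weak: "ip \<psi> (casimir_op k) = ip \<psi> (\<lambda>g. cnj c *s k g)" if k: "k \<in> sections" for k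
  proof -
    have 1: "(\<lambda>n. ip (casimir_op k) (f n)) \<longlonglongrightarrow> ip (casimir_op k) \<psi>"
      by (rule ip_tendsto[OF _ \<psi> _ f_lim]) (intro sections_L2 f sections_casimir k)+
    have 2: "(\<lambda>n. ip k (h n)) \<longlonglongrightarrow> ip k (\<lambda>g. c *s \<psi> g)"
      by (rule ip_tendsto[OF _ L2_vector_scalar[OF \<psi>] _ h_lim]) (simp_all only: h sections_L2 f sections_casimir k)
    have "ip k (h n) = ip (casimir_op k) (f n)" for n unfolding h by (rule casimir_symmetric[OF k f])
    then have "(\<lambda>n. ip k (h n)) = (\<lambda>n. ip (casimir_op k) (f n))" by (rule ext)
    then have "ip (casimir_op k) \<psi> = ip k (\<lambda>g. c *s \<psi> g)" using 1 2 LIMSEQ_unique by metis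
    then show ?thesis by (simp add: ip_commute[of \<psi>] ip_vector_scalar[of k c] ip_vector_scalar[of \<psi>] ip_commute[of _ k])
  qed
  from smooth_eigensection_of_weak[OF \<psi> nz weak] show ?thesis using that by auto
qed

text \<open>The operator \<open>D\<close> is not symmetric for the \<open>L\<^sup>2\<close> product, so \<open>D\<^sup>2 = - \<Omega>\<close> is carried over to the closure with the formal
  adjoint \<open>D\<^sup>*\<close>. For smooth \<open>k\<close> and smooth \<open>f\<^sub>n \<rightarrow> \<psi>\<close> with \<open>D f\<^sub>n \<rightarrow> \<nu> \<psi>\<close>, the product of \<open>\<Omega> k\<close> with \<open>f\<^sub>n\<close> is minus the
  product of \<open>D\<^sup>* k\<close> with \<open>D f\<^sub>n\<close>; both factors \<open>D\<close> produce \<open>\<nu>\<close> in the limit.\<close>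

lemma smooth_casimir_eigensection_of_closed_dirac:
  assumes A: "(\<psi>, \<lambda>g. \<nu> *s \<psi> g) \<in> closed_dirac" and nz: "l2_norm L \<psi> \<noteq> 0"
  obtains u where "u \<in> sections" "l2_norm L u \<noteq> 0" "\<And>g. casimir_op u g = - (\<nu>\<^sup>2) *s u g"
proof -
  obtain f h where \<psi>: "\<psi> \<in> L2" and fh: "\<And>n::nat. (f n, h n) \<in> {(\<psi>, dirac \<psi>) |\<psi>. \<psi> \<in> sections}"
    and f_lim: "(\<lambda>n. l2_norm L (\<lambda>g. f n g - \<psi> g)) \<longlonglongrightarrow> 0"
    and h_lim: "(\<lambda>n. l2_norm L (\<lambda>g. h n g - \<nu> *s \<psi> g)) \<longlonglongrightarrow> 0"
    using A unfolding closed_dirac_def graph_closure_def by blast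
  have f: "f n \<in> sections" and h: "h n = dirac (f n)" for n using fh[of n] by blast+
  have smf: "smooth (f n)" for n using f by (simp add: sections_def)
  have weak: "ip \<psi> (casimir_op k) = ip \<psi> (\<lambda>g. (- ((cnj \<nu>)\<^sup>2)) *s k g)" if k: "k \<in> sections" for k
  proof -
    obtain \<theta> where \<theta>: "\<theta> \<in> sections" "\<And>\<phi>. \<phi> \<in> sections \<Longrightarrow> ip k (dirac \<phi>) = ip \<theta> \<phi>"
      using dirac_formal_adjoint[OF k] by blast
    note S = sections_L2 f sections_dirac sections_casimir sections_vector_scalar k \<theta>(1)
    have 1: "(\<lambda>n. ip (casimir_op k) (f n)) \<longlonglongrightarrow> ip (casimir_op k) \<psi>"
      by (rule ip_tendsto[OF _ \<psi> _ f_lim]) (simp_all only: S)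
    have 2: "(\<lambda>n. ip \<theta> (h n)) \<longlonglongrightarrow> ip \<theta> (\<lambda>g. \<nu> *s \<psi> g)"
      by (rule ip_tendsto[OF _ L2_vector_scalar[OF \<psi>] _ h_lim]) (simp_all only: h S)
    have "ip (casimir_op k) (f n) = - ip \<theta> (h n)" for n
    proof -
      have "ip (casimir_op k) (f n) = ip k (casimir_op (f n))" by (rule casimir_symmetric[OF k f, symmetric])
      also have "casimir_op (f n) = (\<lambda>g. (- 1) *\<^sub>R dirac (h n) g)"
        unfolding h using dirac_square[OF smf, of n] by (simp add: fun_eq_iff)
      also have "ip k (\<lambda>g. (- 1) *\<^sub>R dirac (h n) g) = - ip \<theta> (h n)"
        unfolding ip_scaleR_right h by (simp add: \<theta>(2) S)
      finally show ?thesis .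
    qed
    then have "(\<lambda>n. ip (casimir_op k) (f n)) = (\<lambda>n. - ip \<theta> (h n))" by (rule ext)
    then have a: "ip (casimir_op k) \<psi> = - ip \<theta> (\<lambda>g. \<nu> *s \<psi> g)"
      using 1 tendsto_minus[OF 2] LIMSEQ_unique by metis
    have 3: "(\<lambda>n. ip (\<lambda>g. cnj \<nu> *s \<theta> g) (f n)) \<longlonglongrightarrow> ip (\<lambda>g. cnj \<nu> *s \<theta> g) \<psi>"
      by (rule ip_tendsto[OF _ \<psi> _ f_lim]) (simp_all only: S)
    have 4: "(\<lambda>n. ip (\<lambda>g. cnj \<nu> *s k g) (h n)) \<longlonglongrightarrow> ip (\<lambda>g. cnj \<nu> *s k g) (\<lambda>g. \<nu> *s \<psi> g)"
      by (rule ip_tendsto[OF _ L2_vector_scalar[OF \<psi>] _ h_lim]) (simp_all only: h S)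
    have "ip (\<lambda>g. cnj \<nu> *s \<theta> g) (f n) = ip (\<lambda>g. cnj \<nu> *s k g) (h n)" for n
    proof -
      have "ip (\<lambda>g. cnj \<nu> *s \<theta> g) (f n) = ip \<theta> (\<lambda>g. \<nu> *s f n g)" by (simp add: ip_vector_scalar)
      also have "\<dots> = ip k (dirac (\<lambda>g. \<nu> *s f n g))" by (rule \<theta>(2)[symmetric]) (rule sections_vector_scalar[OF f])
      also have "dirac (\<lambda>g. \<nu> *s f n g) = (\<lambda>g. \<nu> *s h n g)"
        unfolding h by (rule ext, rule dirac_vector_scalar[OF smf])
      finally show ?thesis by (simp add: ip_vector_scalar)
    qed
    then have "(\<lambda>n. ip (\<lambda>g. cnj \<nu> *s \<theta> g) (f n)) = (\<lambda>n. ip (\<lambda>g. cnj \<nu> *s k g) (h n))" by (rule ext)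
    then have "ip (\<lambda>g. cnj \<nu> *s \<theta> g) \<psi> = ip (\<lambda>g. cnj \<nu> *s k g) (\<lambda>g. \<nu> *s \<psi> g)"
      using 3 4 LIMSEQ_unique by metis
    then have "ip \<theta> (\<lambda>g. \<nu> *s \<psi> g) = ip (\<lambda>g. cnj \<nu> *s (cnj \<nu> *s k g)) \<psi>"
      by (simp only: ip_vector_scalar)
    also have "(\<lambda>g. cnj \<nu> *s (cnj \<nu> *s k g)) = (\<lambda>g. (- 1) *\<^sub>R ((- ((cnj \<nu>)\<^sup>2)) *s k g))"
      by (rule ext) (simp add: vec_eq_iff power2_eq_square)
    also have "ip \<dots> \<psi> = - ip (\<lambda>g. (- ((cnj \<nu>)\<^sup>2)) *s k g) \<psi>" unfolding ip_scaleR by simp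
    finally show ?thesis using a by (simp add: ip_commute)
  qed
  from smooth_eigensection_of_weak[OF \<psi> nz weak] show ?thesis using that by auto
qed

lemma l2_norm_nonzero_point: "\<psi> \<in> sections \<Longrightarrow> l2_norm L \<psi> \<noteq> 0 \<Longrightarrow> \<exists>p. \<psi> p \<noteq> 0"
proof (rule ccontr)
  assume nz: "l2_norm L \<psi> \<noteq> 0" and "\<not> (\<exists>p. \<psi> p \<noteq> 0)"
  then have "\<psi> = (\<lambda>g. 0)" by blast
  with nz show False by (simp add: l2_norm_def)
qed

lemma point_spectrum_dirac_iff:
  "\<nu> \<in> point_spectrum (l2_norm L) closed_dirac \<longleftrightarrow>
    (\<exists>u\<in>sections. l2_norm L u \<noteq> 0 \<and> (\<forall>g. casimir_op u g = - (\<nu>\<^sup>2) *s u g))"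
proof
  assume "\<nu> \<in> point_spectrum (l2_norm L) closed_dirac"
  then obtain \<psi> where "(\<psi>, \<lambda>g. \<nu> *s \<psi> g) \<in> closed_dirac" "l2_norm L \<psi> \<noteq> 0"
    unfolding point_spectrum_def by blast
  from smooth_casimir_eigensection_of_closed_dirac[OF this]
  show "\<exists>u\<in>sections. l2_norm L u \<noteq> 0 \<and> (\<forall>g. casimir_op u g = - (\<nu>\<^sup>2) *s u g)" by metis
next
  assume "\<exists>u\<in>sections. l2_norm L u \<noteq> 0 \<and> (\<forall>g. casimir_op u g = - (\<nu>\<^sup>2) *s u g)"
  then obtain u where u: "u \<in> sections" "l2_norm L u \<noteq> 0" "\<And>g. casimir_op u g = - (\<nu>\<^sup>2) *s u g" by blast
  obtain p where p: "u p \<noteq> 0" using l2_norm_nonzero_point[OF u(1,2)] ..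
  from dirac_eigensection_of_casimir[OF u(1) p u(3)]
  obtain \<psi> q where \<psi>: "\<psi> \<in> sections" "\<psi> q \<noteq> 0" "\<And>g. dirac \<psi> g = \<nu> *s \<psi> g" by blast
  have "dirac \<psi> = (\<lambda>g. \<nu> *s \<psi> g)" using \<psi>(3) by (rule ext)
  then have "(\<psi>, \<lambda>g. \<nu> *s \<psi> g) \<in> closed_dirac" using closed_dirac_sections[OF \<psi>(1)] by simp
  then show "\<nu> \<in> point_spectrum (l2_norm L) closed_dirac"
    unfolding point_spectrum_def using l2_norm_nonzero[OF \<psi>(1,2)] by blast
qed

lemma eigenvalue_casimir_iff:
  "(\<exists>\<psi>. (\<psi>, \<lambda>g. c *s \<psi> g) \<in> closed_casimir \<and> l2_norm L \<psi> \<noteq> 0) \<longleftrightarrow>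
    (\<exists>u\<in>sections. l2_norm L u \<noteq> 0 \<and> (\<forall>g. casimir_op u g = c *s u g))"
proof
  assume "\<exists>\<psi>. (\<psi>, \<lambda>g. c *s \<psi> g) \<in> closed_casimir \<and> l2_norm L \<psi> \<noteq> 0"
  then obtain \<psi> where "(\<psi>, \<lambda>g. c *s \<psi> g) \<in> closed_casimir" "l2_norm L \<psi> \<noteq> 0" by blast
  from smooth_eigensection_of_closed_casimir[OF this]
  show "\<exists>u\<in>sections. l2_norm L u \<noteq> 0 \<and> (\<forall>g. casimir_op u g = c *s u g)" by metis
next
  assume "\<exists>u\<in>sections. l2_norm L u \<noteq> 0 \<and> (\<forall>g. casimir_op u g = c *s u g)"
  then obtain u where u: "u \<in> sections" "l2_norm L u \<noteq> 0" "\<And>g. casimir_op u g = c *s u g" by blast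
  have "casimir_op u = (\<lambda>g. c *s u g)" using u(3) by (rule ext)
  then show "\<exists>\<psi>. (\<psi>, \<lambda>g. c *s \<psi> g) \<in> closed_casimir \<and> l2_norm L \<psi> \<noteq> 0"
    using closed_casimir_sections[OF u(1)] u(2) by (intro exI[of _ u]) simp
qed

text \<open>A vector orthogonal to the range of \<open>D - \<mu>\<close> is orthogonal to the range of \<open>(D - \<mu>) (D + \<mu>) = -\<Omega> - \<mu>\<^sup>2\<close>, so it
  is a weak eigensection of \<open>\<Omega>\<close>. As the eigenvalues of \<open>\<Omega>\<close> are real, \<open>\<mu>\<close> is an eigenvalue of \<open>D\<close>.\<close>

lemma dense_range:
  assumes \<mu>: "\<mu> \<notin> point_spectrum (l2_norm L) closed_dirac" and \<eta>: "\<eta> \<in> L2" and e: "e > 0"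
  shows "\<exists>(\<psi>, \<phi>)\<in>closed_dirac. l2_norm L (\<lambda>g. \<phi> g - \<mu> *s \<psi> g - \<eta> g) < e"
proof (rule ccontr)
  assume no: "\<not> ?thesis"
  define R where "R f g = dirac f g + (- \<mu>) *s f g" for f g
  have R: "R f \<in> sections" if "f \<in> sections" for f
    unfolding R_def[abs_def] by (intro sections_add sections_dirac sections_vector_scalar that)
  have minus: "(- c) *s x = - (c *s x)" for c and x :: spinor by (simp add: vec_eq_iff)
  have far: "l2_norm L (\<lambda>g. R f g - \<eta> g) \<ge> e" if f: "f \<in> sections" for f
  proof (rule ccontr)
    assume "\<not> l2_norm L (\<lambda>g. R f g - \<eta> g) \<ge> e"
    then have "l2_norm L (\<lambda>g. dirac f g - \<mu> *s f g - \<eta> g) < e" by (simp add: R_def minus)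
    then show False using no closed_dirac_sections[OF f] by blast
  qed
  obtain \<zeta> where \<zeta>: "\<zeta> \<in> L2" "l2_norm L \<zeta> \<noteq> 0" and orth: "\<And>w. w \<in> R ` sections \<Longrightarrow> ip \<zeta> w = 0"
  proof (rule orthogonal_vector_exists[where W="R ` sections", OF _ _ _ _ \<eta> e])
    show "R ` sections \<subseteq> L2" using R sections_L2 by blast
    have "(\<lambda>g. 0 :: spinor) \<in> sections" by (simp add: sections_def smooth_const equi_zero)
    then show "R ` sections \<noteq> {}" by blast
    show "(\<lambda>g. a g + b g) \<in> R ` sections" if ab: "a \<in> R ` sections" "b \<in> R ` sections" for a b
    proof -
      obtain f h where fh: "f \<in> sections" "h \<in> sections" "a = R f" "b = R h" using ab by blast
      have sm: "smooth f" "smooth h" using fh by (simp_all add: sections_def)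
      have "(\<lambda>g. a g + b g) = R (\<lambda>g. f g + h g)"
        unfolding fh R_def dirac_add[OF sm] by (simp add: fun_eq_iff vec_eq_iff algebra_simps)
      then show ?thesis using sections_add[OF fh(1,2)] by blast
    qed
    show "(\<lambda>g. c *\<^sub>R a g) \<in> R ` sections" if a: "a \<in> R ` sections" for a c
    proof -
      obtain f where f: "f \<in> sections" "a = R f" using a by blast
      have cR: "c *\<^sub>R x = of_real c *s x" for x :: spinor by (simp add: vec_eq_iff scaleR_conv_of_real[where 'a=complex])
      have sm: "smooth f" using f by (simp add: sections_def)
      have "(\<lambda>g. c *\<^sub>R a g) = R (\<lambda>g. of_real c *s f g)"
        unfolding f R_def cR dirac_vector_scalar[OF sm] by (simp add: fun_eq_iff vec_eq_iff algebra_simps)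
      then show ?thesis using sections_vector_scalar[OF f(1)] by blast
    qed
    show "e \<le> l2_norm L (\<lambda>g. w g - \<eta> g)" if "w \<in> R ` sections" for w using far that by blast
  qed blast
  have "ip \<zeta> (casimir_op f) = ip \<zeta> (\<lambda>g. (- (\<mu>\<^sup>2)) *s f g)" if f: "f \<in> sections" for f
  proof -
    have sm: "smooth f" using f by (simp add: sections_def)
    define h where "h g = dirac f g + \<mu> *s f g" for g
    have h: "h \<in> sections" unfolding h_def[abs_def] by (intro sections_add sections_dirac sections_vector_scalar f)
    have "dirac h g = dirac (dirac f) g + \<mu> *s dirac f g" for g
      unfolding h_def[abs_def]
      using dirac_add[OF smooth_dirac[OF sm] smooth_bounded_linear[OF bounded_linear_vector_scalar sm]]
        dirac_vector_scalar[OF sm] by simp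
    then have "R h = (\<lambda>g. (- (\<mu>\<^sup>2)) *s f g - casimir_op f g)"
      unfolding R_def h_def dirac_square[OF sm] by (simp add: fun_eq_iff vec_eq_iff power2_eq_square algebra_simps)
    moreover have "ip \<zeta> (R h) = 0" using orth h by blast
    ultimately have "ip \<zeta> (\<lambda>g. (- (\<mu>\<^sup>2)) *s f g - casimir_op f g) = 0" by (simp only:)
    moreover have "ip \<zeta> (\<lambda>g. (- (\<mu>\<^sup>2)) *s f g - casimir_op f g) = ip \<zeta> (\<lambda>g. (- (\<mu>\<^sup>2)) *s f g) - ip \<zeta> (casimir_op f)"
      by (rule ip_diff_right) (intro sections_L2 sections_vector_scalar sections_casimir f \<zeta>(1))+
    ultimately show ?thesis by linarith
  qed
  from smooth_eigensection_of_weak[OF \<zeta> this]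
  obtain u where u: "u \<in> sections" "l2_norm L u \<noteq> 0" "\<And>g. casimir_op u g = cnj (- (\<mu>\<^sup>2)) *s u g" by blast
  have "cnj (- (\<mu>\<^sup>2)) = - (\<mu>\<^sup>2)" using casimir_eigenvalue_real[OF u] by simp
  then have "\<forall>g. casimir_op u g = - (\<mu>\<^sup>2) *s u g" using u(3) by simp
  then have "\<mu> \<in> point_spectrum (l2_norm L) closed_dirac" unfolding point_spectrum_dirac_iff using u(1,2) by blast
  then show False using \<mu> by blast
qed

text \<open>For \<open>w = f u\<^sub>1\<close> with \<open>T f = i\<tau> f\<close>, the component of \<open>(D + \<mu>) w\<close> along \<open>u\<^sub>2\<close> is \<open>\<surd>2 i (\<tau> + 1/2) f\<close>, and
  \<open>D - \<mu>\<close> maps \<open>(D + \<mu>) w\<close> to \<open>-\<Omega> w - \<mu>\<^sup>2 w\<close>. If \<open>|\<tau>|\<close> tends to infinity faster than \<open>\<Omega> f\<close>, no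
  resolvent can be bounded.\<close>

lemma dirac_resolvent_empty:
  assumes c: "c > 0" and n0: "n0 > 0"
    and packets: "\<And>R. \<exists>p f. p \<ge> R \<and> smooth f \<and> equi f \<and>
      (\<forall>g. left_deriv exp_T f g = - (\<i> * of_real (p\<^sup>2 / (2 * c))) * f g) \<and>
      (\<forall>g. norm (casimir_op f g) \<le> B * (1 + p)) \<and> (\<integral>g. (norm (f g :: complex))\<^sup>2 \<partial>M) = n0\<^sup>2"
  shows "resolvent_set L2 (l2_norm L) closed_dirac = {}"
proof (rule ccontr)
  assume "resolvent_set L2 (l2_norm L) closed_dirac \<noteq> {}"
  then obtain \<mu> C where bound: "\<forall>(\<psi>, \<phi>)\<in>closed_dirac. l2_norm L \<psi> \<le> C * l2_norm L (\<lambda>g. \<phi> g - \<mu> *s \<psi> g)"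
    unfolding resolvent_set_def by blast
  interpret fm: finite_measure M by (rule finite_measure_M)
  define V where "V = sqrt (measure M (space M))"
  define a where "a = \<bar>C\<bar> * (\<bar>B\<bar> * V + (norm \<mu>)\<^sup>2 * n0)"
  have V: "V \<ge> 0" and a: "a \<ge> 0" using n0 by (simp_all add: V_def a_def)
  \<comment> \<open>the estimates below end in \<open>p n0 \<le> 4 c (a + |C| |B| V + 1)\<close>, which \<open>p \<ge> R\<close> contradicts; \<open>p \<ge> 2 \<surd>c\<close> absorbs the \<open>1/2\<close>\<close>
  define R where "R = max (max 1 (sqrt c * 2)) (16 * c * (a + \<bar>C\<bar> * \<bar>B\<bar> * V + 1) / n0)"
  obtain p f where p: "p \<ge> R" and f: "smooth f" "equi f"
    and Tf: "\<And>g. left_deriv exp_T f g = - (\<i> * of_real (p\<^sup>2 / (2 * c))) * f g"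
    and Of: "\<And>g. norm (casimir_op f g) \<le> B * (1 + p)" and nf: "(\<integral>g. (norm (f g :: complex))\<^sup>2 \<partial>M) = n0\<^sup>2"
    using packets[of R] by blast
  have p1: "p \<ge> 1" using p by (simp add: R_def)
  define A :: "complex \<Rightarrow> spinor" where "A z = (\<chi> i. if i = 1 then z else 0)" for z
  have A_norm: "norm (A z :: spinor) = norm z" for z
    by (simp add: A_def norm_vec_def L2_set_def sum_4)
  have "linear (A :: complex \<Rightarrow> spinor)" unfolding A_def by (rule linearI) (simp_all add: vec_eq_iff)
  then have A: "bounded_linear (A :: complex \<Rightarrow> spinor)" by (simp add: linear_conv_bounded_linear)
  define w :: "osc \<Rightarrow> spinor" where "w g = A (f g)" for g
  have smw: "smooth w" unfolding w_def[abs_def] by (rule smooth_bounded_linear[OF A f(1)])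
  have "equi w" unfolding w_def[abs_def] by (rule equi_linear[OF bounded_linear.linear[OF A] f(2)])
  with smw have w: "w \<in> sections" by (simp add: sections_def)
  have norm_w: "l2_norm L w = n0" using n0 nf by (simp add: l2_norm_def w_def A_norm)
  have cas_w: "casimir_op w g = A (casimir_op f g)" for g
    unfolding w_def[abs_def] by (rule casimir_op_bounded_linear[OF A f(1)])
  have D: "left_deriv \<gamma> w g = A (left_deriv \<gamma> f g)" if "one_parameter \<gamma>" for \<gamma> g
    unfolding w_def[abs_def] by (rule left_deriv_bounded_linear[OF A that f(1)])
  define \<psi> where "\<psi> g = dirac w g + \<mu> *s w g" for g
  have \<psi>: "\<psi> \<in> sections" unfolding \<psi>_def[abs_def] by (intro sections_add sections_dirac sections_vector_scalar w)
  have comp2: "\<psi> g $ 2 = of_real (sqrt 2) * (- (\<i> * of_real (p\<^sup>2 / (2 * c))) + \<i> / 2) * f g" for g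
    unfolding \<psi>_def dirac_eq
    by (simp add: D one_parameter_exp w_def A_def Tf matrix_vector_mult_def matrix_matrix_mult_def sum_4
        cliff_X_def cliff_Y_def cliff_Z_def cliff_T_def scaleR_conv_of_real[where 'a=complex] algebra_simps)
  have big: "p\<^sup>2 / (2 * c) \<ge> 1"
  proof -
    have "sqrt c * 2 \<le> p" using p by (simp add: R_def)
    then have "(sqrt c * 2)\<^sup>2 \<le> p\<^sup>2" using c by (intro power_mono) simp_all
    then have "4 * c \<le> p\<^sup>2" using c by (simp add: power_mult_distrib)
    then show ?thesis using c by (simp add: field_simps)
  qed
  have lower: "norm (\<psi> g) \<ge> p\<^sup>2 / (4 * c) * norm (f g)" for g
  proof -
    have "norm (- (\<i> * of_real (p\<^sup>2 / (2 * c))) + \<i> / 2) = norm (\<i> * of_real (1 / 2 - p\<^sup>2 / (2 * c)))"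
      by (simp add: algebra_simps)
    also have "\<dots> = \<bar>1 / 2 - p\<^sup>2 / (2 * c)\<bar>" by (simp only: norm_mult norm_ii norm_of_real mult_1)
    also have "\<dots> \<ge> p\<^sup>2 / (4 * c)" using big c by (simp add: field_simps)
    finally have 1: "norm (- (\<i> * of_real (p\<^sup>2 / (2 * c))) + \<i> / 2) \<ge> p\<^sup>2 / (4 * c)" .
    have "p\<^sup>2 / (4 * c) * norm (f g) \<le> norm (- (\<i> * of_real (p\<^sup>2 / (2 * c))) + \<i> / 2) * norm (f g)"
      by (rule mult_right_mono[OF 1]) simp
    also have "\<dots> = 1 * (norm (- (\<i> * of_real (p\<^sup>2 / (2 * c))) + \<i> / 2) * norm (f g))" by simp
    also have "\<dots> \<le> sqrt 2 * (norm (- (\<i> * of_real (p\<^sup>2 / (2 * c))) + \<i> / 2) * norm (f g))"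
      by (rule mult_right_mono) simp_all
    also have "\<dots> = norm (\<psi> g $ 2)" unfolding comp2 by (simp add: norm_mult)
    also have "\<dots> \<le> norm (\<psi> g)" by (rule Finite_Cartesian_Product.norm_nth_le)
    finally show ?thesis .
  qed
  have int_f: "integrable M (\<lambda>g. (norm (f g))\<^sup>2)"
    by (rule integrable_M_continuous) (simp_all add: equi_norm f continuous_intros smooth_continuous_on)
  have "p\<^sup>2 / (4 * c) * n0 \<le> l2_norm L \<psi>"
  proof (rule power2_le_imp_le)
    have "(p\<^sup>2 / (4 * c) * n0)\<^sup>2 = (\<integral>g. (p\<^sup>2 / (4 * c))\<^sup>2 * (norm (f g))\<^sup>2 \<partial>M)"
      by (simp only: integral_mult_right_zero nf power_mult_distrib)
    also have "\<dots> \<le> (\<integral>g. (norm (\<psi> g))\<^sup>2 \<partial>M)"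
    proof (rule integral_mono)
      show "integrable M (\<lambda>g. (p\<^sup>2 / (4 * c))\<^sup>2 * (norm (f g))\<^sup>2)" by (rule integrable_mult_right[OF int_f])
      show "integrable M (\<lambda>g. (norm (\<psi> g))\<^sup>2)" by (rule L2D(4)[OF sections_L2[OF \<psi>]])
      show "(p\<^sup>2 / (4 * c))\<^sup>2 * (norm (f g))\<^sup>2 \<le> (norm (\<psi> g))\<^sup>2" for g
        unfolding power_mult_distrib[symmetric] by (rule power_mono[OF lower]) (use c in simp)
    qed
    also have "\<dots> = (l2_norm L \<psi>)\<^sup>2" by (simp add: l2_norm_square ip_def power2_norm_eq_inner)
    finally show "(p\<^sup>2 / (4 * c) * n0)\<^sup>2 \<le> (l2_norm L \<psi>)\<^sup>2" .
  qed (rule l2_norm_nonneg)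
  also have "l2_norm L \<psi> \<le> C * l2_norm L (\<lambda>g. dirac \<psi> g - \<mu> *s \<psi> g)"
    using bspec[OF bound closed_dirac_sections[OF \<psi>]] by simp
  also have "(\<lambda>g. dirac \<psi> g - \<mu> *s \<psi> g) = (\<lambda>g. (- 1) *\<^sub>R casimir_op w g + (- (\<mu>\<^sup>2)) *s w g)"
  proof
    fix g
    have "dirac \<psi> g = dirac (dirac w) g + \<mu> *s dirac w g"
      unfolding \<psi>_def[abs_def]
      using dirac_add[OF smooth_dirac[OF smw] smooth_bounded_linear[OF bounded_linear_vector_scalar smw]]
        dirac_vector_scalar[OF smw] by simp
    then show "dirac \<psi> g - \<mu> *s \<psi> g = (- 1) *\<^sub>R casimir_op w g + (- (\<mu>\<^sup>2)) *s w g"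
      unfolding dirac_square[OF smw] \<psi>_def by (simp add: vec_eq_iff power2_eq_square algebra_simps)
  qed
  also have "C * l2_norm L \<dots> \<le> \<bar>C\<bar> * (l2_norm L (\<lambda>g. (- 1) *\<^sub>R casimir_op w g) + l2_norm L (\<lambda>g. (- (\<mu>\<^sup>2)) *s w g))"
    by (intro mult_mono l2_norm_triangle L2_scaleR L2_vector_scalar sections_L2 sections_casimir w)
       (simp_all add: l2_norm_nonneg)
  also have "\<dots> = \<bar>C\<bar> * (l2_norm L (casimir_op w) + (norm \<mu>)\<^sup>2 * n0)"
    unfolding l2_norm_scaleR l2_norm_vector_scalar norm_w by (simp add: norm_power)
  also have "\<dots> \<le> \<bar>C\<bar> * (\<bar>B\<bar> * (1 + p) * V + (norm \<mu>)\<^sup>2 * n0)"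
  proof (intro mult_left_mono add_right_mono)
    have "(\<integral>g. (norm (casimir_op w g))\<^sup>2 \<partial>M) \<le> (\<integral>g. (\<bar>B\<bar> * (1 + p))\<^sup>2 \<partial>M)"
    proof (rule integral_mono)
      show "integrable M (\<lambda>g. (norm (casimir_op w g))\<^sup>2)"
        by (rule L2D(4)[OF sections_L2[OF sections_casimir[OF w]]])
      show "(norm (casimir_op w g))\<^sup>2 \<le> (\<bar>B\<bar> * (1 + p))\<^sup>2" for g
      proof (rule power_mono)
        have "norm (casimir_op w g) \<le> B * (1 + p)" unfolding cas_w A_norm by (rule Of)
        also have "\<dots> \<le> \<bar>B\<bar> * (1 + p)" using p1 by (intro mult_right_mono) simp_all
        finally show "norm (casimir_op w g) \<le> \<bar>B\<bar> * (1 + p)" .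
      qed simp
    qed simp
    also have "\<dots> = (\<bar>B\<bar> * (1 + p) * V)\<^sup>2" by (simp add: V_def power_mult_distrib mult.commute)
    finally have "(l2_norm L (casimir_op w))\<^sup>2 \<le> (\<bar>B\<bar> * (1 + p) * V)\<^sup>2"
      by (simp add: l2_norm_square ip_def power2_norm_eq_inner)
    then show "l2_norm L (casimir_op w) \<le> \<bar>B\<bar> * (1 + p) * V"
      by (rule power2_le_imp_le) (use p1 V in simp)
  qed simp
  also have "\<dots> = a + \<bar>C\<bar> * \<bar>B\<bar> * V * p" by (simp add: a_def algebra_simps)
  also have "\<dots> \<le> (a + \<bar>C\<bar> * \<bar>B\<bar> * V + 1) * p"
  proof -
    have "a * 1 \<le> a * p" using p1 a by (intro mult_left_mono)
    then show ?thesis using p1 by (simp add: algebra_simps)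
  qed
  finally have "p * p * n0 \<le> 4 * c * (a + \<bar>C\<bar> * \<bar>B\<bar> * V + 1) * p" using c by (simp add: field_simps power2_eq_square)
  then have "p * n0 \<le> 4 * c * (a + \<bar>C\<bar> * \<bar>B\<bar> * V + 1)" using p1 by (simp add: mult_ac)
  moreover have "16 * c * (a + \<bar>C\<bar> * \<bar>B\<bar> * V + 1) \<le> p * n0"
  proof -
    have "16 * c * (a + \<bar>C\<bar> * \<bar>B\<bar> * V + 1) / n0 \<le> p" using p by (simp add: R_def)
    then show ?thesis using n0 by (simp add: field_simps)
  qed
  moreover have "c * (a + \<bar>C\<bar> * \<bar>B\<bar> * V + 1) > 0" using c a V by (intro mult_pos_pos add_nonneg_pos add_nonneg_nonneg mult_nonneg_nonneg) simp_all
  ultimately show False by simp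
qed

end

section \<open>Wave packets\<close>

lemma bounded_if_zero_outside_ball:
  fixes \<gamma> :: "complex \<Rightarrow> complex"
  assumes "continuous_on UNIV \<gamma>" "\<And>\<xi>. norm \<xi> > r \<Longrightarrow> \<gamma> \<xi> = 0"
  shows "\<exists>B\<ge>0. \<forall>\<xi>. norm (\<gamma> \<xi>) \<le> B"
proof -
  have "compact (\<gamma> ` cball 0 r)"
    by (rule compact_continuous_image[OF continuous_on_subset[OF assms(1)] compact_cball]) simp
  from compact_imp_bounded[OF this] obtain B where B: "\<forall>x\<in>\<gamma> ` cball 0 r. norm x \<le> B" unfolding bounded_iff by (rule exE)
  have "norm (\<gamma> \<xi>) \<le> max B 0" for \<xi>
  proof (cases "norm \<xi> \<le> r")
    case True
    then have "norm (\<gamma> \<xi>) \<le> B" using B by simp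
    then show ?thesis by simp
  qed (simp add: assms(2))
  then show ?thesis by (intro exI[of _ "max B 0"]) simp
qed

text \<open>Functions \<open>\<beta>(\<xi>) exp i(p x + c z + \<tau> t)\<close>, with \<open>\<xi> = x + iy\<close>, are preserved by differentiation. On them the Casimir operator
  has the leading coefficient \<open>- p\<^sup>2 - 2 c \<tau>\<close>; if this vanishes, what remains is of first order in \<open>p\<close>.\<close>

definition plane_wave :: "real \<Rightarrow> real \<Rightarrow> real \<Rightarrow> (complex \<Rightarrow> complex) \<Rightarrow> osc \<Rightarrow> complex"
  where "plane_wave p c \<tau> \<beta> g = \<beta> (fst g) * cis (p * Re (fst g) + c * fst (snd g) + \<tau> * snd (snd g))"

lemma smooth_plane_wave: assumes "smooth \<beta>" shows "smooth (plane_wave p c \<tau> \<beta>)"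
  unfolding plane_wave_def[abs_def]
  by (intro smooth_mult smooth_compose[OF assms] smooth_cis smooth_add smooth_const smooth_Re smooth_fst smooth_snd smooth_id)

lemma plane_wave_has_derivative:
  assumes \<beta>: "smooth \<beta>"
  shows "(plane_wave p c \<tau> \<beta> has_derivative (\<lambda>v. (dir_deriv (fst v) \<beta> (fst g)
    + \<i> * of_real (p * Re (fst v) + c * fst (snd v) + \<tau> * snd (snd v)) * \<beta> (fst g))
    * cis (p * Re (fst g) + c * fst (snd g) + \<tau> * snd (snd g)))) (at g)"
proof -
  have 1: "((\<lambda>g :: osc. \<beta> (fst g)) has_derivative (\<lambda>v. dir_deriv (fst v) \<beta> (fst g))) (at g)"
    by (rule has_derivative_compose[OF bounded_linear_imp_has_derivative[OF bounded_linear_fst] smooth_has_derivative[OF \<beta>]])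
  have lin: "bounded_linear (\<lambda>g :: osc. \<i> * of_real (p * Re (fst g) + c * fst (snd g) + \<tau> * snd (snd g)))"
    by (rule linear_conv_bounded_linear[THEN iffD1], rule linearI)
       (simp_all add: algebra_simps scaleR_conv_of_real)
  note 2 = has_derivative_compose[OF bounded_linear_imp_has_derivative[OF lin]
      has_field_derivative_imp_has_derivative[OF DERIV_exp], of g UNIV]
  show ?thesis unfolding plane_wave_def[abs_def] cis_conv_exp
    by (rule has_derivative_eq_rhs[OF has_derivative_mult[OF 1 2]]) (simp add: fun_eq_iff algebra_simps)
qed

lemma dir_deriv_plane_wave:
  assumes "smooth \<beta>"
  shows "dir_deriv v (plane_wave p c \<tau> \<beta>) = plane_wave p c \<tau> (\<lambda>\<xi>. dir_deriv (fst v) \<beta> \<xi>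
    + \<i> * of_real (p * Re (fst v) + c * fst (snd v) + \<tau> * snd (snd v)) * \<beta> \<xi>)"
  by (rule ext, rule dir_derivI) (simp only: plane_wave_def[of _ _ _ "\<lambda>\<xi>. dir_deriv _ \<beta> \<xi> + _ * \<beta> \<xi>"] plane_wave_has_derivative[OF assms])

lemma casimir_plane_wave:
  assumes \<beta>: "smooth \<beta>" and p: "p\<^sup>2 = - 2 * c * \<tau>"
  shows "casimir_op (plane_wave p c \<tau> \<beta>) g = plane_wave p c \<tau> (\<lambda>\<xi>.
      of_real p * (2 * \<i> * dir_deriv 1 \<beta> \<xi> + of_real (c * Im \<xi>) * \<beta> \<xi>)
      + (dir_deriv 1 (dir_deriv 1 \<beta>) \<xi> + dir_deriv \<i> (dir_deriv \<i> \<beta>) \<xi>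
        + \<i> * of_real c * (of_real (Re \<xi>) * dir_deriv \<i> \<beta> \<xi> - of_real (Im \<xi>) * dir_deriv 1 \<beta> \<xi>)
        - of_real (c\<^sup>2 * ((Re \<xi>)\<^sup>2 + (Im \<xi>)\<^sup>2) / 4) * \<beta> \<xi>)) g"
proof -
  have lin: "dir_deriv v (\<lambda>\<xi>. \<gamma> \<xi> + k * \<delta> \<xi>) \<xi> = dir_deriv v \<gamma> \<xi> + k * dir_deriv v \<delta> \<xi>"
    if "smooth \<gamma>" "smooth \<delta>" for v k \<xi> and \<gamma> \<delta> :: "complex \<Rightarrow> complex"
    by (rule dir_derivI) (intro has_derivative_add has_derivative_mult_right smooth_has_derivative that)
  have lin2: "dir_deriv v (\<lambda>\<xi>. k * \<delta> \<xi>) \<xi> = k * dir_deriv v \<delta> \<xi>"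
    if "smooth \<delta>" for v k \<xi> and \<delta> :: "complex \<Rightarrow> complex"
    by (rule dir_derivI) (intro has_derivative_mult_right smooth_has_derivative that)
  have z: "dir_deriv 0 \<delta> = (\<lambda>\<xi>. 0)" if "smooth \<delta>" for \<delta> :: "complex \<Rightarrow> complex"
    using linear_0[OF has_derivative_linear[OF smooth_has_derivative[OF that]]] by (rule ext)
  have D: "D1 (plane_wave p c \<tau> \<delta>) = plane_wave p c \<tau> (\<lambda>\<xi>. dir_deriv 1 \<delta> \<xi> + \<i> * of_real p * \<delta> \<xi>)"
    "D2 (plane_wave p c \<tau> \<delta>) = plane_wave p c \<tau> (dir_deriv \<i> \<delta>)"
    "D3 (plane_wave p c \<tau> \<delta>) = plane_wave p c \<tau> (\<lambda>\<xi>. \<i> * of_real c * \<delta> \<xi>)"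
    "D4 (plane_wave p c \<tau> \<delta>) = plane_wave p c \<tau> (\<lambda>\<xi>. \<i> * of_real \<tau> * \<delta> \<xi>)"
    if "smooth \<delta>" for \<delta> :: "complex \<Rightarrow> complex"
    by (simp_all add: dir_deriv_plane_wave that z)
  have sm: "smooth (\<lambda>\<xi>. k * \<delta> \<xi>)" if "smooth \<delta>" for k and \<delta> :: "complex \<Rightarrow> complex"
    using smooth_mult[OF smooth_const that] .
  have p': "of_real p * (of_real p * w) = - 2 * of_real c * of_real \<tau> * (w :: complex)" for w
    using arg_cong[OF p, of "\<lambda>x. of_real x * w"] by (simp add: power2_eq_square mult.assoc)
  show ?thesis
    unfolding casimir_op_coordinates[OF smooth_plane_wave[OF \<beta>]]
    by (simp add: D \<beta> smooth_dir_deriv smooth_add sm lin lin2 plane_wave_def scaleR_conv_of_real)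
       (simp add: algebra_simps power2_eq_square p' add_divide_distrib diff_divide_distrib)
qed

lemma of_int_multiple:
  fixes Q :: "real \<Rightarrow> bool"
  assumes "Q 0" "\<And>x y. Q x \<Longrightarrow> Q y \<Longrightarrow> Q (x + y)" "\<And>x. Q x \<Longrightarrow> Q (- x)" "Q x"
  shows "Q (of_int k * x)"
proof -
  have nat: "Q (real n * x)" for n
    by (induction n) (use assms in \<open>auto simp: distrib_right\<close>)
  show ?thesis
  proof (cases "k \<ge> 0")
    case True
    then show ?thesis using nat[of "nat k"] by simp
  next
    case False
    then show ?thesis using assms(3)[OF nat[of "nat (- k)"]] by simp
  qed
qed

text \<open>The features of a basic lattice that the construction of wave packets uses.\<close>

locale basic_osc_lattice = osc_lattice +
  fixes \<kappa> :: nat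
  assumes discrete_projection: "discrete (fst ` L)"
    and \<kappa>_pos: "\<kappa> > 0" and \<kappa>_mem: "(0, 0, 2 * pi * real \<kappa>) \<in> L"
    and time_L: "l \<in> L \<Longrightarrow> \<exists>k::int. snd (snd l) = of_int k * (2 * pi * real \<kappa>)"
begin

lemma projection_gap:
  obtains \<delta> where "\<delta> > 0" "\<And>l. l \<in> L \<Longrightarrow> norm (fst l) < \<delta> \<Longrightarrow> fst l = 0"
proof -
  have "0 \<in> fst ` L" using one_L by force
  then obtain U where U: "open U" "U \<inter> fst ` L = {0}"
    using discrete_projection unfolding discrete_def isolated_in_def by blast
  then obtain \<delta> where \<delta>: "\<delta> > 0" "ball 0 \<delta> \<subseteq> U" unfolding open_contains_ball by blast
  have "fst l = 0" if "l \<in> L" "norm (fst l) < \<delta>" for l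
  proof -
    have "fst l \<in> U \<inter> fst ` L" using that \<delta>(2) by auto
    then show ?thesis using U(2) by blast
  qed
  with \<delta>(1) show ?thesis by (rule that)
qed

lemma fst_mult_L: "l \<in> L \<Longrightarrow> fst (l \<cdot> g) = fst l + fst g"
  by (simp add: osc_mult_eq cis_lattice)

lemma fst_inv_L: "l \<in> L \<Longrightarrow> fst (osc_inv l) = - fst l"
  using fst_mult_L[of l "osc_inv l"] by (simp add: eq_neg_iff_add_eq_0 add.commute)

text \<open>The central part of \<open>L\<close> is trivial or generated by its least positive element \<open>z0\<close>; the sign of \<open>z0\<close> decides between the
  frequencies \<open>2\<pi>/z0\<close> and \<open>\<pi>/z0\<close>.\<close>

lemma central_frequency:
  obtains c where "c > 0" "\<And>z. (0, z, 0) \<in> L \<Longrightarrow> cis (c * z) = of_real (s (0, z, 0))"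
proof -
  define A where "A z \<longleftrightarrow> (0, z, 0) \<in> L" for z :: real
  have A0: "A 0" using one_L by (simp add: A_def)
  have prod: "(0, y, 0) \<cdot> (0, z, 0) = ((0, y + z, 0) :: osc)" for y z by (simp add: omega_def)
  have Aadd: "A (y + z)" if "A y" "A z" for y z using mult_L that prod unfolding A_def by metis
  have inv: "osc_inv (0, z, 0) = ((0, - z, 0) :: osc)" for z by (simp add: osc_inv_def)
  have Aneg: "A (- z)" if "A z" for z using inv_L that inv unfolding A_def by metis
  show ?thesis
  proof (cases "\<exists>z>0. A z")
    case False
    have zero: "z = 0" if "A z" for z
    proof (rule ccontr)
      assume "z \<noteq> 0"
      then consider "z > 0" | "- z > 0" by linarith
      then show False using False that Aneg[OF that] by cases blast+
    qed
    have "cis (1 * z) = of_real (s (0, z, 0))" if "(0, z, 0) \<in> L" for z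
      using zero[of z] that s_one by (simp add: A_def)
    then show ?thesis by (rule that[of 1, rotated]) simp_all
  next
    case True
    then obtain z1 where z1: "z1 > 0" "A z1" by blast
    define P where "P = {z. A z \<and> 0 < z \<and> z \<le> z1}"
    have "compact ((\<lambda>z. (0, z, 0) :: osc) ` {0..z1})"
      by (intro compact_continuous_image continuous_intros compact_Icc)
    then have "finite (L \<inter> (\<lambda>z. (0, z, 0)) ` {0..z1})" by (rule finite_L_compact)
    then have "finite ((\<lambda>l. fst (snd l)) ` (L \<inter> (\<lambda>z. (0, z, 0)) ` {0..z1}))" by (rule finite_imageI)
    moreover have "P \<subseteq> (\<lambda>l. fst (snd l)) ` (L \<inter> (\<lambda>z. (0, z, 0)) ` {0..z1})"
    proof
      fix z assume "z \<in> P"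
      then have "(0, z, 0) \<in> L \<inter> (\<lambda>z. (0, z, 0)) ` {0..z1}" by (auto simp: P_def A_def)
      from imageI[OF this, of "\<lambda>l. fst (snd l)"] show "z \<in> (\<lambda>l. fst (snd l)) ` (L \<inter> (\<lambda>z. (0, z, 0)) ` {0..z1})" by simp
    qed
    ultimately have finP: "finite P" by (rule finite_subset[rotated])
    define z0 where "z0 = Min P"
    have "z1 \<in> P" using z1 by (simp add: P_def)
    then have z0P: "z0 \<in> P" unfolding z0_def using finP by (intro Min_in) auto
    then have z0: "z0 > 0" "A z0" "z0 \<le> z1" by (simp_all add: P_def)
    have mult: "\<exists>k::int. z = of_int k * z0" if z: "A z" for z
    proof -
      \<comment> \<open>the remainder of \<open>z\<close> modulo \<open>z0\<close> is in the central part and smaller than \<open>z0\<close>\<close>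
      define r where "r = z - of_int \<lfloor>z / z0\<rfloor> * z0"
      have "A (of_int \<lfloor>z / z0\<rfloor> * z0)" by (rule of_int_multiple[of A, OF A0 Aadd Aneg z0(2)])
      then have "A r" unfolding r_def using Aadd[OF z Aneg] by simp
      have "of_int \<lfloor>z / z0\<rfloor> * z0 \<le> z" using z0(1) by (simp add: pos_le_divide_eq[symmetric])
      then have "r \<ge> 0" by (simp add: r_def)
      have "z / z0 < of_int \<lfloor>z / z0\<rfloor> + 1" by linarith
      then have "r < z0" using z0(1) by (simp add: r_def pos_divide_less_eq algebra_simps)
      have "r = 0"
      proof (rule ccontr)
        assume "r \<noteq> 0"
        then have "r \<in> P" using \<open>A r\<close> \<open>r \<ge> 0\<close> \<open>r < z0\<close> z0(3) by (simp add: P_def)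
        then have "z0 \<le> r" unfolding z0_def using finP by (intro Min_le)
        then show False using \<open>r < z0\<close> by simp
      qed
      then show ?thesis by (auto simp: r_def)
    qed
    define c where "c = (if s (0, z0, 0) = 1 then 2 * pi / z0 else pi / z0)"
    have c: "c > 0" using z0(1) by (simp add: c_def)
    define Q where "Q z \<longleftrightarrow> A z \<and> cis (c * z) = of_real (s (0, z, 0))" for z
    have "Q 0" using A0 s_one by (simp add: Q_def)
    moreover have "Q (y + z)" if yz: "Q y" "Q z" for y z
    proof -
      have "s (0, y + z, 0) = s (0, y, 0) * s (0, z, 0)"
        using s_mult[of "(0, y, 0)" "(0, z, 0)"] yz unfolding prod by (simp add: Q_def A_def)
      then show ?thesis using yz Aadd by (simp add: Q_def distrib_left flip: cis_mult)
    qed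
    moreover have "Q (- z)" if z: "Q z" for z
    proof -
      have "s (0, - z, 0) = s (0, z, 0)" using s_inv[of "(0, z, 0)"] z unfolding inv by (simp add: Q_def A_def)
      moreover have "cis (c * - z) = cnj (cis (c * z))" by (simp add: cis_cnj)
      ultimately show ?thesis using z Aneg by (simp add: Q_def)
    qed
    moreover have "Q z0"
      using z0 s_sign[of "(0, z0, 0)"] by (auto simp: Q_def c_def A_def)
    ultimately have "Q (of_int k * z0)" for k by (rule of_int_multiple)
    then have "Q z" if "A z" for z using mult[OF that] by blast
    then show ?thesis using that[OF c] by (simp add: Q_def A_def)
  qed
qed

text \<open>An element of \<open>L\<close> over \<open>\<xi> = 0\<close> is a product of a power of \<open>(0, 0, 2\<pi>\<kappa>)\<close> and an element \<open>(0, z, 0)\<close> of \<open>L\<close>.\<close>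

lemma phase_on_centre:
  assumes c: "\<And>z. (0, z, 0) \<in> L \<Longrightarrow> cis (c * z) = of_real (s (0, z, 0))"
    and \<tau>: "cis (\<tau> * (2 * pi * real \<kappa>)) = of_real (s (0, 0, 2 * pi * real \<kappa>))"
    and l: "l \<in> L" "fst l = 0"
  shows "cis (c * fst (snd l) + \<tau> * snd (snd l)) = of_real (s l)"
proof -
  define A where "A t \<longleftrightarrow> (0, 0, t) \<in> L \<and> cis (\<tau> * t) = of_real (s (0, 0, t))" for t :: real
  have prod: "(0, 0, y) \<cdot> (0, z, t) = ((0, z, y + t) :: osc)" for y z t by (simp add: omega_def)
  have inv: "osc_inv (0, 0, z) = ((0, 0, - z) :: osc)" for z by (simp add: osc_inv_def)
  have "A 0" using one_L s_one by (simp add: A_def)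
  moreover have "A (y + z)" if yz: "A y" "A z" for y z
  proof -
    have "s (0, 0, y + z) = s (0, 0, y) * s (0, 0, z)"
      using s_mult[of "(0, 0, y)" "(0, 0, z)"] yz unfolding prod by (simp add: A_def)
    moreover have "(0, 0, y + z) \<in> L" using mult_L[of "(0, 0, y)" "(0, 0, z)"] yz unfolding prod by (simp add: A_def)
    ultimately show ?thesis using yz by (simp add: A_def distrib_left flip: cis_mult)
  qed
  moreover have "A (- z)" if z: "A z" for z
  proof -
    have "s (0, 0, - z) = s (0, 0, z)" using s_inv[of "(0, 0, z)"] z unfolding inv by (simp add: A_def)
    moreover have "(0, 0, - z) \<in> L" using inv_L[of "(0, 0, z)"] z unfolding inv by (simp add: A_def)
    moreover have "cis (\<tau> * - z) = cnj (cis (\<tau> * z))" by (simp add: cis_cnj)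
    ultimately show ?thesis using z by (simp add: A_def)
  qed
  moreover have "A (2 * pi * real \<kappa>)" using \<kappa>_mem \<tau> by (simp add: A_def)
  ultimately have mult: "A (of_int k * (2 * pi * real \<kappa>))" for k by (rule of_int_multiple)
  obtain z t where lz: "l = (0, z, t)" using l(2) by (cases l) auto
  have t: "A t" using time_L[OF l(1)] mult by (auto simp: lz)
  then have tL: "(0, 0, t) \<in> L" by (simp add: A_def)
  have "osc_inv (0, 0, t) \<cdot> l = (0, z, 0)" unfolding inv lz prod by simp
  then have zL: "(0, z, 0) \<in> L" using mult_L[OF inv_L[OF tL] l(1)] by simp
  have "l = (0, 0, t) \<cdot> (0, z, 0)" unfolding prod lz by simp
  then have "s l = s (0, 0, t) * s (0, z, 0)" using s_mult[OF tL zL] by simp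
  then show ?thesis using c[OF zL] t by (simp add: lz A_def mult.commute flip: cis_mult)
qed

subsection \<open>Equivariant packets\<close>

text \<open>This means that \<open>l\<close> moves the \<open>\<xi>\<close>-coordinate of \<open>g\<close> into the ball of radius \<open>\<delta>/2\<close>. Two such \<open>l\<close> differ by an element of
  \<open>L\<close> whose projection is shorter than \<open>\<delta>\<close>.\<close>

definition near :: "real \<Rightarrow> osc \<Rightarrow> osc \<Rightarrow> bool"
  where "near \<delta> g l \<longleftrightarrow> l \<in> L \<and> norm (fst l + fst g) < \<delta> / 2"

text \<open>The sum of \<open>s(l) f(l g)\<close> over all \<open>l\<close> in \<open>L\<close> modulo those over \<open>\<xi> = 0\<close>. If \<open>f\<close> is supported near \<open>\<xi> = 0\<close> at most one
  class contributes, and any representative that is near may be chosen.\<close>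

definition packet :: "real \<Rightarrow> (osc \<Rightarrow> complex) \<Rightarrow> osc \<Rightarrow> complex"
  where "packet \<delta> f g = (if \<exists>l. near \<delta> g l then s (SOME l. near \<delta> g l) *\<^sub>R f ((SOME l. near \<delta> g l) \<cdot> g) else 0)"

context
  fixes \<delta> :: real and f :: "osc \<Rightarrow> complex"
  assumes \<delta>: "\<delta> > 0" and gap: "\<And>l. l \<in> L \<Longrightarrow> norm (fst l) < \<delta> \<Longrightarrow> fst l = 0"
    and central: "\<And>l g. l \<in> L \<Longrightarrow> fst l = 0 \<Longrightarrow> f (l \<cdot> g) = s l *\<^sub>R f g"
    and supp: "\<And>g. norm (fst g) > \<delta> / 4 \<Longrightarrow> f g = 0"
begin

lemma packet_near:
  assumes l: "near \<delta> g l" shows "packet \<delta> f g = s l *\<^sub>R f (l \<cdot> g)"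
proof -
  define k where "k = (SOME l. near \<delta> g l)"
  have k: "near \<delta> g k" unfolding k_def using l by (rule someI)
  have kl: "k \<in> L" "l \<in> L" using k l by (simp_all add: near_def)
  define m where "m = k \<cdot> osc_inv l"
  have m: "m \<in> L" using kl by (simp add: m_def mult_L inv_L)
  have fst_m: "fst m = fst k - fst l" by (simp add: m_def fst_mult_L fst_inv_L kl)
  have "norm (fst m) = norm ((fst k + fst g) - (fst l + fst g))" by (simp add: fst_m)
  also have "\<dots> \<le> norm (fst k + fst g) + norm (fst l + fst g)" by (rule norm_triangle_ineq4)
  also have "\<dots> < \<delta>" using k l by (simp add: near_def)
  finally have m0: "fst m = 0" using gap[OF m] by blast
  have km: "k = m \<cdot> l" by (simp add: m_def osc_assoc)
  have "\<exists>l. near \<delta> g l" using l ..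
  then have "packet \<delta> f g = s k *\<^sub>R f (k \<cdot> g)"
    unfolding packet_def k_def[symmetric] by (simp only: if_True)
  also have "\<dots> = s l *\<^sub>R f (l \<cdot> g)"
  proof -
    have "s m * s l * s m = s l" using s_square[OF m] by algebra
    then show ?thesis
      unfolding km osc_assoc central[OF m m0, of "l \<cdot> g"] s_mult[OF m kl(2)] scaleR_scaleR by simp
  qed
  finally show ?thesis .
qed

lemma packet_far: "\<not> (\<exists>l. near \<delta> g l) \<Longrightarrow> packet \<delta> f g = 0"
  unfolding packet_def by (rule if_not_P)

lemma packet_equi: "equi (packet \<delta> f)"
  unfolding equi_def
proof (intro ballI allI)
  fix m g assume m: "m \<in> L"
  show "packet \<delta> f (m \<cdot> g) = s m *\<^sub>R packet \<delta> f g"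
  proof (cases "\<exists>l. near \<delta> (m \<cdot> g) l")
    case True
    then obtain l where l: "near \<delta> (m \<cdot> g) l" ..
    then have lL: "l \<in> L" by (simp add: near_def)
    have lm: "near \<delta> g (l \<cdot> m)" using l m by (simp add: near_def mult_L fst_mult_L add.assoc)
    show ?thesis unfolding packet_near[OF l] packet_near[OF lm]
      using s_mult[OF lL m] s_square[OF m] by (simp add: osc_assoc mult.left_commute)
  next
    case False
    have "\<not> (\<exists>l. near \<delta> g l)"
    proof
      assume "\<exists>l. near \<delta> g l"
      then obtain l where l: "near \<delta> g l" ..
      then have "near \<delta> (m \<cdot> g) (l \<cdot> osc_inv m)"
        using m by (simp add: near_def mult_L inv_L fst_mult_L fst_inv_L)
      then show False using False by blast
    qed
    from packet_far[OF this] show ?thesis unfolding packet_far[OF False] by simp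
  qed
qed

text \<open>The supports \<open>|\<xi>| \<le> \<delta>/4\<close> are strictly inside the balls of radius \<open>\<delta>/2\<close>, so that at points that are near no \<open>l\<close> the packet
  vanishes on a neighbourhood.\<close>

lemma packet_local:
  obtains (wave) U l where "open U" "g \<in> U" "l \<in> L" "\<And>h. h \<in> U \<Longrightarrow> packet \<delta> f h = s l *\<^sub>R f (l \<cdot> h)"
  | (zero) U where "open U" "g \<in> U" "\<And>h. h \<in> U \<Longrightarrow> packet \<delta> f h = 0"
proof (cases "\<exists>l. near \<delta> g l")
  case True
  then obtain l where l: "near \<delta> g l" ..
  define U where "U = {h :: osc. norm (fst l + fst h) < \<delta> / 2}"
  have "open U" unfolding U_def by (intro open_Collect_less continuous_intros)
  moreover have "g \<in> U" "l \<in> L" using l by (simp_all add: U_def near_def)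
  moreover have "packet \<delta> f h = s l *\<^sub>R f (l \<cdot> h)" if "h \<in> U" for h
    by (rule packet_near) (use that \<open>l \<in> L\<close> in \<open>simp add: near_def U_def\<close>)
  ultimately show ?thesis by (rule wave)
next
  case False
  define U where "U = {h :: osc. norm (fst h - fst g) < \<delta> / 8}"
  have "open U" unfolding U_def by (intro open_Collect_less continuous_intros)
  moreover have "g \<in> U" using \<delta> by (simp add: U_def)
  moreover have "packet \<delta> f h = 0" if h: "h \<in> U" for h
  proof (cases "\<exists>l. near \<delta> h l")
    case True
    then obtain l where l: "near \<delta> h l" ..
    then have lL: "l \<in> L" by (simp add: near_def)
    have "norm (fst l + fst g) \<ge> \<delta> / 2"
    proof (rule ccontr)
      assume "\<not> norm (fst l + fst g) \<ge> \<delta> / 2"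
      then have "near \<delta> g l" using lL by (simp add: near_def)
      then show False using False by blast
    qed
    moreover have "norm (fst l + fst g) \<le> norm (fst l + fst h) + norm (fst h - fst g)"
      using norm_triangle_ineq4[of "fst l + fst h" "fst h - fst g"] by simp
    ultimately have "norm (fst (l \<cdot> h)) > \<delta> / 4" using h \<delta> by (simp add: U_def fst_mult_L lL)
    then show ?thesis unfolding packet_near[OF l] by (simp add: supp)
  qed (rule packet_far)
  ultimately show ?thesis by (rule zero)
qed

lemma smooth_packet: assumes f: "smooth f" shows "smooth (packet \<delta> f)"
proof (rule smooth_local)
  fix g
  show "\<exists>U h. open U \<and> g \<in> U \<and> smooth h \<and> (\<forall>y\<in>U. packet \<delta> f y = h y)"
  proof (cases rule: packet_local[of g])
    case (wave U l)
    then show ?thesis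
      by (intro exI[of _ U] exI[of _ "\<lambda>h. s l *\<^sub>R f (l \<cdot> h)"] conjI ballI smooth_scaleR smooth_const smooth_translate f) simp_all
  next
    case (zero U)
    then show ?thesis by (intro exI[of _ U] exI[of _ "\<lambda>h. 0"] conjI ballI smooth_const) simp_all
  qed
qed

lemma left_deriv_packet:
  assumes f: "smooth f" and \<gamma>: "one_parameter \<gamma>" and eig: "\<And>g. left_deriv \<gamma> f g = a * f g"
  shows "left_deriv \<gamma> (packet \<delta> f) g = a * packet \<delta> f g"
proof (cases rule: packet_local[of g])
  case (wave U l)
  have "left_deriv \<gamma> (packet \<delta> f) g = left_deriv \<gamma> (\<lambda>h. s l *\<^sub>R f (l \<cdot> h)) g"
    by (rule left_deriv_local[OF wave(1,2,4) \<gamma>])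
  also have "\<dots> = s l *\<^sub>R left_deriv \<gamma> f (l \<cdot> g)"
    using left_deriv_bounded_linear[OF bounded_linear_scaleR_right \<gamma> smooth_translate[OF f, of l], of "s l" g]
      left_deriv_translate[of \<gamma> f l g] by simp
  finally show ?thesis unfolding eig wave(4)[OF wave(2)] by simp
next
  case (zero U)
  have "left_deriv \<gamma> (packet \<delta> f) g = left_deriv \<gamma> (\<lambda>h. 0) g"
    by (rule left_deriv_local[OF zero \<gamma>])
  then show ?thesis using zero(3)[OF zero(2)] by (simp add: left_deriv_def)
qed

lemma casimir_packet_bound:
  assumes f: "smooth f" and bound: "\<And>g. norm (casimir_op f g) \<le> B" and "B \<ge> 0"
  shows "norm (casimir_op (packet \<delta> f) g) \<le> B"
proof (cases rule: packet_local[of g])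
  case (wave U l)
  have "casimir_op (packet \<delta> f) g = casimir_op (\<lambda>h. s l *\<^sub>R f (l \<cdot> h)) g"
    by (rule casimir_op_local[OF wave(1,2,4)])
  also have "\<dots> = s l *\<^sub>R casimir_op f (l \<cdot> g)"
    using casimir_op_bounded_linear[OF bounded_linear_scaleR_right smooth_translate[OF f, of l], of "s l" g]
      casimir_op_translate[of f l g] by simp
  finally show ?thesis using bound[of "l \<cdot> g"] wave(3) by simp
next
  case (zero U)
  have "casimir_op (packet \<delta> f) g = casimir_op (\<lambda>h. 0) g"
    by (rule casimir_op_local[OF zero])
  then show ?thesis using \<open>B \<ge> 0\<close> by (simp add: casimir_op_def left_deriv_def)
qed

end

lemma norm_packet:
  assumes "\<And>g. norm (f g) = norm (f' g)" shows "norm (packet \<delta> f g) = norm (packet \<delta> f' g)"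
proof (cases "\<exists>l. near \<delta> g l")
  case True
  then have "near \<delta> g (SOME l. near \<delta> g l)" by (rule someI_ex)
  then have "(SOME l. near \<delta> g l) \<in> L" by (simp add: near_def)
  then show ?thesis using True assms by (simp add: packet_def)
qed (simp add: packet_def)

text \<open>The packets have \<open>\<tau> = - p\<^sup>2/(2c)\<close>, where \<open>p\<^sup>2 + 2 c \<tau> = 0\<close>. Equivariance under \<open>(0, 0, 2\<pi>\<kappa>)\<close> holds for the values
  \<open>\<tau> = - (n + \<theta>)/\<kappa>\<close>, for which \<open>p\<close> is unbounded. All packets have the same modulus.\<close>

lemma packets_exist:
  obtains c B n0 :: real where "c > 0" "n0 > 0"
    "\<And>R. \<exists>p f. p \<ge> R \<and> smooth f \<and> equi f \<and>
      (\<forall>g. left_deriv exp_T f g = - (\<i> * of_real (p\<^sup>2 / (2 * c))) * f g) \<and>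
      (\<forall>g. norm (casimir_op f g) \<le> B * (1 + p)) \<and> (\<integral>g. (norm (f g :: complex))\<^sup>2 \<partial>M) = n0\<^sup>2"
proof -
  obtain \<delta> where \<delta>: "\<delta> > 0" "\<And>l. l \<in> L \<Longrightarrow> norm (fst l) < \<delta> \<Longrightarrow> fst l = 0" using projection_gap by blast
  obtain c where c: "c > 0" "\<And>z. (0, z, 0) \<in> L \<Longrightarrow> cis (c * z) = of_real (s (0, z, 0))"
    using central_frequency by blast
  define \<theta> :: real where "\<theta> = (if s (0, 0, 2 * pi * real \<kappa>) = 1 then 0 else 1 / 2)"
  define \<beta> where "\<beta> \<xi> = complex_of_real (flat ((\<delta> / 4)\<^sup>2 - ((Re \<xi>)\<^sup>2 + (Im \<xi>)\<^sup>2)))" for \<xi>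
  have \<beta>: "smooth \<beta>" unfolding \<beta>_def[abs_def]
    by (intro smooth_of_real smooth_flat_compose smooth_diff smooth_add smooth_const smooth_power smooth_Re smooth_Im smooth_id)
  have \<beta>_supp: "\<beta> \<xi> = 0" if "norm \<xi> > \<delta> / 4" for \<xi>
  proof -
    have "(\<delta> / 4)\<^sup>2 \<le> (norm \<xi>)\<^sup>2" using that \<delta>(1) by (intro power_mono) simp_all
    then show ?thesis by (simp add: \<beta>_def flat_def cmod_power2)
  qed
  have d_supp: "dir_deriv v \<gamma> \<xi> = 0" if "\<And>\<xi>. norm \<xi> > \<delta> / 4 \<Longrightarrow> \<gamma> \<xi> = 0" "norm \<xi> > \<delta> / 4"
    for v \<xi> and \<gamma> :: "complex \<Rightarrow> complex"
  proof (rule dir_derivI)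
    have "open {\<xi> :: complex. norm \<xi> > \<delta> / 4}" by (intro open_Collect_less continuous_intros)
    then show "(\<gamma> has_derivative (\<lambda>v. 0)) (at \<xi>)"
      by (rule has_derivative_transform_within_open[OF has_derivative_const[of 0]]) (use that in simp_all)
  qed
  define \<beta>1 where "\<beta>1 \<xi> = 2 * \<i> * dir_deriv 1 \<beta> \<xi> + of_real (c * Im \<xi>) * \<beta> \<xi>" for \<xi>
  define \<beta>0 where "\<beta>0 \<xi> = dir_deriv 1 (dir_deriv 1 \<beta>) \<xi> + dir_deriv \<i> (dir_deriv \<i> \<beta>) \<xi>
        + \<i> * of_real c * (of_real (Re \<xi>) * dir_deriv \<i> \<beta> \<xi> - of_real (Im \<xi>) * dir_deriv 1 \<beta> \<xi>)
        - of_real (c\<^sup>2 * ((Re \<xi>)\<^sup>2 + (Im \<xi>)\<^sup>2) / 4) * \<beta> \<xi>" for \<xi>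
  have "smooth \<beta>1" unfolding \<beta>1_def[abs_def]
    by (intro smooth_add smooth_mult smooth_const smooth_dir_deriv smooth_of_real smooth_Im smooth_id \<beta>)
  moreover have "\<beta>1 \<xi> = 0" if "norm \<xi> > \<delta> / 4" for \<xi> using that \<beta>_supp d_supp by (simp add: \<beta>1_def)
  ultimately have "\<exists>B\<ge>0. \<forall>\<xi>. norm (\<beta>1 \<xi>) \<le> B"
    by (rule bounded_if_zero_outside_ball[OF smooth_continuous_on])
  then obtain B1 where "B1 \<ge> 0 \<and> (\<forall>\<xi>. norm (\<beta>1 \<xi>) \<le> B1)" ..
  then have B1: "B1 \<ge> 0" "norm (\<beta>1 \<xi>) \<le> B1" for \<xi> by simp_all
  have "smooth \<beta>0" unfolding \<beta>0_def[abs_def]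
    by (intro smooth_add smooth_diff smooth_mult smooth_const smooth_dir_deriv smooth_of_real smooth_Im smooth_Re smooth_divide_const
        smooth_power smooth_id \<beta>)
  moreover have "\<beta>0 \<xi> = 0" if "norm \<xi> > \<delta> / 4" for \<xi> using that \<beta>_supp d_supp by (simp add: \<beta>0_def)
  ultimately have "\<exists>B\<ge>0. \<forall>\<xi>. norm (\<beta>0 \<xi>) \<le> B"
    by (rule bounded_if_zero_outside_ball[OF smooth_continuous_on])
  then obtain B0 where "B0 \<ge> 0 \<and> (\<forall>\<xi>. norm (\<beta>0 \<xi>) \<le> B0)" ..
  then have B0: "B0 \<ge> 0" "norm (\<beta>0 \<xi>) \<le> B0" for \<xi> by simp_all
  define f where "f p = plane_wave p c (- (p\<^sup>2 / (2 * c))) \<beta>" for p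
  have f: "smooth (f p)" for p unfolding f_def by (rule smooth_plane_wave[OF \<beta>])
  have supp: "f p g = 0" if "norm (fst g) > \<delta> / 4" for p g using \<beta>_supp[OF that] by (simp add: f_def plane_wave_def)
  have norm_f: "norm (f p g) = norm (f 0 g)" for p g by (simp add: f_def plane_wave_def norm_mult)
  have cas_f: "norm (casimir_op (f p) g) \<le> (B0 + B1) * (1 + p)" if p: "p \<ge> 0" for p g
  proof -
    have "casimir_op (f p) g = plane_wave p c (- (p\<^sup>2 / (2 * c))) (\<lambda>\<xi>. of_real p * \<beta>1 \<xi> + \<beta>0 \<xi>) g"
      unfolding f_def \<beta>1_def \<beta>0_def by (rule casimir_plane_wave[OF \<beta>]) (use c(1) in simp)
    then have "norm (casimir_op (f p) g) = norm (of_real p * \<beta>1 (fst g) + \<beta>0 (fst g))"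
      by (simp add: plane_wave_def norm_mult)
    also have "\<dots> \<le> p * norm (\<beta>1 (fst g)) + norm (\<beta>0 (fst g))"
      by (rule order_trans[OF norm_triangle_ineq]) (simp add: norm_mult p)
    also have "\<dots> \<le> p * B1 + B0" by (intro add_mono mult_left_mono B1 B0 p)
    also have "\<dots> \<le> (B0 + B1) * (1 + p)" using p B0(1) B1(1) by (simp add: algebra_simps)
    finally show ?thesis .
  qed
  have T_f: "left_deriv exp_T (f p) g = - (\<i> * of_real (p\<^sup>2 / (2 * c))) * f p g" for p g
    unfolding left_deriv_coordinates(4)[OF f] unfolding f_def dir_deriv_plane_wave[OF \<beta>]
    using linear_0[OF has_derivative_linear[OF smooth_has_derivative[OF \<beta>]]] by (simp add: plane_wave_def)
  define pn where "pn n = sqrt (2 * c * (real n + \<theta>) / real \<kappa>)" for n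
  have \<theta>: "\<theta> \<ge> 0" by (simp add: \<theta>_def)
  have pn2: "(pn n)\<^sup>2 / (2 * c) = (real n + \<theta>) / real \<kappa>" for n
    unfolding pn_def using c(1) \<theta> by simp
  have pn0: "pn n \<ge> 0" for n unfolding pn_def using c(1) \<theta> by simp
  have phase: "cis (- ((pn n)\<^sup>2 / (2 * c)) * (2 * pi * real \<kappa>)) = of_real (s (0, 0, 2 * pi * real \<kappa>))" for n
  proof -
    have e: "- ((pn n)\<^sup>2 / (2 * c)) * (2 * pi * real \<kappa>) = 2 * pi * (- real n) + - (2 * pi * \<theta>)"
      unfolding pn2 using \<kappa>_pos by (simp add: field_simps)
    have "cis (- ((pn n)\<^sup>2 / (2 * c)) * (2 * pi * real \<kappa>)) = cis (2 * pi * (- real n)) * cis (- (2 * pi * \<theta>))"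
      by (simp only: e cis_mult)
    also have "cis (2 * pi * (- real n)) = 1" by (rule cis_multiple_2pi) simp
    also have "cis (- (2 * pi * \<theta>)) = of_real (s (0, 0, 2 * pi * real \<kappa>))"
      using s_sign[OF \<kappa>_mem] by (auto simp: \<theta>_def simp flip: cis_cnj)
    finally show ?thesis by simp
  qed
  have central: "f (pn n) (l \<cdot> g) = s l *\<^sub>R f (pn n) g" if l: "l \<in> L" "fst l = 0" for n l g
  proof -
    have ph: "cis (c * fst (snd l) + - ((pn n)\<^sup>2 / (2 * c)) * snd (snd l)) = of_real (s l)"
      by (rule phase_on_centre[OF c(2) phase l])
    have "l \<cdot> g = (fst g, fst (snd l) + fst (snd g), snd (snd l) + snd (snd g))"
      using l cis_lattice[OF l(1)] by (simp add: osc_mult_eq omega_def)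
    then have "f (pn n) (l \<cdot> g) = cis (c * fst (snd l) + - ((pn n)\<^sup>2 / (2 * c)) * snd (snd l)) * f (pn n) g"
      by (simp add: f_def plane_wave_def cis_mult algebra_simps add_divide_distrib)
    then show ?thesis unfolding ph by (simp add: scaleR_conv_of_real)
  qed
  note pk = \<delta> central supp
  have pk_norm: "norm (packet \<delta> (f p) g) = norm (packet \<delta> (f (pn 0)) g)" for p g
    by (rule norm_packet) (simp only: norm_f[of p] norm_f[of "pn 0"])
  define n0 where "n0 = sqrt (\<integral>g. (norm (packet \<delta> (f (pn 0)) g))\<^sup>2 \<partial>M)"
  have n0_sq: "(\<integral>g. (norm (packet \<delta> (f p) g))\<^sup>2 \<partial>M) = n0\<^sup>2" for p
    unfolding pk_norm[of p] n0_def by simp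
  have "n0 > 0"
  proof -
    define A :: "complex \<Rightarrow> spinor" where "A z = (\<chi> i. if i = 1 then z else 0)" for z
    have A_norm: "norm (A z) = norm z" for z by (simp add: A_def norm_vec_def L2_set_def sum_4)
    have "linear A" unfolding A_def by (rule linearI) (simp_all add: vec_eq_iff)
    then have A: "bounded_linear A" by (simp add: linear_conv_bounded_linear)
    define w where "w g = A (packet \<delta> (f (pn 0)) g)" for g
    have "smooth w" unfolding w_def[abs_def]
      by (rule smooth_bounded_linear[OF A smooth_packet[OF pk f]])
    moreover have "equi w" unfolding w_def[abs_def]
      by (rule equi_linear[OF bounded_linear.linear[OF A] packet_equi[OF pk]])
    ultimately have w: "w \<in> sections" by (simp add: sections_def)
    have near1: "near \<delta> osc_one osc_one" using \<delta>(1) one_L by (simp add: near_def)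
    have "flat ((\<delta> / 4)\<^sup>2) > 0" unfolding flat_pos_iff using \<delta>(1) by simp
    then have "f (pn 0) osc_one \<noteq> 0" by (simp add: f_def plane_wave_def \<beta>_def)
    moreover have "packet \<delta> (f (pn 0)) osc_one = s osc_one *\<^sub>R f (pn 0) (osc_one \<cdot> osc_one)"
      by (rule packet_near[OF pk near1])
    ultimately have "norm (w osc_one) \<noteq> 0" unfolding w_def A_norm by (simp add: s_one)
    then have "l2_norm L w \<noteq> 0" by (intro l2_norm_nonzero[OF w, of osc_one]) simp
    then have "n0 \<noteq> 0" by (simp add: l2_norm_def n0_def w_def A_norm)
    moreover have "n0 \<ge> 0" by (simp add: n0_def)
    ultimately show ?thesis by simp
  qed
  moreover have "\<exists>p f. p \<ge> R \<and> smooth f \<and> equi f \<and>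
      (\<forall>g. left_deriv exp_T f g = - (\<i> * of_real (p\<^sup>2 / (2 * c))) * f g) \<and>
      (\<forall>g. norm (casimir_op f g) \<le> (B0 + B1) * (1 + p)) \<and> (\<integral>g. (norm (f g :: complex))\<^sup>2 \<partial>M) = n0\<^sup>2" for R
  proof -
    obtain n where n: "R\<^sup>2 * real \<kappa> / (2 * c) \<le> real n" using real_arch_simple by blast
    have "R\<^sup>2 \<le> (pn n)\<^sup>2"
    proof -
      have "R\<^sup>2 * real \<kappa> / (2 * c) \<le> real n + \<theta>" using n \<theta> by simp
      then have "R\<^sup>2 \<le> 2 * c * (real n + \<theta>) / real \<kappa>" using c(1) \<kappa>_pos by (simp add: field_simps)
      also have "\<dots> = (pn n)\<^sup>2" unfolding pn_def using c(1) \<theta> by simp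
      finally show ?thesis .
    qed
    note pk' = \<delta> central[of _ n] supp[of _ "pn n"]
    have R: "pn n \<ge> R" by (rule power2_le_imp_le[OF \<open>R\<^sup>2 \<le> (pn n)\<^sup>2\<close> pn0])
    have b: "0 \<le> (B0 + B1) * (1 + pn n)" using B0(1) B1(1) pn0[of n] by simp
    have cas: "norm (casimir_op (packet \<delta> (f (pn n))) g) \<le> (B0 + B1) * (1 + pn n)" for g
      by (rule casimir_packet_bound[OF pk' f cas_f[OF pn0] b])
    show ?thesis
    proof (intro exI conjI allI)
      show "pn n \<ge> R" by (rule R)
      show "smooth (packet \<delta> (f (pn n)))" by (rule smooth_packet[OF pk' f])
      show "equi (packet \<delta> (f (pn n)))" by (rule packet_equi[OF pk'])
      show "left_deriv exp_T (packet \<delta> (f (pn n))) g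
          = - (\<i> * of_real ((pn n)\<^sup>2 / (2 * c))) * packet \<delta> (f (pn n)) g" for g
        by (rule left_deriv_packet[OF pk' f one_parameter_exp(4) T_f])
      show "norm (casimir_op (packet \<delta> (f (pn n))) g) \<le> (B0 + B1) * (1 + pn n)" for g by (rule cas)
      show "(\<integral>g. (norm (packet \<delta> (f (pn n)) g))\<^sup>2 \<partial>M) = n0\<^sup>2" by (rule n0_sq)
    qed
  qed
  ultimately show ?thesis by (rule that[OF c(1)])
qed

end

section \<open>Basic lattices\<close>

lemma m_inv_Osc: "inv\<^bsub>Osc\<^esub> g = osc_inv g"
  by (rule group.inv_equality[OF group_Osc]) (simp_all add: Osc_def)

text \<open>The time coordinates of \<open>L\<close> are multiples of \<open>2\<pi>\<kappa>\<close>, because those of the generators are. Multiplication by a power of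
  \<open>(0, 0, 2\<pi>\<kappa>)\<close> therefore takes \<open>L\<close> to \<open>L \<inter> H\<close> and preserves the projection to \<open>\<xi>\<close>, whose values on \<open>L \<inter> H\<close> are discrete
  because \<open>L\<close> is normalised.\<close>

lemma basic_lattice_sign:
  assumes basic: "basic_lattice L" and \<epsilon>: "\<epsilon> \<in> hom (Osc\<lparr>carrier := L\<rparr>) (integer_mod_group 2)"
  shows "\<exists>\<kappa>. basic_osc_lattice L (\<lambda>l. (-1) ^ nat (\<epsilon> l)) \<kappa>"
proof -
  obtain \<Gamma> and \<kappa> :: nat where \<Gamma>: "group_lattice Heis \<Gamma>" and \<kappa>: "\<kappa> > 0"
    and gen: "L = generate Osc (insert (0, 0, 2 * pi * real \<kappa>) \<Gamma>)"
    using basic unfolding basic_lattice_def by blast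
  have lattice: "group_lattice Osc L" and norm: "normalised L" using basic by (simp_all add: basic_lattice_def)
  have sub: "subgroup L Osc" using lattice by (simp add: group_lattice_def)
  have mult: "k \<cdot> l \<in> L" if "k \<in> L" "l \<in> L" for k l
    using subgroup.m_closed[OF sub that] by (simp add: Osc_def)
  have inv: "osc_inv l \<in> L" if "l \<in> L" for l
    using subgroup.m_inv_closed[OF sub that] by (simp add: m_inv_Osc)
  have one: "osc_one \<in> L" using subgroup.one_closed[OF sub] by (simp add: Osc_def)
  have "subgroup \<Gamma> Heis" using \<Gamma> by (simp add: group_lattice_def)
  then have "\<Gamma> \<subseteq> heis" using subgroup.subset by fastforce
  have \<kappa>_mem: "(0, 0, 2 * pi * real \<kappa>) \<in> L" unfolding gen by (rule generate.incl) simp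
  have gen_time: "\<exists>k::int. snd (snd h) = of_int k * (2 * pi * real \<kappa>)" if "h \<in> insert (0, 0, 2 * pi * real \<kappa>) \<Gamma>" for h
    using that
  proof
    assume "h = (0, 0, 2 * pi * real \<kappa>)"
    then show ?thesis by (intro exI[of _ 1]) simp
  next
    assume "h \<in> \<Gamma>"
    then have "snd (snd h) = 0" using \<open>\<Gamma> \<subseteq> heis\<close> by (auto simp: heis_def)
    then show ?thesis by (intro exI[of _ 0]) simp
  qed
  have time: "\<exists>k::int. snd (snd l) = of_int k * (2 * pi * real \<kappa>)" if "l \<in> L" for l
    using that unfolding gen
  proof (induction rule: generate.induct)
    case one
    show ?case by (intro exI[of _ 0]) (simp add: Osc_def)
  next
    case (incl h)
    then show ?case by (rule gen_time)
  next
    case (inv h)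
    then obtain k :: int where "snd (snd h) = of_int k * (2 * pi * real \<kappa>)" using gen_time by blast
    then show ?case by (intro exI[of _ "- k"]) (simp add: m_inv_Osc osc_inv_def)
  next
    case (eng h1 h2)
    from eng.IH obtain j k :: int where "snd (snd h1) = of_int j * (2 * pi * real \<kappa>)"
      "snd (snd h2) = of_int k * (2 * pi * real \<kappa>)" by blast
    then show ?case by (intro exI[of _ "j + k"]) (simp add: Osc_def osc_mult_eq distrib_right)
  qed
  have cis: "cis (snd (snd l)) = 1" if "l \<in> L" for l
  proof -
    obtain k :: int where "snd (snd l) = of_int k * (2 * pi * real \<kappa>)" using time[OF \<open>l \<in> L\<close>] by blast
    then have "snd (snd l) = 2 * pi * (of_int k * real \<kappa>)" by simp
    moreover have "cis (2 * pi * (of_int k * real \<kappa>)) = 1" by (rule cis_multiple_2pi) simp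
    ultimately show ?thesis by (simp only:)
  qed
  have "fst ` L = fst ` (L \<inter> heis)"
  proof (intro equalityI subsetI)
    fix \<xi> assume "\<xi> \<in> fst ` L"
    then obtain l where l: "l \<in> L" "\<xi> = fst l" by blast
    obtain k :: int where k: "snd (snd l) = of_int k * (2 * pi * real \<kappa>)" using time[OF l(1)] by blast
    have "(0, 0, of_int k * (2 * pi * real \<kappa>)) \<in> L"
    proof (rule of_int_multiple[of "\<lambda>t. (0, 0, t) \<in> L"])
      show "(0, 0, x + y) \<in> L" if "(0, 0, x) \<in> L" "(0, 0, y) \<in> L" for x y
        using mult[OF that] by (simp add: omega_def)
      show "(0, 0, - x) \<in> L" if "(0, 0, x) \<in> L" for x
        using inv[OF that] by (simp add: osc_inv_def)
    qed (rule one, rule \<kappa>_mem)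
    from mult[OF l(1) inv[OF this]]
    have "l \<cdot> osc_inv (0, 0, of_int k * (2 * pi * real \<kappa>)) \<in> L \<inter> heis"
      using k by (simp add: heis_def osc_mult_eq osc_inv_def split_beta)
    moreover have "\<xi> = fst (l \<cdot> osc_inv (0, 0, of_int k * (2 * pi * real \<kappa>)))"
      using l(2) by (simp add: osc_mult_eq osc_inv_def)
    ultimately show "\<xi> \<in> fst ` (L \<inter> heis)" by blast
  qed blast
  moreover have "discrete (fst ` (L \<inter> heis))" using norm by (simp add: normalised_def group_lattice_def)
  ultimately have discrete: "discrete (fst ` L)" by simp
  have \<epsilon>_range: "\<epsilon> l = 0 \<or> \<epsilon> l = 1" if "l \<in> L" for l
  proof -
    have "\<epsilon> l \<in> carrier (integer_mod_group 2)" using \<epsilon> that by (simp add: hom_def Pi_iff)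
    then show ?thesis by (auto simp: carrier_integer_mod_group)
  qed
  have \<epsilon>_mult: "\<epsilon> (k \<cdot> l) = (\<epsilon> k + \<epsilon> l) mod 2" if "k \<in> L" "l \<in> L" for k l
    using \<epsilon> that by (simp add: hom_def Osc_def)
  have "basic_osc_lattice L (\<lambda>l. (-1) ^ nat (\<epsilon> l)) \<kappa>"
  proof (unfold_locales)
    show "(-1) ^ nat (\<epsilon> (k \<cdot> l)) = ((-1) ^ nat (\<epsilon> k) * (-1) ^ nat (\<epsilon> l) :: real)" if "k \<in> L" "l \<in> L" for k l
      using \<epsilon>_range[OF that(1)] \<epsilon>_range[OF that(2)] by (elim disjE) (simp_all add: \<epsilon>_mult that)
    show "(-1) ^ nat (\<epsilon> l) = (1 :: real) \<or> (-1) ^ nat (\<epsilon> l) = (-1 :: real)" if "l \<in> L" for l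
      using \<epsilon>_range[OF that] by auto
  qed (fact lattice cis discrete \<kappa> \<kappa>_mem time)+
  then show ?thesis by blast
qed

lemma sign_scaleR: "(-1) ^ n *s v = (-1) ^ n *\<^sub>R (v :: spinor)"
  by (cases "even n") (simp_all add: vec_eq_iff)

lemma in_neg_casimir_closure: "(\<psi>, \<zeta>) \<in> neg_casimir_closure L \<epsilon> \<longleftrightarrow> (\<psi>, \<lambda>g. - \<zeta> g) \<in> casimir_closure L \<epsilon>"
proof
  assume "(\<psi>, \<zeta>) \<in> neg_casimir_closure L \<epsilon>"
  then obtain \<phi> where "(\<psi>, \<phi>) \<in> casimir_closure L \<epsilon>" "\<zeta> = (\<lambda>g. - \<phi> g)"
    unfolding neg_casimir_closure_def by blast
  then show "(\<psi>, \<lambda>g. - \<zeta> g) \<in> casimir_closure L \<epsilon>" by simp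
next
  assume *: "(\<psi>, \<lambda>g. - \<zeta> g) \<in> casimir_closure L \<epsilon>"
  show "(\<psi>, \<zeta>) \<in> neg_casimir_closure L \<epsilon>"
    unfolding neg_casimir_closure_def mem_Collect_eq
    by (rule exI[of _ \<psi>], rule exI[of _ "\<lambda>g. - \<zeta> g"]) (simp add: *)
qed

theorem theorem1p1:
  fixes L :: "osc set" and \<epsilon> :: "osc \<Rightarrow> int"
  assumes "basic_lattice L"
    and "\<epsilon> \<in> hom (Osc\<lparr>carrier := L\<rparr>) (integer_mod_group 2)"
  shows
    "spectrum (L2_sections L \<epsilon>) (l2_norm L) (dirac_closure L \<epsilon>) = UNIV \<and>
     point_spectrum (l2_norm L) (dirac_closure L \<epsilon>) =
       {\<nu>. \<nu> = 0 \<and> kernel_nontrivial (l2_norm L) (casimir_closure L \<epsilon>)} \<union>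
       {\<nu>. \<exists>\<mu> \<in> point_spectrum (l2_norm L) (neg_casimir_closure L \<epsilon>). \<mu> \<noteq> 0 \<and> \<nu>\<^sup>2 = \<mu>} \<and>
     residual_spectrum (L2_sections L \<epsilon>) (l2_norm L) (dirac_closure L \<epsilon>) = {}"
proof -
  define s :: "osc \<Rightarrow> real" where "s l = (-1) ^ nat (\<epsilon> l)" for l
  obtain \<kappa> where "basic_osc_lattice L s \<kappa>"
    using basic_lattice_sign[OF assms] unfolding s_def[abs_def] by blast
  then interpret basic_osc_lattice L s \<kappa> .
  have eq: "equivariant L \<epsilon> = equi"
    by (rule ext) (simp add: equivariant_def equi_def sign_scaleR s_def Osc_def)
  have L2: "L2_sections L \<epsilon> = L2" unfolding L2_sections_def L2_def eq ..
  have sections: "smooth_sections L \<epsilon> = sections" unfolding smooth_sections_def sections_def eq ..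
  have dirac: "dirac_closure L \<epsilon> = closed_dirac" unfolding dirac_closure_def closed_dirac_def L2 sections ..
  have casimir: "casimir_closure L \<epsilon> = closed_casimir"
    unfolding casimir_closure_def closed_casimir_def L2 sections casimir_eq ..
  define E where "E c \<longleftrightarrow> (\<exists>u\<in>sections. l2_norm L u \<noteq> 0 \<and> (\<forall>g. casimir_op u g = c *s u g))" for c
  have resolvent: "resolvent_set L2 (l2_norm L) closed_dirac = {}"
    by (rule packets_exist) (rule dirac_resolvent_empty)
  have kernel: "kernel_nontrivial (l2_norm L) closed_casimir \<longleftrightarrow> E 0"
    using eigenvalue_casimir_iff[of 0] by (simp add: kernel_nontrivial_def E_def)
  have neg: "\<mu> \<in> point_spectrum (l2_norm L) (neg_casimir_closure L \<epsilon>) \<longleftrightarrow> E (- \<mu>)" for \<mu>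
  proof -
    have "(\<lambda>g. - (\<mu> *s \<psi> g)) = (\<lambda>g. (- \<mu>) *s \<psi> g)" for \<psi> :: "osc \<Rightarrow> spinor"
      by (simp add: fun_eq_iff vec_eq_iff)
    then show ?thesis
      unfolding point_spectrum_def mem_Collect_eq in_neg_casimir_closure casimir E_def
      by (simp only: eigenvalue_casimir_iff)
  qed
  have point: "\<nu> \<in> point_spectrum (l2_norm L) closed_dirac \<longleftrightarrow> E (- (\<nu>\<^sup>2))" for \<nu>
    unfolding E_def by (rule point_spectrum_dirac_iff)
  show ?thesis
    unfolding L2 dirac
  proof (intro conjI)
    show "spectrum L2 (l2_norm L) closed_dirac = UNIV" by (simp add: spectrum_def resolvent)
    show "point_spectrum (l2_norm L) closed_dirac =
       {\<nu>. \<nu> = 0 \<and> kernel_nontrivial (l2_norm L) (casimir_closure L \<epsilon>)} \<union>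
       {\<nu>. \<exists>\<mu> \<in> point_spectrum (l2_norm L) (neg_casimir_closure L \<epsilon>). \<mu> \<noteq> 0 \<and> \<nu>\<^sup>2 = \<mu>}"
      unfolding set_eq_iff Un_iff mem_Collect_eq Bex_def casimir kernel neg point
      by (metis neg_0_equal_iff_equal power_zero_numeral zero_eq_power2)
    show "residual_spectrum L2 (l2_norm L) closed_dirac = {}"
      unfolding residual_spectrum_def using dense_range by blast
  qed
qed

end
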